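(* Let $\mathbb{G}$ be a Carnot group of homogeneous dimension $Q$, let $d$ be a left-invariant distance on $\mathbb{G}$ associated with a homogeneous norm, let $1\le p<Q$ and $\lambda>1$, and set $B:=B_d(e,1)$, $B':=B_d(e,\lambda)$. Let $q$ satisfy (i) $1\le q\le \frac{pQ}{Q-p}$ if $p>1$, or (ii) $1\le q<\frac{Q}{Q-1}$ if $p=1$. Then there exists a constant $C=C(p,q,\lambda,B)$ such that for every $f\in L^p(B)$ compactly supported in $B$ with $\int_B f(x)\,dx=0$ there exists a horizontal vector field $F\in L^q(B',V_1)$, compactly supported in $B'$, such that $$f=\mathrm{div}_{\mathbb{G}}F\quad\text{in } B \qquad\text{and}\qquad \|F\|_{L^q(B',V_1)}\le C\,\|f\|_{L^p(B)} .$$ Moreover, if $p>1$ and $q=\frac{pQ}{Q-p}$, the constant $C$ does not depend on the ball: one and the same $C$ (depending on $p$, $\lambda$, $\mathbb{G}$, $d$) works when $B,B'$ are replaced by $B_d(x,r),B_d(x,\lambda r)$ for any $x\in\mathbb{G}$, $r>0$.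
   Context: A Carnot group $\mathbb{G}$ of step $\kappa$ is a connected, simply connected Lie group whose Lie algebra $\mathfrak{g}$, of dimension $n$, has a stratification $\mathfrak{g}=V_1\oplus\dots\oplus V_\kappa$ with $[V_1,V_i]=V_{i+1}$, $V_\kappa\ne\{0\}$, $V_i=\{0\}$ for $i>\kappa$. Its homogeneous dimension is $Q=\sum_{i=1}^\kappa i\dim V_i$. Fix a basis $e_1,\dots,e_n$ of $\mathfrak{g}$ adapted to the stratification; $X_1,\dots,X_n$ are the corresponding left-invariant vector fields, and $X_1,\dots,X_{m_1}$ ($m_1=\dim V_1$) are those corresponding to the basis of $V_1$. $\mathfrak{g}$ has the scalar product making $X_1,\dots,X_n$ orthonormal. $\mathbb{G}$ is identified with $\mathfrak{g}\cong\mathbb{R}^n$ through exponential coordinates (product given by the Baker–Campbell–Hausdorff formula); $e=0$ is the identity, and integrals are with respect to Lebesgue measure, which is the Haar measure. The dilations $\delta_\lambda$ ($\lambda>0$) are the automorphisms acting on $V_i$ as multiplication by $\lambda^i$. A homogeneous norm is a continuous function $\|\cdot\|:\mathbb{G}\to[0,\infty)$ with $\|p\|=0\iff p=e$, $\|p^{-1}\|=\|p\|$, $\|\delta_\lambda p\|=\lambda\|p\|$ and $\|p\cdot q\|\le\|p\|+\|q\|$ for all $p,q\in\mathbb{G}$, $\lambda>0$. The associated left-invariant distance is $d(p,q)=\|p^{-1}q\|$, and $B_d(p,r)$ is the open $d$-ball with center $p$ and radius $r$. $V_1$ also denotes the horizontal bundle, spanned at each point by $X_1,\dots,X_{m_1}$;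 a horizontal vector field is $F=\sum_{i=1}^{m_1}F_iX_i$. $L^q(B',V_1)$ is the space of such $F$ with $F_i\in L^q(B')$, with norm computed from the pointwise norm $|F|=(\sum_i F_i^2)^{1/2}$. The horizontal divergence is $\mathrm{div}_{\mathbb{G}}F=\sum_{j=1}^{m_1}X_jF_j$ in the sense of distributions. *)

theory Defs
  imports "HOL-Analysis.Analysis"
begin

section \<open>Stratified Lie algebras\<close>

text \<open>
  The Lie algebra lives on a Euclidean space \<open>'a\<close>, whose standard basis \<^const>\<open>Basis\<close> plays the
  role of the basis $e_1,\dots,e_n$ adapted to the stratification. Accordingly the inner product
  of \<open>'a\<close> is the scalar product making the basis orthonormal, and \<^const>\<open>lebesgue\<close> is Lebesgue
  measure in the corresponding coordinates. Only the values of \<open>layer\<close> at positive indices matter.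
\<close>

record 'a stratified =
  bracket :: "'a \<Rightarrow> 'a \<Rightarrow> 'a"
  layer :: "nat \<Rightarrow> 'a set"
  step :: nat

definition lie_algebra :: "('a::euclidean_space \<Rightarrow> 'a \<Rightarrow> 'a) \<Rightarrow> bool" where
  "lie_algebra br \<longleftrightarrow>
     bilinear br \<and> (\<forall>x. br x x = 0) \<and>
     (\<forall>x y z. br x (br y z) + br y (br z x) + br z (br x y) = 0)"

definition carnot :: "('a::euclidean_space) stratified \<Rightarrow> bool" where
  "carnot G \<longleftrightarrow>
     lie_algebra (bracket G) \<and>
     1 \<le> step G \<and>
     (\<forall>i\<ge>1. subspace (layer G i)) \<and>
     (\<forall>x. \<exists>!v. v \<in> (\<Pi>\<^sub>E i\<in>{1..step G}. layer G i) \<and> x = (\<Sum>i=1..step G. v i)) \<and>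
     (\<forall>i\<ge>1. span {bracket G x y | x y. x \<in> layer G 1 \<and> y \<in> layer G i} = layer G (Suc i)) \<and>
     layer G (step G) \<noteq> {0} \<and>
     (\<forall>i>step G. layer G i = {0}) \<and>
     Basis \<subseteq> (\<Union>i\<in>{1..step G}. layer G i)"

definition hom_dim :: "('a::euclidean_space) stratified \<Rightarrow> nat" where
  "hom_dim G = (\<Sum>i=1..step G. i * dim (layer G i))"

definition hbasis :: "('a::euclidean_space) stratified \<Rightarrow> 'a set" where
  "hbasis G = Basis \<inter> layer G 1"


section \<open>The group in exponential coordinates\<close>

fun lie_word :: "('a::real_vector \<Rightarrow> 'a \<Rightarrow> 'a) \<Rightarrow> 'a list \<Rightarrow> 'a" where
  "lie_word br [] = 0"
| "lie_word br [x] = x"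
| "lie_word br (x # y # zs) = br x (lie_word br (y # zs))"

definition bch_index :: "nat \<Rightarrow> (nat \<times> nat) list set" where
  "bch_index k =
     {rs. rs \<noteq> [] \<and> (\<forall>(r, s)\<in>set rs. 0 < r + s) \<and> (\<Sum>(r, s)\<leftarrow>rs. r + s) \<le> k}"

text \<open>
  The Baker--Campbell--Hausdorff formula in Dynkin's form,
  \[
    x\cdot y = \sum_{k\ge 1} \frac{(-1)^{k-1}}{k} \sum_{r_i+s_i>0}
      \frac{[x^{r_1}y^{s_1}\cdots x^{r_k}y^{s_k}]}{\sum_i (r_i+s_i)\, \prod_i r_i!\, s_i!},
  \]
  where $[z_1\cdots z_m] = [z_1,[z_2,\dots[z_{m-1},z_m]\dots]]$ and $[z_1]=z_1$. A summand of total
  degree $\sum_i (r_i+s_i)$ greater than the step vanishes, so it is left out here.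
\<close>

definition mult :: "('a::euclidean_space) stratified \<Rightarrow> 'a \<Rightarrow> 'a \<Rightarrow> 'a" where
  "mult G x y =
     (\<Sum>rs\<in>bch_index (step G).
        ((-1) ^ (length rs - 1) /
           (real (length rs) * real (\<Sum>(r, s)\<leftarrow>rs. r + s) * (\<Prod>(r, s)\<leftarrow>rs. fact r * fact s)))
        *\<^sub>R lie_word (bracket G) (concat (map (\<lambda>(r, s). replicate r x @ replicate s y) rs)))"

lemma finite_bch_index: "finite (bch_index k)"
proof -
  have len: "length rs \<le> (\<Sum>(r, s)\<leftarrow>rs. r + s)" if "\<forall>(r, s)\<in>set rs. 0 < r + s"
    for rs :: "(nat \<times> nat) list"
    using that by (induction rs) (auto simp: Suc_le_eq split: prod.splits)
  have el: "r \<le> (\<Sum>(r, s)\<leftarrow>rs. r + s) \<and> s \<le> (\<Sum>(r, s)\<leftarrow>rs. r + s)" if "(r, s) \<in> set rs"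
    for rs :: "(nat \<times> nat) list" and r s
    using that by (induction rs) auto
  have "bch_index k \<subseteq> {rs. set rs \<subseteq> {..k} \<times> {..k} \<and> length rs \<le> k}"
    unfolding bch_index_def using len el by (fastforce dest: order_trans)
  then show ?thesis
    by (rule finite_subset) (intro finite_lists_length_le finite_cartesian_product finite_atMost)
qed

text \<open>The identity of the group is $0$ and the inverse of $x$ is $-x$.\<close>

lemma mult_minus:
  assumes "carnot G"
  shows "mult G x (- x) = 0"
proof -
  let ?br = "bracket G"
  let ?w = "\<lambda>rs. concat (map (\<lambda>(r, s). replicate r x @ replicate s (- x)) rs)"
  let ?c = "\<lambda>rs. (-1) ^ (length rs - 1) /
     (real (length rs) * real (\<Sum>(r, s)\<leftarrow>rs. r + s) * (\<Prod>(r, s)\<leftarrow>rs. fact r * fact s)) :: real"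
  let ?f = "\<lambda>rs. ?c rs *\<^sub>R lie_word ?br (?w rs)"
  have bl: "bilinear ?br" and alt: "?br z z = 0" for z
    using assms by (auto simp: carnot_def lie_algebra_def)
  have pm: "?br a b = 0" if "a \<in> {x, - x}" "b \<in> {x, - x}" for a b
    using that by (auto simp: alt bilinear_lneg[OF bl] bilinear_rneg[OF bl])
  have word0: "lie_word ?br ws = 0" if "set ws \<subseteq> {x, - x}" "length ws \<ge> 2" for ws
    using that
  proof (induction ws)
    case (Cons a ws)
    then obtain b zs where "ws = b # zs"
      by (cases ws) auto
    with Cons show ?case
      by (cases zs) (auto simp: pm bilinear_rzero[OF bl])
  qed auto
  have len: "length (?w rs) = (\<Sum>(r, s)\<leftarrow>rs. r + s)" for rs
    by (induction rs) auto
  have sub: "set (?w rs) \<subseteq> {x, - x}" for rs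
    by (induction rs) (simp_all add: split_beta set_replicate_conv_if)
  have one: "rs \<in> {[(1, 0)], [(0, 1)]}" if "rs \<in> bch_index (step G)" "(\<Sum>(r, s)\<leftarrow>rs. r + s) < 2" for rs
  proof -
    obtain r s rs' where rs: "rs = (r, s) # rs'"
      using \<open>rs \<in> bch_index (step G)\<close> by (cases rs) (auto simp: bch_index_def)
    have "rs' = []"
      using that by (cases rs') (auto simp: rs bch_index_def)
    then show ?thesis
      using that by (auto simp: rs bch_index_def)
  qed
  have "mult G x (- x) = (\<Sum>rs\<in>bch_index (step G). ?f rs)"
    by (simp add: mult_def)
  also have "\<dots> = (\<Sum>rs\<in>{[(1, 0)], [(0, 1)]}. ?f rs)"
  proof (rule sum.mono_neutral_right[OF finite_bch_index])
    show "{[(1, 0)], [(0, 1)]} \<subseteq> bch_index (step G)"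
      using assms by (auto simp: bch_index_def carnot_def)
    show "\<forall>rs\<in>bch_index (step G) - {[(1, 0)], [(0, 1)]}. ?f rs = 0"
    proof
      fix rs assume rs: "rs \<in> bch_index (step G) - {[(1, 0)], [(0, 1)]}"
      then have "\<not> (\<Sum>(r, s)\<leftarrow>rs. r + s) < 2"
        using one by blast
      then have "lie_word ?br (?w rs) = 0"
        by (intro word0 sub) (simp add: len)
      then show "?f rs = 0"
        by simp
    qed
  qed
  also have "\<dots> = 0"
    by simp
  finally show ?thesis .
qed

text \<open>The inner sum is the component of $x$ in the $i$-th layer, as the basis is adapted.\<close>

definition dilation :: "('a::euclidean_space) stratified \<Rightarrow> real \<Rightarrow> 'a \<Rightarrow> 'a" where
  "dilation G l x = (\<Sum>i=1..step G. l ^ i *\<^sub>R (\<Sum>b\<in>Basis \<inter> layer G i. (x \<bullet> b) *\<^sub>R b))"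

definition hom_norm :: "('a::euclidean_space) stratified \<Rightarrow> ('a \<Rightarrow> real) \<Rightarrow> bool" where
  "hom_norm G N \<longleftrightarrow>
     continuous_on UNIV N \<and>
     (\<forall>x. 0 \<le> N x) \<and>
     (\<forall>x. N x = 0 \<longleftrightarrow> x = 0) \<and>
     (\<forall>x. N (- x) = N x) \<and>
     (\<forall>l>0. \<forall>x. N (dilation G l x) = l * N x) \<and>
     (\<forall>x y. N (mult G x y) \<le> N x + N y)"

definition hom_dist :: "('a::euclidean_space) stratified \<Rightarrow> ('a \<Rightarrow> real) \<Rightarrow> 'a \<Rightarrow> 'a \<Rightarrow> real" where
  "hom_dist G N x y = N (mult G (- x) y)"

definition hom_ball :: "('a::euclidean_space) stratified \<Rightarrow> ('a \<Rightarrow> real) \<Rightarrow> 'a \<Rightarrow> real \<Rightarrow> 'a set" where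
  "hom_ball G N x r = {y. hom_dist G N x y < r}"


section \<open>Left-invariant vector fields, test functions and horizontal divergence\<close>

text \<open>The left-invariant vector field with value \<open>b\<close> at the identity: $X_b(x) = d(L_x)_0\, b$.\<close>

definition left_inv_field :: "('a::euclidean_space) stratified \<Rightarrow> 'a \<Rightarrow> 'a \<Rightarrow> 'a" where
  "left_inv_field G b x = frechet_derivative (mult G x) (at 0) b"

definition lie_deriv :: "('a::euclidean_space) stratified \<Rightarrow> 'a \<Rightarrow> ('a \<Rightarrow> real) \<Rightarrow> 'a \<Rightarrow> real" where
  "lie_deriv G b \<phi> x = frechet_derivative \<phi> (at x) (left_inv_field G b x)"

primrec C_k :: "nat \<Rightarrow> ('a::euclidean_space \<Rightarrow> real) \<Rightarrow> bool" where
  "C_k 0 \<phi> \<longleftrightarrow> continuous_on UNIV \<phi>"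
| "C_k (Suc k) \<phi> \<longleftrightarrow> (\<exists>\<phi>'. (\<forall>x. (\<phi> has_derivative \<phi>' x) (at x)) \<and> (\<forall>v. C_k k (\<lambda>x. \<phi>' x v)))"

definition test_function :: "('a::euclidean_space) set \<Rightarrow> ('a \<Rightarrow> real) \<Rightarrow> bool" where
  "test_function U \<phi> \<longleftrightarrow>
     (\<forall>k. C_k k \<phi>) \<and> compact (closure {x. \<phi> x \<noteq> 0}) \<and> closure {x. \<phi> x \<noteq> 0} \<subseteq> U"

text \<open>
  A horizontal vector field $F = \sum_b F_b X_b$ is given by its coordinates in the left-invariant
  frame: it is a function \<open>F\<close> into the first layer, and $F_b(x)$ is \<open>F x \<bullet> b\<close> for \<open>b \<in> hbasis G\<close>.
\<close>

definition horizontal_on :: "('a::euclidean_space) stratified \<Rightarrow> 'a set \<Rightarrow> ('a \<Rightarrow> 'a) \<Rightarrow> bool" where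
  "horizontal_on G A F \<longleftrightarrow> (\<forall>x\<in>A. F x \<in> layer G 1)"

definition hnorm :: "('a::euclidean_space) stratified \<Rightarrow> 'a \<Rightarrow> real" where
  "hnorm G v = sqrt (\<Sum>b\<in>hbasis G. (v \<bullet> b)\<^sup>2)"

text \<open>
  The distribution $X_b u$ on \<open>U\<close>. The minus sign is the only correction: $X_b$ is divergence free
  with respect to Lebesgue (Haar) measure, so its formal adjoint is $-X_b$.
\<close>

definition distr_lie_deriv ::
    "('a::euclidean_space) stratified \<Rightarrow> 'a set \<Rightarrow> 'a \<Rightarrow> ('a \<Rightarrow> real) \<Rightarrow> ('a \<Rightarrow> real) \<Rightarrow> real" where
  "distr_lie_deriv G U b u \<phi> = - (\<integral>x. u x * lie_deriv G b \<phi> x \<partial>lebesgue_on U)"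

definition distr_hdiv ::
    "('a::euclidean_space) stratified \<Rightarrow> 'a set \<Rightarrow> ('a \<Rightarrow> 'a) \<Rightarrow> ('a \<Rightarrow> real) \<Rightarrow> real" where
  "distr_hdiv G U F \<phi> = (\<Sum>b\<in>hbasis G. distr_lie_deriv G U b (\<lambda>x. F x \<bullet> b) \<phi>)"

definition is_hdiv_in ::
    "('a::euclidean_space) stratified \<Rightarrow> 'a set \<Rightarrow> ('a \<Rightarrow> real) \<Rightarrow> ('a \<Rightarrow> 'a) \<Rightarrow> bool" where
  "is_hdiv_in G U f F \<longleftrightarrow>
     (\<forall>\<phi>. test_function U \<phi> \<longrightarrow> (\<integral>x. f x * \<phi> x \<partial>lebesgue_on U) = distr_hdiv G U F \<phi>)"


section \<open>Lebesgue spaces\<close>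

definition in_Lp :: "real \<Rightarrow> ('a::euclidean_space) set \<Rightarrow> ('a \<Rightarrow> real) \<Rightarrow> bool" where
  "in_Lp p A f \<longleftrightarrow>
     f \<in> borel_measurable (lebesgue_on A) \<and> integrable (lebesgue_on A) (\<lambda>x. \<bar>f x\<bar> powr p)"

definition Lp_norm :: "real \<Rightarrow> ('a::euclidean_space) set \<Rightarrow> ('a \<Rightarrow> real) \<Rightarrow> real" where
  "Lp_norm p A f = (\<integral>x. \<bar>f x\<bar> powr p \<partial>lebesgue_on A) powr (1 / p)"

definition in_Lp_hor ::
    "('a::euclidean_space) stratified \<Rightarrow> real \<Rightarrow> 'a set \<Rightarrow> ('a \<Rightarrow> 'a) \<Rightarrow> bool" where
  "in_Lp_hor G q A F \<longleftrightarrow> horizontal_on G A F \<and> (\<forall>b\<in>hbasis G. in_Lp q A (\<lambda>x. F x \<bullet> b))"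

definition Lp_norm_hor ::
    "('a::euclidean_space) stratified \<Rightarrow> real \<Rightarrow> 'a set \<Rightarrow> ('a \<Rightarrow> 'a) \<Rightarrow> real" where
  "Lp_norm_hor G q A F = Lp_norm q A (\<lambda>x. hnorm G (F x))"

text \<open>Elements of $L^p(A)$ are classes modulo null sets, so the support is the essential one.\<close>

definition compactly_supported_in ::
    "('a::euclidean_space) set \<Rightarrow> ('a \<Rightarrow> 'b::real_vector) \<Rightarrow> bool" where
  "compactly_supported_in A f \<longleftrightarrow>
     (\<exists>K. compact K \<and> K \<subseteq> A \<and> (AE x in lebesgue_on A. x \<notin> K \<longrightarrow> f x = 0))"

end

theory Submission
  imports Defs
begin

text \<open>
  It suffices to solve the equation without any support condition: if \<open>F\<^sub>0\<close> is a horizontal field with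
  divergence \<open>f\<close>, then \<open>F\<^sub>0\<close> cut off sharply outside \<open>B\<close> is compactly supported in \<open>B'\<close>, and test
  functions on \<open>B\<close> do not see the cut. We take \<open>F\<^sub>0 = f * K\<close>, where the horizontal kernel \<open>K\<close> is bounded
  by a multiple of \<open>N\<^sup>1\<^sup>-\<^sup>Q\<close> and has divergence \<open>\<delta>\<^sub>0\<close>.

  For \<open>K\<close>, write \<open>\<phi>(x)\<close> as minus the integral of the derivative of \<open>\<phi>\<close> along the dilation curves
  \<open>s \<mapsto> x \<cdot> \<delta>\<^sub>s y\<close> and average over \<open>y\<close> with a smooth bump. The Euler field is a combination of all
  left-invariant fields with polynomial coefficients; those outside the first layer are commutators,
  and integrating them by parts against the bump for fixed \<open>s\<close>, where nothing is singular,
  leaves horizontal derivatives only. The integral over \<open>s\<close> then produces \<open>K\<close>.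

  The bounds are those of the fractional integral with kernel \<open>N\<^sup>1\<^sup>-\<^sup>Q\<close>. For \<open>p > 1\<close> a level set of it is
  estimated by splitting the kernel and \<open>f\<close> at heights depending on the level, and the estimate is
  integrated over the levels. For \<open>p = 1\<close> Jensen's inequality is enough.

  That the Dynkin series is a group law at all rests on a faithful nilpotent representation: the
  adjoint action on the Lie algebra extended by its grading derivation.
\<close>

section \<open>The grading of a Carnot algebra\<close>

text \<open>Along a single dilation curve the integral would give a kernel concentrated on that
  curve; averaging over \<open>y\<close> and substituting \<open>z = dilation G s y\<close> makes it
  a function. A left-invariant field of layer \<open>i\<close> would enter with a factor
  \<open>s ^ (i - 1)\<close> and hence a kernel of degree \<open>i - Q\<close>; only
  \<open>i = 1\<close> fits the horizontal divergence, so the higher layers must go before the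
  integration over \<open>s\<close>. Each commutator costs the bump one derivative, while the test
  function is differentiated only once. This is why the bump is a power of a truncated quadratic:
  its exponent is a supply of derivatives, and the polynomial coefficients of the fields do no harm.

  Neither associativity nor the invariance of Lebesgue measure can be read off from Dynkin's finite
  sum. Both are obtained from the filtration by degree: two exponential curves are compared one
  degree at a time, and translations differ from vector addition by terms that raise the degree.

  At the endpoint exponent the fractional integral is bounded on the whole space, which yields one
  constant for all balls. Below it, and for \<open>p = 1\<close>, the constant also involves the
  measure of the ball.\<close>

locale carnot_group =
  fixes G :: "('a::euclidean_space) stratified"
  assumes carnot: "carnot G"
begin

abbreviation br :: "'a \<Rightarrow> 'a \<Rightarrow> 'a" where "br \<equiv> bracket G"
abbreviation V :: "nat \<Rightarrow> 'a set" where "V \<equiv> layer G"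

lemma bilinear_br: "bilinear br"
  and br_self [simp]: "br x x = 0"
  and br_jacobi: "br x (br y z) + br y (br z x) + br z (br x y) = 0"
  using carnot unfolding carnot_def lie_algebra_def by simp_all

lemma step_pos: "1 \<le> step G"
  using carnot unfolding carnot_def by (elim conjE)

lemma subspace_layer: "1 \<le> i \<Longrightarrow> subspace (V i)"
  using carnot unfolding carnot_def by (elim conjE allE[of _ i]) simp

lemma layer_decomp: "\<exists>!v. v \<in> (\<Pi>\<^sub>E i\<in>{1..step G}. V i) \<and> x = (\<Sum>i=1..step G. v i)"
  using carnot unfolding carnot_def by (elim conjE allE[of _ x])

lemma span_bracket: "1 \<le> i \<Longrightarrow> span {br x y | x y. x \<in> V 1 \<and> y \<in> V i} = V (Suc i)"
  using carnot unfolding carnot_def by (elim conjE allE[of _ i]) simp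

lemma layer_gt_step: "step G < i \<Longrightarrow> V i = {0}"
  using carnot unfolding carnot_def by simp

lemma Basis_layers: "Basis \<subseteq> (\<Union>i\<in>{1..step G}. V i)"
  using carnot unfolding carnot_def by (elim conjE)

lemma linear_br_right: "linear (br x)" and linear_br_left: "linear (\<lambda>x. br x y)"
  using bilinear_br by (auto simp: bilinear_def)

lemmas br_add_right = linear_add[OF linear_br_right]
  and br_add_left = linear_add[OF linear_br_left]
  and br_scaleR_right = linear_scale[OF linear_br_right]
  and br_scaleR_left = linear_scale[OF linear_br_left]
  and br_diff_right = linear_diff[OF linear_br_right]
  and br_diff_left = linear_diff[OF linear_br_left]
  and br_minus_right = linear_neg[OF linear_br_right]
  and br_minus_left = linear_neg[OF linear_br_left]
  and br_zero_right [simp] = linear_0[OF linear_br_right]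
  and br_zero_left [simp] = linear_0[OF linear_br_left]
  and br_sum_right = linear_sum[OF linear_br_right]
  and br_sum_left = linear_sum[OF linear_br_left]

lemma br_swap: "br y x = - br x y"
proof -
  have "br (x + y) (x + y) = 0" by simp
  then have "br x y + br y x = 0"
    unfolding br_add_right br_add_left by (simp add: add.commute)
  then show ?thesis by (simp add: eq_neg_iff_add_eq_0 add.commute)
qed

lemma br_br: "br (br x y) z = br x (br y z) - br y (br x z)"
proof -
  have "br x (br y z) + br y (br z x) = - br z (br x y)"
    using br_jacobi[of x y z] by (simp add: eq_neg_iff_add_eq_0)
  then show ?thesis
    by (simp add: br_swap[of "br x y" z] br_swap[of x z] br_minus_right)
qed

text \<open>The choice is unambiguous: uniqueness of the decomposition puts a basis vector into one
  layer only, see \<open>Basis_layer_iff\<close>.\<close>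

definition deg :: "'a \<Rightarrow> nat" where
  "deg b = (SOME i. i \<in> {1..step G} \<and> b \<in> V i)"

lemma deg: assumes "b \<in> Basis" shows "1 \<le> deg b" "deg b \<le> step G" "b \<in> V (deg b)"
proof -
  have "\<exists>i. i \<in> {1..step G} \<and> b \<in> V i" using Basis_layers assms by blast
  from someI_ex[OF this, folded deg_def]
  show "1 \<le> deg b" "deg b \<le> step G" "b \<in> V (deg b)" by auto
qed

text \<open>Sorting the coordinates of \<open>x\<close> by degree gives one decomposition along the
  layers, \<open>x\<close> alone in slot \<open>i\<close> gives another. Uniqueness identifies them,
  so the coordinates of all other degrees vanish.\<close>

lemma layer_iff:
  assumes i: "i \<in> {1..step G}"
  shows "x \<in> V i \<longleftrightarrow> (\<forall>b\<in>Basis. deg b \<noteq> i \<longrightarrow> x \<bullet> b = 0)"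
proof
  let ?p = "\<lambda>j. \<Sum>b\<in>{b\<in>Basis. deg b = j}. (x \<bullet> b) *\<^sub>R b"
  have pV: "?p j \<in> V j" if "1 \<le> j" for j
    by (intro subspace_sum subspace_scale subspace_layer that) (use deg in auto)
  have px: "x = (\<Sum>j=1..step G. ?p j)"
  proof -
    have "(\<Sum>j=1..step G. ?p j) = (\<Sum>b\<in>Basis. (x \<bullet> b) *\<^sub>R b)"
      by (rule sum.group) (use deg in auto)
    then show ?thesis by (simp add: euclidean_representation)
  qed
  {
    assume x: "x \<in> V i"
    define v where "v = (\<lambda>j\<in>{1..step G}. ?p j)"
    define w where "w = (\<lambda>j\<in>{1..step G}. if j = i then x else 0)"
    have "v \<in> (\<Pi>\<^sub>E j\<in>{1..step G}. V j) \<and> x = (\<Sum>j=1..step G. v j)"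
      using pV px by (auto simp: v_def)
    moreover have "w \<in> (\<Pi>\<^sub>E j\<in>{1..step G}. V j) \<and> x = (\<Sum>j=1..step G. w j)"
      using x i subspace_layer by (auto simp: w_def subspace_0)
    ultimately have vw: "v = w" using layer_decomp[of x] by blast
    show "\<forall>b\<in>Basis. deg b \<noteq> i \<longrightarrow> x \<bullet> b = 0"
    proof (intro ballI impI)
      fix b :: 'a assume b: "b \<in> Basis" "deg b \<noteq> i"
      have "?p (deg b) = 0" using fun_cong[OF vw, of "deg b"] b deg[OF b(1)] by (simp add: v_def w_def)
      then have "?p (deg b) \<bullet> b = 0" by simp
      moreover have "?p (deg b) \<bullet> b = (\<Sum>c\<in>{c\<in>Basis. deg c = deg b}. (x \<bullet> c) * (if c = b then 1 else 0))"
        unfolding inner_sum_left by (intro sum.cong) (use b in \<open>auto simp: inner_Basis\<close>)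
      ultimately show "x \<bullet> b = 0" using b by (simp add: if_distrib sum.delta cong: if_cong)
    qed
  }
  assume h: "\<forall>b\<in>Basis. deg b \<noteq> i \<longrightarrow> x \<bullet> b = 0"
  have "(\<Sum>j=1..step G. ?p j) = ?p i + (\<Sum>j\<in>{1..step G} - {i}. ?p j)"
    using i by (intro sum.remove) auto
  also have "(\<Sum>j\<in>{1..step G} - {i}. ?p j) = 0"
    by (intro sum.neutral ballI) (use h in auto)
  finally show "x \<in> V i" using px pV[of i] i by simp
qed

lemma Basis_layer_iff: "b \<in> Basis \<Longrightarrow> i \<in> {1..step G} \<Longrightarrow> b \<in> V i \<longleftrightarrow> deg b = i"
  using layer_iff[of i b] by (auto simp: inner_Basis)

lemma hbasis_eq: "hbasis G = {b\<in>Basis. deg b = 1}"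
  using Basis_layer_iff[of _ 1] step_pos by (auto simp: hbasis_def)

lemma layer1_expand: "x \<in> V 1 \<Longrightarrow> x = (\<Sum>b\<in>hbasis G. (x \<bullet> b) *\<^sub>R b)"
proof -
  assume x: "x \<in> V 1"
  have "x = (\<Sum>b\<in>Basis. (x \<bullet> b) *\<^sub>R b)" by (simp add: euclidean_representation)
  also have "\<dots> = (\<Sum>b\<in>hbasis G. (x \<bullet> b) *\<^sub>R b)"
    by (rule sum.mono_neutral_right) (use x layer_iff[of 1 x] step_pos in \<open>auto simp: hbasis_eq\<close>)
  finally show ?thesis .
qed

lemma br_layer1: "1 \<le> i \<Longrightarrow> x \<in> V 1 \<Longrightarrow> y \<in> V i \<Longrightarrow> br x y \<in> V (Suc i)"
  using span_bracket[of i] by (blast intro: span_base)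

text \<open>Induction on the first index: \<open>V (Suc n)\<close> is spanned by brackets of
  \<open>V 1\<close> with \<open>V n\<close>, and the Jacobi identity rewrites
  \<open>br (br u v) y\<close> through brackets with \<open>u\<close> and with \<open>v\<close>,
  where the induction hypothesis handles \<open>v\<close>.\<close>

lemma br_layer: "1 \<le> i \<Longrightarrow> 1 \<le> j \<Longrightarrow> x \<in> V i \<Longrightarrow> y \<in> V j \<Longrightarrow> br x y \<in> V (i + j)"
proof (induction i arbitrary: j x y rule: dec_induct)
  case base
  then show ?case using br_layer1 by auto
next
  case (step n)
  have sub: "subspace {z. br z y \<in> V (Suc n + j)}"
    using subspace_layer[of "Suc n + j"]
    by (auto simp: subspace_def br_add_left br_scaleR_left)
  have "x \<in> span {br u v | u v. u \<in> V 1 \<and> v \<in> V n}"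
    using span_bracket[of n] step by auto
  moreover have "span {br u v | u v. u \<in> V 1 \<and> v \<in> V n} \<subseteq> {z. br z y \<in> V (Suc n + j)}"
  proof (rule span_minimal[OF _ sub], safe)
    fix u v assume u: "u \<in> V 1" and v: "v \<in> V n"
    have 1: "br u (br v y) \<in> V (Suc (n + j))"
      using br_layer1[of "n + j"] step.IH[of j v y] step.prems step.hyps u v by auto
    have "br u y \<in> V (Suc j)" using br_layer1 step.prems u by auto
    then have "br v (br u y) \<in> V (n + Suc j)" using step.IH[of "Suc j" v] v by auto
    with 1 show "br (br u v) y \<in> V (Suc n + j)"
      unfolding br_br using subspace_layer[of "Suc n + j"] by (auto intro: subspace_diff)
  qed
  ultimately show ?case by auto
qed

text \<open>The sum of the layers of degree at least \<open>i\<close>, a descending chain of ideals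
  that reaches 0 beyond the step. Errors are measured in it because they have a lowest degree but
  need not be homogeneous.\<close>

definition filt :: "nat \<Rightarrow> 'a set" where
  "filt i = {v. \<forall>b\<in>Basis. deg b < i \<longrightarrow> v \<bullet> b = 0}"

lemma subspace_filt: "subspace (filt i)"
  by (auto simp: filt_def subspace_def inner_add_left)

lemma filt_le_1: "i \<le> 1 \<Longrightarrow> filt i = UNIV"
proof -
  assume "i \<le> 1"
  then have "\<not> deg b < i" if "b \<in> Basis" for b using deg(1)[OF that] by simp
  then show ?thesis unfolding filt_def by blast
qed

lemma filt_mono: "i \<le> j \<Longrightarrow> filt j \<subseteq> filt i"
  by (auto simp: filt_def)

lemma filt_gt_step: assumes "step G < i" shows "filt i = {0}"
proof -
  have "v = 0" if v: "v \<in> filt i" for v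
  proof (rule euclidean_eqI)
    fix b :: 'a assume b: "b \<in> Basis"
    have "deg b < i" using deg(2)[OF b] assms by simp
    then show "v \<bullet> b = 0 \<bullet> b" using v b by (simp add: filt_def)
  qed
  then show ?thesis using subspace_0[OF subspace_filt[of i]] by blast
qed

lemma layer_filt: assumes "1 \<le> i" "x \<in> V i" shows "x \<in> filt i"
proof (cases "i \<le> step G")
  case True
  then show ?thesis using layer_iff[of i x] assms by (auto simp: filt_def)
next
  case False
  then show ?thesis using layer_gt_step[of i] assms subspace_0[OF subspace_filt] by auto
qed

lemma filt_expand: "x \<in> filt i \<Longrightarrow> x = (\<Sum>b\<in>{b\<in>Basis. i \<le> deg b}. (x \<bullet> b) *\<^sub>R b)"
proof -
  assume x: "x \<in> filt i"
  have "x = (\<Sum>b\<in>Basis. (x \<bullet> b) *\<^sub>R b)" by (simp add: euclidean_representation)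
  also have "\<dots> = (\<Sum>b\<in>{b\<in>Basis. i \<le> deg b}. (x \<bullet> b) *\<^sub>R b)"
    by (rule sum.mono_neutral_right) (use x in \<open>auto simp: filt_def\<close>)
  finally show ?thesis .
qed

lemma br_filt: assumes "x \<in> filt i" "y \<in> filt j" shows "br x y \<in> filt (i + j)"
proof -
  have bc: "br b c \<in> filt (i + j)" if "b \<in> Basis" "c \<in> Basis" "i \<le> deg b" "j \<le> deg c" for b c
    using layer_filt[OF _ br_layer[of "deg b" "deg c" b c]] deg that
      filt_mono[of "i + j" "deg b + deg c"] by (auto simp: subset_iff)
  have "br x y = br (\<Sum>b\<in>{b\<in>Basis. i \<le> deg b}. (x \<bullet> b) *\<^sub>R b) (\<Sum>b\<in>{b\<in>Basis. j \<le> deg b}. (y \<bullet> b) *\<^sub>R b)"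
    by (rule arg_cong2[where f = br, OF filt_expand[OF assms(1)] filt_expand[OF assms(2)]])
  also have "\<dots> \<in> filt (i + j)"
    unfolding br_sum_left br_sum_right br_scaleR_left br_scaleR_right
    by (intro subspace_sum subspace_scale subspace_filt) (use bc in auto)
  finally show ?thesis .
qed

lemma br_filt_Suc: "x \<in> filt i \<Longrightarrow> br x y \<in> filt (Suc i)" "y \<in> filt i \<Longrightarrow> br x y \<in> filt (Suc i)"
  using br_filt[of x i y 1] br_filt[of x 1 y i] by (auto simp: filt_le_1)

text \<open>Letters start in degree one and every bracket adds at least one. Words longer than the
  step therefore vanish, which is what makes the truncation of Dynkin's series exact.\<close>

lemma lie_word_filt: "lie_word br ws \<in> filt (length ws)"
proof (induction ws)
  case (Cons x ws)
  then show ?case by (cases ws) (auto simp: br_filt_Suc filt_le_1)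
qed (auto simp: filt_le_1)

lemma lie_word_eq_0: "step G < length ws \<Longrightarrow> lie_word br ws = 0"
  using lie_word_filt[of ws] filt_gt_step by auto

text \<open>Letters are replaced one after the other. Unless the word is a single letter, the
  replaced letter sits inside a bracket, and that bracket gains a degree.\<close>

lemma lie_word_diff:
  assumes "list_all2 (\<lambda>u v. u - v \<in> filt i) us vs"
  shows "lie_word br us - lie_word br vs \<in> filt (if length us = 1 then i else Suc i)"
  using assms
proof (induction us vs rule: list_all2_induct)
  case Nil
  then show ?case by (simp add: subspace_0 subspace_filt)
next
  case (Cons u us v vs)
  show ?case
  proof (cases us)
    case Nil
    with Cons show ?thesis by simp
  next
    case (Cons u' us')
    then obtain v' vs' where vs: "vs = v' # vs'" using Cons.hyps by (auto simp: list_all2_Cons1)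
    have "lie_word br us - lie_word br vs \<in> filt i"
      using Cons.IH filt_mono[of i "Suc i"] by (auto split: if_splits)
    then have "br u (lie_word br us - lie_word br vs) + br (u - v) (lie_word br vs) \<in> filt (Suc i)"
      using Cons.hyps by (intro subspace_add subspace_filt br_filt_Suc)
    then show ?thesis using Cons vs by (simp add: br_diff_left br_diff_right)
  qed
qed

section \<open>The grading derivation, the dilations it generates, and the homogeneous
  dimension\<close>

definition euler :: "'a \<Rightarrow> 'a" where
  "euler x = (\<Sum>b\<in>Basis. (deg b * (x \<bullet> b)) *\<^sub>R b)"

lemma linear_euler: "linear euler"
  by (rule linearI) (simp_all add: euler_def inner_add_left algebra_simps sum.distrib scaleR_sum_right)

lemma euler_inner: "b \<in> Basis \<Longrightarrow> euler x \<bullet> b = deg b * (x \<bullet> b)"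
  unfolding euler_def by (simp add: inner_sum_left inner_Basis if_distrib sum.delta cong: if_cong)

lemma euler_inj: "euler x = euler y \<Longrightarrow> x = y"
proof (rule euclidean_eqI)
  fix b :: 'a assume b: "b \<in> Basis" and e: "euler x = euler y"
  then have "deg b * (x \<bullet> b) = deg b * (y \<bullet> b)" using euler_inner by metis
  then show "x \<bullet> b = y \<bullet> b" using deg(1)[OF b] by simp
qed

lemma euler_layer: assumes "1 \<le> i" "x \<in> V i" shows "euler x = i *\<^sub>R x"
proof (cases "i \<le> step G")
  case True
  then have "euler x \<bullet> b = (i *\<^sub>R x) \<bullet> b" if "b \<in> Basis" for b
    using layer_iff[of i x] assms that by (cases "deg b = i") (auto simp: euler_inner)
  then show ?thesis by (rule euclidean_eqI)
next
  case False
  then show ?thesis using layer_gt_step[of i] assms linear_0[OF linear_euler] by auto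
qed

lemma br_expand: "br x y = (\<Sum>b\<in>Basis. \<Sum>c\<in>Basis. ((x \<bullet> b) * (y \<bullet> c)) *\<^sub>R br b c)"
proof -
  have "br x y = br (\<Sum>b\<in>Basis. (x \<bullet> b) *\<^sub>R b) (\<Sum>b\<in>Basis. (y \<bullet> b) *\<^sub>R b)"
    by (simp add: euclidean_representation)
  then show ?thesis
    unfolding br_sum_left br_sum_right br_scaleR_left br_scaleR_right
    by (subst sum.swap) (simp add: scaleR_sum_right mult.commute)
qed

text \<open>By bilinearity basis vectors suffice, and their bracket lies in the layer given by the
  sum of the degrees.\<close>

lemma euler_br: "euler (br x y) = br (euler x) y + br x (euler y)"
proof -
  have bc: "euler (br b c) = (real (deg b) + real (deg c)) *\<^sub>R br b c" if "b \<in> Basis" "c \<in> Basis" for b c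
    using euler_layer[OF _ br_layer[of "deg b" "deg c" b c]] deg that by simp
  have "euler (br x y) = (\<Sum>b\<in>Basis. \<Sum>c\<in>Basis. ((x \<bullet> b) * (y \<bullet> c)) *\<^sub>R euler (br b c))"
    by (subst br_expand) (simp add: linear_sum[OF linear_euler] linear_scale[OF linear_euler])
  also have "\<dots> = (\<Sum>b\<in>Basis. \<Sum>c\<in>Basis. ((euler x \<bullet> b) * (y \<bullet> c)) *\<^sub>R br b c + ((x \<bullet> b) * (euler y \<bullet> c)) *\<^sub>R br b c)"
    by (intro sum.cong refl) (simp add: bc euler_inner algebra_simps)
  also have "\<dots> = br (euler x) y + br x (euler y)"
    by (simp add: sum.distrib br_expand[of "euler x" y] br_expand[of x "euler y"])
  finally show ?thesis .
qed

lemma dilation_eq: "dilation G s x = (\<Sum>b\<in>Basis. (s ^ deg b * (x \<bullet> b)) *\<^sub>R b)"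
proof -
  have "dilation G s x = (\<Sum>i=1..step G. \<Sum>b\<in>{b\<in>Basis. deg b = i}. (s ^ deg b * (x \<bullet> b)) *\<^sub>R b)"
    unfolding dilation_def scaleR_sum_right
    by (intro sum.cong refl) (use Basis_layer_iff in auto)
  also have "\<dots> = (\<Sum>b\<in>Basis. (s ^ deg b * (x \<bullet> b)) *\<^sub>R b)"
    by (rule sum.group) (use deg in auto)
  finally show ?thesis .
qed

lemma dilation_inner: "b \<in> Basis \<Longrightarrow> dilation G s x \<bullet> b = s ^ deg b * (x \<bullet> b)"
  unfolding dilation_eq by (simp add: inner_sum_left inner_Basis if_distrib sum.delta cong: if_cong)

lemma dilation_layer: assumes "1 \<le> i" "x \<in> V i" shows "dilation G s x = s ^ i *\<^sub>R x"
proof (cases "i \<le> step G")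
  case True
  then have "dilation G s x \<bullet> b = (s ^ i *\<^sub>R x) \<bullet> b" if "b \<in> Basis" for b
    using layer_iff[of i x] assms that by (cases "deg b = i") (auto simp: dilation_inner)
  then show ?thesis by (rule euclidean_eqI)
next
  case False
  then have "x = 0" using layer_gt_step[of i] assms by auto
  then show ?thesis by (simp add: dilation_eq)
qed

lemma linear_dilation: "linear (dilation G s)"
  by (rule linearI) (simp_all add: dilation_eq inner_add_left algebra_simps sum.distrib scaleR_sum_right)

lemma dilation_br: "dilation G s (br x y) = br (dilation G s x) (dilation G s y)"
proof -
  have bc: "dilation G s (br b c) = (s ^ deg b * s ^ deg c) *\<^sub>R br b c" if "b \<in> Basis" "c \<in> Basis" for b c
    using dilation_layer[OF _ br_layer[of "deg b" "deg c" b c]] deg that by (simp add: power_add)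
  have "dilation G s (br x y) = (\<Sum>b\<in>Basis. \<Sum>c\<in>Basis. ((x \<bullet> b) * (y \<bullet> c)) *\<^sub>R dilation G s (br b c))"
    by (subst br_expand) (simp add: linear_sum[OF linear_dilation] linear_scale[OF linear_dilation])
  also have "\<dots> = (\<Sum>b\<in>Basis. \<Sum>c\<in>Basis. ((dilation G s x \<bullet> b) * (dilation G s y \<bullet> c)) *\<^sub>R br b c)"
    by (intro sum.cong refl) (simp add: bc dilation_inner algebra_simps)
  also have "\<dots> = br (dilation G s x) (dilation G s y)"
    by (simp add: br_expand[of "dilation G s x"])
  finally show ?thesis .
qed

lemma dilation_dilation: "dilation G s (dilation G t x) = dilation G (s * t) x"
  by (rule euclidean_eqI) (simp add: dilation_inner power_mult_distrib)

lemma dilation_1 [simp]: "dilation G 1 x = x"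
  by (rule euclidean_eqI) (simp add: dilation_inner)

lemma dilation_0_left [simp]: "dilation G 0 x = 0"
proof (rule euclidean_eqI)
  fix b :: 'a assume b: "b \<in> Basis"
  then have "deg b \<noteq> 0" using deg(1)[OF b] by simp
  then show "dilation G 0 x \<bullet> b = 0 \<bullet> b" using b by (simp add: dilation_inner)
qed

lemma dilation_0_right [simp]: "dilation G s 0 = 0"
  by (simp add: dilation_eq)

text \<open>The form in which \<open>Q\<close> appears as the exponent of a Jacobian:
  \<open>dilation G s\<close> is diagonal with entries \<open>s ^ deg b\<close>.\<close>

lemma hom_dim_eq: "hom_dim G = (\<Sum>b\<in>Basis. deg b)"
proof -
  have d: "dim (V i) = card {b\<in>Basis. deg b = i}" if i: "i \<in> {1..step G}" for i
  proof -
    have "x \<in> span {b\<in>Basis. deg b = i}" if x: "x \<in> V i" for x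
    proof -
      have "x = (\<Sum>b\<in>Basis. (x \<bullet> b) *\<^sub>R b)" by (simp add: euclidean_representation)
      also have "\<dots> \<in> span {b\<in>Basis. deg b = i}"
      proof (rule span_sum)
        fix b :: 'a assume b: "b \<in> Basis"
        show "(x \<bullet> b) *\<^sub>R b \<in> span {b\<in>Basis. deg b = i}"
        proof (cases "deg b = i")
          case True
          with b show ?thesis by (intro span_scale span_base) simp
        next
          case False
          then have "x \<bullet> b = 0" using layer_iff[OF i, of x] x b by blast
          then show ?thesis by (simp add: span_zero)
        qed
      qed
      finally show ?thesis .
    qed
    moreover have "span {b\<in>Basis. deg b = i} \<subseteq> V i"
      by (rule span_minimal) (use deg subspace_layer i in auto)
    ultimately have "V i = span {b\<in>Basis. deg b = i}" by auto
    moreover have "independent {b\<in>Basis. deg b = i}"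
      by (rule independent_mono[OF independent_Basis]) auto
    ultimately show ?thesis by (simp add: dim_eq_card_independent)
  qed
  have "hom_dim G = (\<Sum>i=1..step G. \<Sum>b\<in>{b\<in>Basis. deg b = i}. deg b)"
    unfolding hom_dim_def by (intro sum.cong refl) (simp add: d)
  also have "\<dots> = (\<Sum>b\<in>Basis. deg b)"
    by (rule sum.group) (use deg in auto)
  finally show ?thesis .
qed

end

section \<open>Endomorphisms and power series at nilpotent elements\<close>

text \<open>Bounded operators with composition as multiplication, a type of their own so that
  powers, products and derivatives of operator-valued curves follow the rules of normed
  algebras.\<close>

typedef (overloaded) ('a::real_normed_vector) endo = "UNIV :: ('a \<Rightarrow>\<^sub>L 'a) set" ..

setup_lifting type_definition_endo

instantiation endo :: (real_normed_vector) real_normed_vector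
begin

lift_definition norm_endo :: "'a endo \<Rightarrow> real" is norm .
lift_definition minus_endo :: "'a endo \<Rightarrow> 'a endo \<Rightarrow> 'a endo" is "(-)" .
lift_definition uminus_endo :: "'a endo \<Rightarrow> 'a endo" is uminus .
lift_definition zero_endo :: "'a endo" is 0 .
lift_definition plus_endo :: "'a endo \<Rightarrow> 'a endo \<Rightarrow> 'a endo" is "(+)" .
lift_definition scaleR_endo :: "real \<Rightarrow> 'a endo \<Rightarrow> 'a endo" is scaleR .

definition dist_endo :: "'a endo \<Rightarrow> 'a endo \<Rightarrow> real" where
  "dist_endo a b = norm (a - b)"
definition sgn_endo :: "'a endo \<Rightarrow> 'a endo" where
  "sgn_endo x = inverse (norm x) *\<^sub>R x"
definition uniformity_endo :: "('a endo \<times> 'a endo) filter" where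
  "uniformity_endo = (INF e\<in>{0 <..}. principal {(x, y). dist x y < e})"
definition open_endo :: "'a endo set \<Rightarrow> bool" where
  "open_endo S = (\<forall>x\<in>S. \<forall>\<^sub>F (x', y) in uniformity. x' = x \<longrightarrow> y \<in> S)"

instance
  apply standard
  unfolding dist_endo_def open_endo_def sgn_endo_def uniformity_endo_def
  by (rule refl | (transfer, simp add: algebra_simps norm_triangle_ineq))+

end

instantiation endo :: (real_normed_vector) real_normed_algebra
begin

lift_definition times_endo :: "'a endo \<Rightarrow> 'a endo \<Rightarrow> 'a endo" is "(o\<^sub>L)" .

instance
  by standard
    (transfer, simp add: blinfun_eqI norm_blinfun_compose
      bounded_bilinear.add_left[OF bounded_bilinear_blinfun_compose]
      bounded_bilinear.add_right[OF bounded_bilinear_blinfun_compose]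
      bounded_bilinear.scaleR_left[OF bounded_bilinear_blinfun_compose]
      bounded_bilinear.scaleR_right[OF bounded_bilinear_blinfun_compose])+

end

lift_definition endo_ap :: "('a::real_normed_vector) endo \<Rightarrow> 'a \<Rightarrow> 'a" is blinfun_apply .

lemma endo_eqI: "(\<And>x. endo_ap S x = endo_ap T x) \<Longrightarrow> S = T"
  by transfer (rule blinfun_eqI)

lemma endo_ap_mult [simp]: "endo_ap (S * T) x = endo_ap S (endo_ap T x)"
  by transfer simp

lemma endo_ap_zero [simp]: "endo_ap 0 x = 0" and endo_ap_plus: "endo_ap (S + T) x = endo_ap S x + endo_ap T x"
  and endo_ap_minus: "endo_ap (S - T) x = endo_ap S x - endo_ap T x" and endo_ap_scaleR: "endo_ap (c *\<^sub>R T) x = c *\<^sub>R endo_ap T x"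
  by (transfer; simp add: blinfun.bilinear_simps)+

lemma bounded_bilinear_endo_ap: "bounded_bilinear endo_ap"
proof
  show "\<exists>K. \<forall>T x. norm (endo_ap T x) \<le> norm (T :: 'a endo) * norm x * K"
  proof (intro exI allI)
    show "norm (endo_ap T x) \<le> norm (T :: 'a endo) * norm x * 1" for T x
      by transfer (simp add: norm_blinfun)
  qed
qed (transfer, simp add: blinfun.bilinear_simps)+

lemma linear_endo_ap: "linear (endo_ap T)"
  by (rule bounded_linear.linear, rule bounded_bilinear.bounded_linear_right[OF bounded_bilinear_endo_ap])

lemma endo_ap_sum: "endo_ap (sum f A) x = (\<Sum>a\<in>A. endo_ap (f a) x)"
  by (rule bounded_bilinear.sum_left[OF bounded_bilinear_endo_ap])

lift_definition id_endo :: "('a::real_normed_vector) endo" is id_blinfun .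

lemma endo_ap_id [simp]: "endo_ap id_endo x = x"
  by transfer simp

instantiation endo :: (euclidean_space) real_algebra_1
begin

definition one_endo :: "'a endo" where "one_endo = id_endo"

instance
proof
  show "1 * a = a" "a * 1 = a" for a :: "'a endo"
    by (rule endo_eqI, simp add: one_endo_def)+
  obtain b :: 'a where b: "b \<in> Basis" using nonempty_Basis by blast
  then have "endo_ap (0 :: 'a endo) b \<noteq> endo_ap 1 b" by (auto simp: one_endo_def)
  then show "(0 :: 'a endo) \<noteq> 1" by metis
qed

end

lemma endo_ap_one [simp]: "endo_ap 1 x = x"
  by (simp add: one_endo_def)

lift_definition endo_mk :: "('a::euclidean_space \<Rightarrow> 'a) \<Rightarrow> 'a endo" is "\<lambda>f. Blinfun f" .

lemma endo_ap_endo_mk: "linear f \<Longrightarrow> endo_ap (endo_mk f) = f"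
  by transfer (simp add: bounded_linear_Blinfun_apply linear_conv_bounded_linear)



section \<open>Power series evaluated at nilpotent elements\<close>

lemma sum_triangle:
  fixes F :: "nat \<Rightarrow> nat \<Rightarrow> 'b::comm_monoid_add"
  assumes "\<And>i j. K \<le> i + j \<Longrightarrow> F i j = 0"
  shows "(\<Sum>n<K. \<Sum>i\<le>n. F i (n - i)) = (\<Sum>i<K. \<Sum>j<K. F i j)"
proof -
  have "(\<Sum>n<K. \<Sum>i\<le>n. F i (n - i)) = (\<Sum>(i,j)\<in>{(i,j). i + j < K}. F i j)"
    by (simp add: sum.triangle_reindex)
  also have "\<dots> = (\<Sum>(i,j)\<in>{..<K} \<times> {..<K}. F i j)"
    by (rule sum.mono_neutral_left) (auto intro!: assms simp: not_less)
  finally show ?thesis by (simp add: sum.cartesian_product)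
qed

text \<open>For \<open>T ^ K = 0\<close> this truncation is a ring homomorphism compatible with
  composition, so identities between formal power series pass to nilpotent operators without any
  question of convergence.\<close>

definition fps_eval :: "nat \<Rightarrow> 'r::real_algebra_1 \<Rightarrow> real fps \<Rightarrow> 'r" where
  "fps_eval K T f = (\<Sum>k<K. fps_nth f k *\<^sub>R T ^ k)"

lemma nilpotent_power_eq_0:
  fixes T :: "'r::real_algebra_1"
  assumes "T ^ K = 0" "K \<le> n" shows "T ^ n = 0"
  using assms by (metis le_add_diff_inverse power_add mult_zero_left)

lemma fps_eval_diff: "fps_eval K T (f - g) = fps_eval K T f - fps_eval K T g"
  by (simp add: fps_eval_def scaleR_diff_left sum_subtractf)

lemma fps_eval_1: "0 < K \<Longrightarrow> fps_eval K T 1 = 1"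
proof -
  assume "0 < K"
  have "fps_eval K T 1 = (\<Sum>k<K. if k = 0 then 1 else 0)"
    unfolding fps_eval_def by (intro sum.cong refl) auto
  then show ?thesis using \<open>0 < K\<close> by simp
qed

lemma fps_eval_X: "1 < K \<Longrightarrow> fps_eval K T fps_X = T"
proof -
  assume "1 < K"
  have "fps_eval K T fps_X = (\<Sum>k<K. if k = 1 then T else 0)"
    unfolding fps_eval_def by (intro sum.cong refl) auto
  then show ?thesis using \<open>1 < K\<close> by simp
qed

lemma fps_eval_mult:
  assumes T: "T ^ K = 0"
  shows "fps_eval K T (f * g) = fps_eval K T f * fps_eval K T g"
proof -
  let ?F = "\<lambda>i j. (fps_nth f i *\<^sub>R T ^ i) * (fps_nth g j *\<^sub>R T ^ j)"
  have "fps_eval K T (f * g) = (\<Sum>n<K. \<Sum>i\<le>n. ?F i (n - i))"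
    unfolding fps_eval_def fps_mult_nth atLeast0AtMost scaleR_sum_left
    by (intro sum.cong refl) (simp add: power_add[symmetric] mult.commute)
  also have "\<dots> = (\<Sum>i<K. \<Sum>j<K. ?F i j)"
    by (rule sum_triangle) (simp add: power_add[symmetric] nilpotent_power_eq_0[OF T])
  also have "\<dots> = fps_eval K T f * fps_eval K T g"
    unfolding fps_eval_def by (rule sum_product[symmetric])
  finally show ?thesis .
qed

lemma fps_eval_power: "T ^ K = 0 \<Longrightarrow> 0 < K \<Longrightarrow> fps_eval K T (f ^ n) = fps_eval K T f ^ n"
  by (induction n) (simp_all add: fps_eval_1 fps_eval_mult)

text \<open>As \<open>g\<close> has no constant term, \<open>g ^ i\<close> starts in degree
  \<open>i\<close>; the inner sum may then run over all \<open>i < K\<close> independently of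
  \<open>n\<close>, and the two sums can be exchanged.\<close>

lemma fps_eval_compose:
  assumes T: "T ^ K = 0" "0 < K" and g: "fps_nth g 0 = 0"
  shows "fps_eval K T (f oo g) = fps_eval K (fps_eval K T g) f"
proof -
  have nth: "fps_nth (f oo g) n = (\<Sum>i<K. fps_nth f i * fps_nth (g ^ i) n)" if "n < K" for n
    unfolding fps_compose_nth
    by (rule sum.mono_neutral_left)
      (use that g in \<open>auto intro!: disjI2 startsby_zero_power_prefix[rule_format]\<close>)
  have "fps_eval K T (f oo g) = (\<Sum>n<K. \<Sum>i<K. (fps_nth f i * fps_nth (g ^ i) n) *\<^sub>R T ^ n)"
    unfolding fps_eval_def by (intro sum.cong refl) (simp add: nth scaleR_sum_left)
  also have "\<dots> = (\<Sum>i<K. fps_nth f i *\<^sub>R fps_eval K T (g ^ i))"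
    by (subst sum.swap) (simp add: fps_eval_def scaleR_sum_right)
  also have "\<dots> = fps_eval K (fps_eval K T g) f"
    by (simp add: fps_eval_power[OF T] fps_eval_def[of _ "fps_eval K T g"])
  finally show ?thesis .
qed

text \<open>\<open>fps_phi\<close> is (exp X - 1) / X and governs the derivative of the exponential;
  \<open>fps_g\<close> is log(1 + X) / X and carries the coefficients of Dynkin's series.
  Substituting exp X - 1 into the latter makes them inverse to each other.\<close>

definition fps_phi :: "real fps" where "fps_phi = Abs_fps (\<lambda>k. 1 / fact (Suc k))"
definition fps_g :: "real fps" where "fps_g = Abs_fps (\<lambda>k. (- 1) ^ k / real (Suc k))"

lemma fps_ln_exp: "fps_ln 1 oo (fps_exp 1 - 1) = (fps_X :: real fps)"
  by (simp add: fps_ln_fps_exp_inv fps_inv_fps_exp_compose)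

lemma fps_phi_g: "fps_phi * (fps_g oo (fps_exp 1 - 1)) = 1"
proof -
  let ?e = "fps_exp 1 - 1 :: real fps"
  have e0: "fps_nth ?e 0 = 0" by simp
  have 1: "fps_X * fps_phi = ?e"
    by (rule fps_ext) (auto simp: fps_phi_def fps_X_mult_nth gr0_conv_Suc)
  have 2: "fps_X * fps_g = fps_ln 1"
    by (rule fps_ext) (auto simp: fps_g_def fps_ln_nth fps_X_mult_nth gr0_conv_Suc)
  have "fps_X * (fps_phi * (fps_g oo ?e)) = (fps_X oo ?e) * (fps_g oo ?e)"
    by (simp add: 1 mult.assoc[symmetric] e0)
  also have "\<dots> = (fps_X * fps_g) oo ?e"
    by (rule fps_compose_mult_distrib[OF e0, symmetric])
  also have "\<dots> = fps_X * 1" by (simp add: 2 fps_ln_exp)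
  finally show ?thesis by (simp only: mult_left_cancel[OF fps_X_neq_zero])
qed

definition nexp :: "nat \<Rightarrow> 'r::real_algebra_1 \<Rightarrow> 'r" where "nexp K T = (\<Sum>k<K. (1 / fact k) *\<^sub>R T ^ k)"

lemma nexp_fps_eval: "nexp K T = fps_eval K T (fps_exp 1)"
  by (simp add: nexp_def fps_eval_def)

lemma scaleR_power_nc: "(t *\<^sub>R T) ^ n = t ^ n *\<^sub>R (T :: 'r::real_algebra_1) ^ n"
  by (induction n) simp_all

lemma nexp_scaleR: "nexp K (t *\<^sub>R T) = fps_eval K T (fps_exp t)"
  unfolding nexp_def fps_eval_def by (intro sum.cong refl) (simp add: scaleR_power_nc)

lemma nexp_add: "T ^ K = 0 \<Longrightarrow> nexp K ((s + t) *\<^sub>R T) = nexp K (s *\<^sub>R T) * nexp K (t *\<^sub>R T)"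
  unfolding nexp_scaleR fps_exp_add_mult by (rule fps_eval_mult)

lemma nexp_0 [simp]: "0 < K \<Longrightarrow> nexp K 0 = 1"
  by (simp add: nexp_def power_0_left if_distrib cong: if_cong)

text \<open>The formal logarithm recovers the exponent.\<close>

lemma nexp_inj:
  assumes "S ^ K = 0" "T ^ K = 0" "1 < K" "nexp K S = nexp K T" shows "S = T"
proof -
  have "R = fps_eval K (nexp K R - 1) (fps_ln 1)" if "R ^ K = 0" for R :: 'a
  proof -
    have "R = fps_eval K R (fps_ln 1 oo (fps_exp 1 - 1))"
      using assms(3) by (simp add: fps_ln_exp fps_eval_X)
    also have "\<dots> = fps_eval K (nexp K R - 1) (fps_ln 1)"
      using assms(3) that by (simp add: fps_eval_compose fps_eval_diff fps_eval_1 nexp_fps_eval)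
    finally show ?thesis .
  qed
  with assms show ?thesis by metis
qed

lemma phi_g_inverse:
  assumes "T ^ K = 0" "0 < K"
  shows "fps_eval K T fps_phi * fps_eval K (nexp K T - 1) fps_g = 1"
proof -
  have "fps_eval K (nexp K T - 1) fps_g = fps_eval K T (fps_g oo (fps_exp 1 - 1))"
    using assms by (simp add: fps_eval_compose fps_eval_diff fps_eval_1 nexp_fps_eval)
  then show ?thesis using assms by (simp add: fps_eval_mult[symmetric] fps_phi_g fps_eval_1)
qed

section \<open>Conjugation by exponentials and the derivative of the exponential\<close>

definition ad_op :: "'r::ring \<Rightarrow> 'r \<Rightarrow> 'r" where "ad_op L W = L * W - W * L"

text \<open>Left multiplication by \<open>L\<close> is \<open>ad_op L\<close> plus right
  multiplication by \<open>L\<close>. These two commute, so the binomial theorem applies.\<close>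

lemma power_mult_ad_op:
  fixes L W :: "'r::real_algebra_1"
  shows "L ^ n * W = (\<Sum>k\<le>n. real (n choose k) *\<^sub>R ((ad_op L ^^ k) W * L ^ (n - k)))"
proof (induction n)
  case (Suc n)
  let ?a = "\<lambda>k. (ad_op L ^^ k) W"
  have "L ^ Suc n * W = L * (L ^ n * W)" by (simp add: mult.assoc)
  also have "\<dots> = (\<Sum>k\<le>n. real (n choose k) *\<^sub>R (L * ?a k * L ^ (n - k)))"
    by (simp add: Suc sum_distrib_left mult.assoc)
  also have "\<dots> = (\<Sum>k\<le>n. real (n choose k) *\<^sub>R (?a (Suc k) * L ^ (n - k)) + real (n choose k) *\<^sub>R (?a k * L ^ (Suc n - k)))"
    by (intro sum.cong refl)
      (simp add: ad_op_def algebra_simps Suc_diff_le power_commutes flip: scaleR_add_right)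
  also have "\<dots> = (\<Sum>k\<le>n. real (n choose k) *\<^sub>R (?a (Suc k) * L ^ (n - k))) + (\<Sum>k\<le>Suc n. real (n choose k) *\<^sub>R (?a k * L ^ (Suc n - k)))"
    by (simp add: sum.distrib)
  also have "(\<Sum>k\<le>Suc n. real (n choose k) *\<^sub>R (?a k * L ^ (Suc n - k))) =
      W * L ^ Suc n + (\<Sum>k\<le>n. real (n choose Suc k) *\<^sub>R (?a (Suc k) * L ^ (n - k)))"
    by (subst sum.atMost_Suc_shift) simp
  also have "(\<Sum>k\<le>n. real (n choose k) *\<^sub>R (?a (Suc k) * L ^ (n - k))) + (W * L ^ Suc n + (\<Sum>k\<le>n. real (n choose Suc k) *\<^sub>R (?a (Suc k) * L ^ (n - k)))) =
    W * L ^ Suc n + (\<Sum>k\<le>n. real (Suc n choose Suc k) *\<^sub>R (?a (Suc k) * L ^ (n - k)))"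
    by (simp add: sum.distrib scaleR_add_left algebra_simps)
  also have "\<dots> = (\<Sum>k\<le>Suc n. real (Suc n choose k) *\<^sub>R (?a k * L ^ (Suc n - k)))"
    unfolding sum.atMost_Suc_shift[of _ n] by simp
  finally show ?case .
qed simp

text \<open>With \<open>A = ad_op L\<close> and \<open>R\<close> right multiplication by
  \<open>L\<close>, the left side is the sum of \<open>(A + R) ^ i R ^ (n - 1 - i)\<close> applied
  to \<open>W\<close>, formally \<open>((A + R) ^ n - R ^ n) / A\<close>. It is the derivative of
  \<open>L ^ n\<close> in direction \<open>W\<close>.\<close>

lemma sum_power_mult_ad_op:
  fixes L W :: "'r::real_algebra_1"
  shows "(\<Sum>i<n. L ^ i * W * L ^ (n - Suc i)) = (\<Sum>k<n. real (n choose Suc k) *\<^sub>R ((ad_op L ^^ k) W * L ^ (n - Suc k)))"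
proof (induction n)
  case (Suc n)
  let ?a = "\<lambda>k. (ad_op L ^^ k) W"
  have pw: "L ^ (n - k) = L ^ (n - Suc k) * L" if "k < n" for k
    using that power_Suc2[of L "n - Suc k"] by (simp add: Suc_diff_Suc)
  have "(\<Sum>i<Suc n. L ^ i * W * L ^ (Suc n - Suc i)) = (\<Sum>i<n. L ^ i * W * L ^ (n - Suc i)) * L + L ^ n * W"
    by (simp add: sum_distrib_right pw mult.assoc)
  also have "\<dots> = (\<Sum>k<n. real (n choose Suc k) *\<^sub>R (?a k * L ^ (n - k))) + L ^ n * W"
    unfolding Suc by (simp add: sum_distrib_right pw mult.assoc)
  also have "(\<Sum>k<n. real (n choose Suc k) *\<^sub>R (?a k * L ^ (n - k))) = (\<Sum>k\<le>n. real (n choose Suc k) *\<^sub>R (?a k * L ^ (n - k)))"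
    by (simp add: lessThan_Suc_atMost[symmetric])
  also have "\<dots> + L ^ n * W = (\<Sum>k<Suc n. real (Suc n choose Suc k) *\<^sub>R (?a k * L ^ (Suc n - Suc k)))"
    unfolding power_mult_ad_op lessThan_Suc_atMost
    by (simp add: sum.distrib[symmetric] scaleR_add_left add.commute)
  finally show ?case .
qed simp

text \<open>The identity exp(L) W exp(-L) = exp(ad L) W. With \<open>2 * M \<le> K\<close>, two
  indices with sum at least \<open>K\<close> include one that is at least \<open>M\<close>, so the
  truncation loses nothing.\<close>

lemma nexp_mult_ad_op:
  fixes L W :: "'r::real_algebra_1"
  assumes "L ^ M = 0" "\<And>k. M \<le> k \<Longrightarrow> (ad_op L ^^ k) W = 0" "2 * M \<le> K"
  shows "nexp K L * W = (\<Sum>k<K. (1 / fact k) *\<^sub>R (ad_op L ^^ k) W) * nexp K L"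
proof -
  let ?F = "\<lambda>i j. ((1 / fact i) *\<^sub>R (ad_op L ^^ i) W) * ((1 / fact j) *\<^sub>R L ^ j)"
  have "nexp K L * W = (\<Sum>n<K. (1 / fact n) *\<^sub>R (L ^ n * W))"
    by (simp add: nexp_def sum_distrib_right)
  also have "\<dots> = (\<Sum>n<K. \<Sum>i\<le>n. ?F i (n - i))"
    unfolding power_mult_ad_op scaleR_sum_right
    by (intro sum.cong refl) (simp add: binomial_fact)
  also have "\<dots> = (\<Sum>i<K. \<Sum>j<K. ?F i j)"
  proof (rule sum_triangle)
    fix i j assume "K \<le> i + j"
    then have "M \<le> i \<or> M \<le> j" using assms(3) by linarith
    then show "?F i j = 0" using assms by (auto simp: nilpotent_power_eq_0[OF assms(1)])
  qed
  also have "\<dots> = (\<Sum>k<K. (1 / fact k) *\<^sub>R (ad_op L ^^ k) W) * nexp K L"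
    unfolding nexp_def by (rule sum_product[symmetric])
  finally show ?thesis .
qed

lemma has_vector_derivative_power_nc:
  fixes L :: "real \<Rightarrow> 'r::{real_normed_algebra,real_algebra_1}"
  assumes "(L has_vector_derivative W) (at t)"
  shows "((\<lambda>t. L t ^ n) has_vector_derivative (\<Sum>i<n. L t ^ i * W * L t ^ (n - Suc i))) (at t)"
proof (induction n)
  case (Suc n)
  have pw: "L t ^ (n - k) = L t ^ (n - Suc k) * L t" if "k < n" for k
    using that power_Suc2[of "L t" "n - Suc k"] by (simp add: Suc_diff_Suc)
  have "((\<lambda>t. L t ^ n * L t) has_vector_derivative
     (L t ^ n * W + (\<Sum>i<n. L t ^ i * W * L t ^ (n - Suc i)) * L t)) (at t)"
    by (rule has_vector_derivative_mult[OF Suc assms])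
  then show ?case
    unfolding power_Suc2 by (simp add: sum_distrib_right pw mult.assoc add.commute)
qed simp

text \<open>Duhamel's formula (exp L)' = phi(ad L)(L') exp(L). Differentiation lowers the degree by
  one, so the double sum is cut at \<open>K - 1\<close>; hence the strict inequality
  \<open>2 * M < K\<close>.\<close>

lemma nexp_has_vector_derivative:
  fixes L :: "real \<Rightarrow> 'r::{real_normed_algebra,real_algebra_1}"
  assumes der: "(L has_vector_derivative W) (at t)"
    and "L t ^ M = 0" "\<And>k. M \<le> k \<Longrightarrow> (ad_op (L t) ^^ k) W = 0" "2 * M < K"
  shows "((\<lambda>t. nexp K (L t)) has_vector_derivative
    (\<Sum>k<K. (1 / fact (Suc k)) *\<^sub>R (ad_op (L t) ^^ k) W) * nexp K (L t)) (at t)"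
proof -
  let ?F = "\<lambda>i j. ((1 / fact (Suc i)) *\<^sub>R (ad_op (L t) ^^ i) W) * ((1 / fact j) *\<^sub>R L t ^ j)"
  obtain K' where K': "K = Suc K'" using assms(4) by (cases K) auto
  have z: "?F i j = 0" if "K' \<le> i + j" for i j
  proof -
    have "M \<le> i \<or> M \<le> j" using assms(4) that K' by linarith
    then show "?F i j = 0" using assms by (auto simp: nilpotent_power_eq_0[OF assms(2)])
  qed
  have "((\<lambda>t. nexp K (L t)) has_vector_derivative
     (\<Sum>n<K. (1 / fact n) *\<^sub>R (\<Sum>i<n. L t ^ i * W * L t ^ (n - Suc i)))) (at t)"
    unfolding nexp_def
    by (intro has_vector_derivative_sum bounded_linear.has_vector_derivative[OF bounded_linear_scaleR_right]
        has_vector_derivative_power_nc der)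
  also have "(\<Sum>n<K. (1 / fact n) *\<^sub>R (\<Sum>i<n. L t ^ i * W * L t ^ (n - Suc i))) =
     (\<Sum>n<K'. (1 / fact (Suc n)) *\<^sub>R (\<Sum>k\<le>n. real (Suc n choose Suc k) *\<^sub>R ((ad_op (L t) ^^ k) W * L t ^ (n - k))))"
    unfolding sum_power_mult_ad_op K' by (subst sum.lessThan_Suc_shift) (simp add: lessThan_Suc_atMost)
  also have "\<dots> = (\<Sum>n<K'. \<Sum>i\<le>n. ?F i (n - i))"
    unfolding scaleR_sum_right
    by (intro sum.cong refl) (simp add: binomial_fact del: fact_Suc binomial_Suc_Suc)
  also have "\<dots> = (\<Sum>i<K'. \<Sum>j<K'. ?F i j)"
    by (rule sum_triangle[OF z])
  also have "\<dots> = (\<Sum>i<K. \<Sum>j<K. ?F i j)"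
    using z[of K'] z[of _ K'] by (simp add: K' del: fact_Suc)
  also have "\<dots> = (\<Sum>k<K. (1 / fact (Suc k)) *\<^sub>R (ad_op (L t) ^^ k) W) * nexp K (L t)"
    unfolding nexp_def by (rule sum_product[symmetric])
  finally show ?thesis .
qed

section \<open>The Baker--Campbell--Hausdorff group law\<close>

context carnot_group
begin

text \<open>
  The adjoint action of \<open>x\<close> on the extension of the Lie algebra by the grading derivation \<open>euler\<close>,
  spanned by \<open>(0, 1)\<close>. As all degrees are positive, it is faithful, whereas the adjoint
  representation on \<open>'a\<close> itself kills the centre.
\<close>

definition ad_ext :: "'a \<Rightarrow> ('a \<times> real) endo" where
  "ad_ext x = endo_mk (\<lambda>(v, s). (br x v - s *\<^sub>R euler x, 0))"

lemma endo_ap_ad_ext [simp]: "endo_ap (ad_ext x) (v, s) = (br x v - s *\<^sub>R euler x, 0)"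
proof -
  have "linear (\<lambda>(v, s). (br x v - s *\<^sub>R euler x, 0 :: real))"
    by (rule linearI) (auto simp: br_add_right br_scaleR_right algebra_simps)
  then show ?thesis by (simp add: ad_ext_def endo_ap_endo_mk)
qed

lemma linear_ad_ext: "linear ad_ext"
  by (rule linearI; rule endo_eqI; case_tac x)
    (simp_all add: endo_ap_plus endo_ap_scaleR br_add_left br_scaleR_left linear_add[OF linear_euler]
      linear_scale[OF linear_euler] algebra_simps)

lemmas ad_ext_simps = linear_add[OF linear_ad_ext] linear_scale[OF linear_ad_ext] linear_0[OF linear_ad_ext]
  linear_diff[OF linear_ad_ext] linear_neg[OF linear_ad_ext]

text \<open>The vector part is the Jacobi identity; the part coming from \<open>(0, 1)\<close> is
  the derivation property of \<open>euler\<close>.\<close>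

lemma ad_op_ad_ext: "ad_op (ad_ext x) (ad_ext y) = ad_ext (br x y)"
proof (rule endo_eqI)
  fix h :: "'a \<times> real"
  show "endo_ap (ad_op (ad_ext x) (ad_ext y)) h = endo_ap (ad_ext (br x y)) h"
    by (cases h) (simp add: ad_op_def endo_ap_minus br_br euler_br br_diff_right br_scaleR_right
        br_swap[of "euler x" y] algebra_simps)
qed

lemma ad_op_ad_ext_power: "(ad_op (ad_ext x) ^^ k) (ad_ext y) = ad_ext ((br x ^^ k) y)"
  by (induction k) (simp_all add: ad_op_ad_ext)

text \<open>The derivation \<open>(0, 1)\<close> is put in degree 0. Since \<open>ad_ext x\<close>
  sends it to \<open>- euler x\<close>, of degree at least 1, \<open>ad_ext x\<close> raises degrees
  on all of the extended algebra.\<close>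

definition filt_ext :: "nat \<Rightarrow> ('a \<times> real) set" where
  "filt_ext m = {h. fst h \<in> filt m \<and> (0 < m \<longrightarrow> snd h = 0)}"

text \<open>Operators that raise degrees by \<open>m\<close>. Beyond the step only 0 remains, so a
  congruence that holds for every \<open>m\<close> is an equality; identities between operators can
  thus be proved by induction on \<open>m\<close>.\<close>

definition filt_endo :: "nat \<Rightarrow> ('a \<times> real) endo set" where
  "filt_endo m = {T. \<forall>k. \<forall>h\<in>filt_ext k. endo_ap T h \<in> filt_ext (k + m)}"

lemma subspace_filt_ext: "subspace (filt_ext m)"
  using subspace_filt[of m] by (auto simp: subspace_def filt_ext_def)

lemma filt_ext_0 [simp]: "filt_ext 0 = UNIV"
  by (auto simp: filt_ext_def filt_le_1)

lemma filt_ext_mono: "i \<le> j \<Longrightarrow> filt_ext j \<subseteq> filt_ext i"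
  using filt_mono[of i j] by (auto simp: filt_ext_def)

lemma filt_ext_gt_step: "step G < m \<Longrightarrow> filt_ext m = {0}"
proof -
  assume "step G < m"
  then have "filt m = {0}" "0 < m" by (auto simp: filt_gt_step)
  then have "h \<in> filt_ext m \<longleftrightarrow> h = 0" for h
    by (cases h) (auto simp: filt_ext_def zero_prod_def)
  then show ?thesis by blast
qed

lemma filt_endo_D: "T \<in> filt_endo m \<Longrightarrow> h \<in> filt_ext k \<Longrightarrow> endo_ap T h \<in> filt_ext (k + m)"
  unfolding filt_endo_def by blast

lemma filt_endo_I: "(\<And>k h. h \<in> filt_ext k \<Longrightarrow> endo_ap T h \<in> filt_ext (k + m)) \<Longrightarrow> T \<in> filt_endo m"
  unfolding filt_endo_def by blast

lemma subspace_filt_endo: "subspace (filt_endo m)"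
  unfolding subspace_def
proof (intro conjI ballI allI filt_endo_I)
  fix S T c k h assume *: "S \<in> filt_endo m" "T \<in> filt_endo m" "h \<in> filt_ext k"
  show "endo_ap (S + T) h \<in> filt_ext (k + m)"
    unfolding endo_ap_plus by (intro subspace_add[OF subspace_filt_ext] filt_endo_D *)
next
  fix S c k h assume *: "S \<in> filt_endo m" "h \<in> filt_ext k"
  show "endo_ap (c *\<^sub>R S) h \<in> filt_ext (k + m)"
    unfolding endo_ap_scaleR by (intro subspace_scale[OF subspace_filt_ext] filt_endo_D *)
qed (simp add: subspace_0[OF subspace_filt_ext])

lemma filt_endo_mult: assumes "S \<in> filt_endo i" "T \<in> filt_endo j" shows "S * T \<in> filt_endo (i + j)"
proof (rule filt_endo_I)
  fix k h assume "h \<in> filt_ext k"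
  then have "endo_ap S (endo_ap T h) \<in> filt_ext (k + j + i)" using assms by (intro filt_endo_D)
  then show "endo_ap (S * T) h \<in> filt_ext (k + (i + j))" by (simp add: algebra_simps)
qed

lemma filt_endo_mult_0: "S \<in> filt_endo 0 \<Longrightarrow> T \<in> filt_endo j \<Longrightarrow> S * T \<in> filt_endo j" "S \<in> filt_endo j \<Longrightarrow> T \<in> filt_endo 0 \<Longrightarrow> S * T \<in> filt_endo j"
  using filt_endo_mult[of S 0 T j] filt_endo_mult[of S j T 0] by simp_all

lemma filt_endo_mono: "i \<le> j \<Longrightarrow> filt_endo j \<subseteq> filt_endo i"
proof
  fix T assume ij: "i \<le> j" "T \<in> filt_endo j"
  show "T \<in> filt_endo i"
  proof (rule filt_endo_I)
    fix k h assume "h \<in> filt_ext k"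
    then have "endo_ap T h \<in> filt_ext (k + j)" by (rule filt_endo_D[OF ij(2)])
    then show "endo_ap T h \<in> filt_ext (k + i)" using filt_ext_mono[of "k + i" "k + j"] ij(1) by auto
  qed
qed

lemma filt_endo_one: "1 \<in> filt_endo 0"
  by (auto simp: filt_endo_def)

lemma filt_endo_power: "T \<in> filt_endo i \<Longrightarrow> T ^ n \<in> filt_endo (n * i)"
  by (induction n) (auto simp: filt_endo_one intro: filt_endo_mult)

lemma filt_endo_gt_step: assumes "step G < m" "T \<in> filt_endo m" shows "T = 0"
proof (rule endo_eqI)
  fix h show "endo_ap T h = endo_ap 0 h"
    using filt_endo_D[OF assms(2), of h 0] filt_ext_gt_step[OF assms(1)] by simp
qed

lemma ad_ext_filt_endo: assumes "1 \<le> m" "x \<in> filt m" shows "ad_ext x \<in> filt_endo m"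
proof -
  have "euler x \<in> filt m" using assms by (auto simp: filt_def euler_inner)
  then have "br x v - s *\<^sub>R euler x \<in> filt (k + m)" if "v \<in> filt k" "0 < k \<longrightarrow> s = 0" for v s k
    using br_filt[OF assms(2) that(1)] that(2) filt_mono[of m "m + k"]
      subspace_filt[of m] by (cases "k = 0") (auto simp: add.commute intro: subspace_diff subspace_scale)
  note * = this
  show ?thesis
  proof (rule filt_endo_I)
    fix k and h :: "'a \<times> real" assume "h \<in> filt_ext k"
    then show "endo_ap (ad_ext x) h \<in> filt_ext (k + m)"
      using *[of "fst h" k "snd h"] assms(1) by (cases h) (auto simp: filt_ext_def)
  qed
qed

lemma ad_ext_filt_endo_1: "ad_ext x \<in> filt_endo 1"
  by (rule ad_ext_filt_endo) (auto simp: filt_le_1)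

lemma ad_ext_nilpotent: "ad_ext x ^ Suc (step G) = 0"
  using filt_endo_power[OF ad_ext_filt_endo_1, of x "Suc (step G)"] by (intro filt_endo_gt_step[of "Suc (step G)"]) auto

lemma br_power_filt: "(br x ^^ k) y \<in> filt k"
  by (induction k) (auto simp: filt_le_1 br_filt_Suc)

lemma br_power_eq_0: "Suc (step G) \<le> k \<Longrightarrow> (br x ^^ k) y = 0"
  using br_power_filt[where k=k] filt_gt_step by auto

text \<open>\<open>ad_ext x ^ Suc (step G) = 0\<close>, so \<open>M = Suc (step G)\<close> in the
  formulas for truncated exponentials, and the truncation has to exceed twice that number.\<close>

definition nil_bound :: nat where "nil_bound = 2 * step G + 4"

lemma nil_bound: "2 * Suc (step G) < nil_bound" "1 < nil_bound" "0 < nil_bound" "step G < nil_bound" "Suc (step G) \<le> nil_bound"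
  by (auto simp: nil_bound_def)

lemma ad_ext_power_nil_bound: "ad_ext x ^ nil_bound = 0"
  by (rule nilpotent_power_eq_0[OF ad_ext_nilpotent nil_bound(5)])

definition exp_ad :: "'a \<Rightarrow> ('a \<times> real) endo" where "exp_ad x = nexp nil_bound (ad_ext x)"
definition ead :: "'a \<Rightarrow> 'a \<Rightarrow> 'a" where "ead x y = (\<Sum>k<nil_bound. (1 / fact k) *\<^sub>R (br x ^^ k) y)"

text \<open>The logarithm gives back \<open>ad_ext x\<close>, whose value at \<open>(0, 1)\<close>
  is \<open>- euler x\<close>, and no degree is 0. Identities in the group are proved by comparing
  their images under \<open>exp_ad\<close>.\<close>

lemma exp_ad_inj: "exp_ad x = exp_ad y \<Longrightarrow> x = y"
proof -
  assume "exp_ad x = exp_ad y"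
  then have "ad_ext x = ad_ext y" unfolding exp_ad_def by (rule nexp_inj[OF ad_ext_power_nil_bound ad_ext_power_nil_bound nil_bound(2)])
  then have "endo_ap (ad_ext x) (0, 1) = endo_ap (ad_ext y) (0, 1)" by simp
  then have "euler x = euler y" by simp
  then show "x = y" by (rule euler_inj)
qed

lemma endo_ap_ad_ext_power: "endo_ap (ad_ext x ^ k) (v, 0) = ((br x ^^ k) v, 0)"
  by (induction k) simp_all

lemma exp_ad_ad_ext: "exp_ad x * ad_ext y = ad_ext (ead x y) * exp_ad x"
proof -
  have "exp_ad x * ad_ext y = (\<Sum>k<nil_bound. (1 / fact k) *\<^sub>R (ad_op (ad_ext x) ^^ k) (ad_ext y)) * exp_ad x"
    unfolding exp_ad_def
    by (rule nexp_mult_ad_op[OF ad_ext_nilpotent]) (use nil_bound in \<open>simp_all add: ad_op_ad_ext_power br_power_eq_0 ad_ext_simps\<close>)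
  then show ?thesis
    by (simp add: ad_op_ad_ext_power ead_def linear_sum[OF linear_ad_ext] ad_ext_simps)
qed

lemma exp_ad_add: "exp_ad ((s + t) *\<^sub>R x) = exp_ad (s *\<^sub>R x) * exp_ad (t *\<^sub>R x)"
  using nexp_add[OF ad_ext_power_nil_bound] by (simp add: exp_ad_def ad_ext_simps)

lemma exp_ad_0 [simp]: "exp_ad 0 = 1"
  using nil_bound by (simp add: exp_ad_def ad_ext_simps)

lemma exp_ad_minus: "exp_ad (- x) * exp_ad x = 1" "exp_ad x * exp_ad (- x) = 1"
  using exp_ad_add[of "-1" 1 x] exp_ad_add[of 1 "-1" x] by simp_all

lemma exp_ad_filt_endo: "exp_ad x \<in> filt_endo 0"
  unfolding exp_ad_def nexp_def
  by (intro subspace_sum subspace_scale subspace_filt_endo)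
    (use filt_endo_power[OF subsetD[OF filt_endo_mono ad_ext_filt_endo_1], of 0] in simp)

lemma exp_ad_scaleR_deriv: "((\<lambda>t. exp_ad (t *\<^sub>R x)) has_vector_derivative ad_ext x * exp_ad (t *\<^sub>R x)) (at t)"
  and exp_ad_ad_ext_commute: "ad_ext x * exp_ad (t *\<^sub>R x) = exp_ad (t *\<^sub>R x) * ad_ext x"
proof -
  \<comment> \<open>\<open>x\<close> commutes with itself, so only the term \<open>k = 0\<close> of
    Duhamel's formula survives.\<close>
  have br0: "(br (t *\<^sub>R x) ^^ k) x = (if k = 0 then x else 0)" for k
    by (induction k) (simp_all add: br_scaleR_left)
  have "((\<lambda>t. nexp nil_bound (ad_ext (t *\<^sub>R x))) has_vector_derivative
    (\<Sum>k<nil_bound. (1 / fact (Suc k)) *\<^sub>R (ad_op (ad_ext (t *\<^sub>R x)) ^^ k) (ad_ext x)) * nexp nil_bound (ad_ext (t *\<^sub>R x))) (at t)"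
  proof (rule nexp_has_vector_derivative[OF _ ad_ext_nilpotent _ nil_bound(1)])
    show "((\<lambda>t. ad_ext (t *\<^sub>R x)) has_vector_derivative ad_ext x) (at t)"
      using bounded_linear.has_vector_derivative[OF bounded_linear_scaleR_left has_vector_derivative_id, of "ad_ext x"]
      by (simp add: ad_ext_simps)
  qed (simp add: ad_op_ad_ext_power br_power_eq_0 ad_ext_simps(3))
  moreover have "(\<Sum>k<nil_bound. (1 / fact (Suc k)) *\<^sub>R (ad_op (ad_ext (t *\<^sub>R x)) ^^ k) (ad_ext x)) = ad_ext x"
    unfolding ad_op_ad_ext_power br0 using nil_bound by (simp add: if_distrib ad_ext_simps(3) cong: if_cong)
  ultimately show "((\<lambda>t. exp_ad (t *\<^sub>R x)) has_vector_derivative ad_ext x * exp_ad (t *\<^sub>R x)) (at t)"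
    by (simp add: exp_ad_def)
  have "ead (t *\<^sub>R x) x = x"
    unfolding ead_def using nil_bound by (simp add: br0 if_distrib cong: if_cong)
  then show "ad_ext x * exp_ad (t *\<^sub>R x) = exp_ad (t *\<^sub>R x) * ad_ext x"
    by (simp add: exp_ad_ad_ext)
qed

end

section \<open>Dynkin's series, sorted by the number of blocks\<close>

context carnot_group
begin

definition bch_deg :: "(nat \<times> nat) list \<Rightarrow> nat" where "bch_deg rs = (\<Sum>(r, s)\<leftarrow>rs. r + s)"
definition bch_fact :: "(nat \<times> nat) list \<Rightarrow> real" where "bch_fact rs = (\<Prod>(r, s)\<leftarrow>rs. fact r * fact s)"
definition bch_letters :: "'a \<Rightarrow> 'a \<Rightarrow> (nat \<times> nat) list \<Rightarrow> 'a list" where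
  "bch_letters x y rs = concat (map (\<lambda>(r, s). replicate r x @ replicate s y) rs)"
definition bch_word :: "'a \<Rightarrow> 'a \<Rightarrow> (nat \<times> nat) list \<Rightarrow> 'a" where
  "bch_word x y rs = lie_word br (bch_letters x y rs)"

lemma bch_simps [simp]:
  "bch_deg [] = 0" "bch_deg ((r, s) # rs) = r + s + bch_deg rs"
  "bch_fact [] = 1" "bch_fact ((r, s) # rs) = fact r * fact s * bch_fact rs"
  "bch_letters x y [] = []" "bch_letters x y ((r, s) # rs) = replicate r x @ replicate s y @ bch_letters x y rs"
  by (simp_all add: bch_deg_def bch_fact_def bch_letters_def)

lemma length_bch_letters: "length (bch_letters x y rs) = bch_deg rs"
  by (induction rs) auto

lemma bch_fact_pos: "0 < bch_fact rs"
  by (induction rs) auto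

lemma mult_bch: "mult G x y = (\<Sum>rs\<in>bch_index (step G).
    ((-1) ^ (length rs - 1) / (real (length rs) * real (bch_deg rs) * bch_fact rs)) *\<^sub>R bch_word x y rs)"
  by (simp add: mult_def bch_deg_def bch_fact_def bch_word_def bch_letters_def)

lemma lie_word_scaleR: "lie_word br (map (scaleR t) ws) = t ^ length ws *\<^sub>R lie_word br ws"
proof (induction ws)
  case (Cons w ws)
  then show ?case by (cases ws) (simp_all add: br_scaleR_left br_scaleR_right)
qed simp

lemma bch_word_scaleR: "bch_word (t *\<^sub>R x) (t *\<^sub>R y) rs = t ^ bch_deg rs *\<^sub>R bch_word x y rs"
proof -
  have "bch_letters (t *\<^sub>R x) (t *\<^sub>R y) rs = map (scaleR t) (bch_letters x y rs)"
    by (induction rs) auto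
  then show ?thesis by (simp add: bch_word_def lie_word_scaleR length_bch_letters)
qed

lemma lie_word_replicate_append:
  "ws \<noteq> [] \<Longrightarrow> lie_word br (replicate r x @ ws) = (br x ^^ r) (lie_word br ws)"
proof (induction r)
  case (Suc r)
  then show ?case by (cases "replicate r x @ ws") auto
qed simp

lemma lie_word_replicate: "lie_word br (replicate s y) = (if s = 1 then y else 0)"
proof (induction s)
  case (Suc s)
  then show ?case by (cases s) auto
qed simp

lemma bch_word_single: "bch_word x y [(r, s)] = (if s = 0 then (if r = 1 then x else 0)
    else if s = 1 then (br x ^^ r) y else 0)"
proof -
  have "(br x ^^ r) 0 = 0" by (induction r) auto
  then show ?thesis
    by (cases "s = 0") (auto simp: bch_word_def lie_word_replicate lie_word_replicate_append)
qed

lemma bch_word_Cons: "0 < bch_deg rs \<Longrightarrow> bch_word x y ((r, s) # rs) = (br x ^^ r) ((br y ^^ s) (bch_word x y rs))"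
proof -
  assume "0 < bch_deg rs"
  then have "bch_letters x y rs \<noteq> []" using length_bch_letters[of x y rs] by auto
  then show ?thesis by (simp add: bch_word_def lie_word_replicate_append)
qed

text \<open>The exponents range over a box instead of having bounded total degree, because over a
  box the product of two truncated exponentials factorises. The lists gained in this way give words
  longer than the step, which are 0.\<close>

definition blocks :: "(nat \<times> nat) set" where "blocks = {..<nil_bound} \<times> {..<nil_bound} - {(0, 0)}"
definition block_lists :: "nat \<Rightarrow> (nat \<times> nat) list set" where
  "block_lists n = {rs. set rs \<subseteq> blocks \<and> length rs = n}"

lemma finite_blocks: "finite blocks" by (simp add: blocks_def)

lemma block_lists_0: "block_lists 0 = {[]}"
  by (auto simp: block_lists_def)

lemma sum_block_lists_Suc:
  fixes F :: "(nat \<times> nat) list \<Rightarrow> 'b::comm_monoid_add"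
  shows "(\<Sum>rs\<in>block_lists (Suc n). F rs) = (\<Sum>p\<in>blocks. \<Sum>rs\<in>block_lists n. F (p # rs))"
proof -
  have "block_lists (Suc n) = (\<lambda>(p, rs). p # rs) ` (blocks \<times> block_lists n)"
    by (auto simp: block_lists_def image_iff length_Suc_conv)
  moreover have "inj_on (\<lambda>(p, rs). p # rs) (blocks \<times> block_lists n)"
    by (auto simp: inj_on_def)
  ultimately show ?thesis
    by (simp add: sum.reindex sum.cartesian_product case_prod_unfold)
qed

lemma bch_deg_pos: "rs \<in> block_lists (Suc n) \<Longrightarrow> 0 < bch_deg rs"
  by (cases rs) (auto simp: block_lists_def blocks_def)

text \<open>The words with \<open>k + 1\<close> blocks in the \<open>t\<close>-derivative of
  Dynkin's series at \<open>t x\<close> and \<open>t y\<close>, without the factor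
  \<open>(-1) ^ k / (k + 1)\<close>. Differentiating \<open>t ^ bch_deg rs\<close> cancels the total
  degree in the denominator, the only factor that does not split over the blocks.\<close>

definition bch_part :: "'a \<Rightarrow> 'a \<Rightarrow> real \<Rightarrow> nat \<Rightarrow> 'a" where
  "bch_part x y t k = (\<Sum>rs\<in>block_lists (Suc k). (t ^ (bch_deg rs - 1) / bch_fact rs) *\<^sub>R bch_word x y rs)"

text \<open>A word that ends in two equal letters has innermost bracket 0. A single block therefore
  survives only as \<open>(1, 0)\<close> or as \<open>(r, 1)\<close>, and the latter add up to the
  exponential of \<open>ad x\<close>.\<close>

lemma bch_part_0: "bch_part x y t 0 = x + ead (t *\<^sub>R x) y"
proof -
  let ?f = "\<lambda>(r, s). (t ^ (r + s - 1) / (fact r * fact s)) *\<^sub>R bch_word x y [(r, s)]"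
  have brt: "(br (t *\<^sub>R x) ^^ k) y = t ^ k *\<^sub>R (br x ^^ k) y" for k
    by (induction k) (simp_all add: br_scaleR_left br_scaleR_right)
  have "bch_part x y t 0 = (\<Sum>p\<in>blocks. ?f p)"
    unfolding bch_part_def sum_block_lists_Suc block_lists_0
    by (intro sum.cong refl) (auto split: prod.splits)
  also have "\<dots> = (\<Sum>p\<in>insert (1, 0) ((\<lambda>r. (r, 1)) ` {..<nil_bound}). ?f p)"
    by (rule sum.mono_neutral_right[OF finite_blocks])
      (use nil_bound in \<open>auto simp: blocks_def bch_word_single image_iff split: if_splits\<close>)
  also have "\<dots> = ?f (1, 0) + (\<Sum>p\<in>(\<lambda>r. (r, 1)) ` {..<nil_bound}. ?f p)"
    by (rule sum.insert) auto
  also have "(\<Sum>p\<in>(\<lambda>r. (r, 1)) ` {..<nil_bound}. ?f p) = (\<Sum>r<nil_bound. ?f (r, 1))"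
    by (subst sum.reindex) (auto simp: inj_on_def)
  also have "\<dots> = ead (t *\<^sub>R x) y"
    unfolding ead_def brt by (intro sum.cong refl) (simp add: bch_word_single)
  finally show ?thesis by (simp add: bch_word_single)
qed

lemma exp_ad_mult_expand: "exp_ad (t *\<^sub>R x) * exp_ad (t *\<^sub>R y) - 1 =
   (\<Sum>(r, s)\<in>blocks. (t ^ (r + s) / (fact r * fact s)) *\<^sub>R (ad_ext x ^ r * ad_ext y ^ s))"
proof -
  let ?f = "\<lambda>(r, s). (t ^ (r + s) / (fact r * fact s)) *\<^sub>R (ad_ext x ^ r * ad_ext y ^ s)"
  have e: "exp_ad (t *\<^sub>R z) = (\<Sum>r<nil_bound. (t ^ r / fact r) *\<^sub>R ad_ext z ^ r)" for z
    unfolding exp_ad_def nexp_def ad_ext_simps(2) scaleR_power_nc by simp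
  have "exp_ad (t *\<^sub>R x) * exp_ad (t *\<^sub>R y) = (\<Sum>p\<in>{..<nil_bound} \<times> {..<nil_bound}. ?f p)"
    unfolding e sum_product sum.cartesian_product
    by (intro sum.cong refl) (auto simp: power_add mult.commute)
  also have "\<dots> = ?f (0, 0) + (\<Sum>p\<in>blocks. ?f p)"
    unfolding blocks_def using nil_bound by (intro sum.remove) auto
  finally show ?thesis by simp
qed

text \<open>Prepending a block \<open>(r, s)\<close> applies the \<open>r\<close>-th power of
  \<open>ad x\<close> after the \<open>s\<close>-th power of \<open>ad y\<close>, and the weighted
  sum of these operators over all blocks is the product of exponentials minus 1.\<close>

lemma bch_part_Suc: "endo_ap (exp_ad (t *\<^sub>R x) * exp_ad (t *\<^sub>R y) - 1) (bch_part x y t k, 0) = (bch_part x y t (Suc k), 0)"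
proof -
  have lin: "linear (\<lambda>v. (br x ^^ r) ((br y ^^ s) v))" for r s
  proof -
    have "linear (br z ^^ n)" for z n
      by (induction n) (simp_all only: funpow.simps linear_id linear_compose[OF _ linear_br_right])
    from linear_compose[OF this this] show ?thesis by (simp add: o_def)
  qed
  have "bch_part x y t (Suc k) = (\<Sum>(r, s)\<in>blocks. \<Sum>rs\<in>block_lists (Suc k).
     (t ^ (r + s) / (fact r * fact s)) *\<^sub>R (t ^ (bch_deg rs - 1) / bch_fact rs) *\<^sub>R (br x ^^ r) ((br y ^^ s) (bch_word x y rs)))"
    unfolding bch_part_def[of _ _ _ "Suc k"] sum_block_lists_Suc[of _ "Suc k"]
  proof (intro sum.cong refl, safe, intro sum.cong refl)
    fix r s rs assume "rs \<in> block_lists (Suc k)"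
    then have "0 < bch_deg rs" by (rule bch_deg_pos)
    then obtain d where "bch_deg rs = Suc d" using gr0_conv_Suc by blast
    then show "(t ^ (bch_deg ((r, s) # rs) - 1) / bch_fact ((r, s) # rs)) *\<^sub>R bch_word x y ((r, s) # rs) =
      (t ^ (r + s) / (fact r * fact s)) *\<^sub>R (t ^ (bch_deg rs - 1) / bch_fact rs) *\<^sub>R (br x ^^ r) ((br y ^^ s) (bch_word x y rs))"
      by (simp add: bch_word_Cons power_add)
  qed
  also have "\<dots> = (\<Sum>(r, s)\<in>blocks. (t ^ (r + s) / (fact r * fact s)) *\<^sub>R (br x ^^ r) ((br y ^^ s) (bch_part x y t k)))"
    by (intro sum.cong refl)
      (auto simp: bch_part_def linear_sum[OF lin] linear_scale[OF lin] scaleR_sum_right)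
  finally show ?thesis
    by (simp add: exp_ad_mult_expand endo_ap_sum endo_ap_scaleR endo_ap_ad_ext_power case_prod_unfold sum_prod)
qed

lemma endo_ap_exp_ad_mult_power: "endo_ap ((exp_ad (t *\<^sub>R x) * exp_ad (t *\<^sub>R y) - 1) ^ k) (bch_part x y t 0, 0) = (bch_part x y t k, 0)"
  by (induction k) (simp_all only: power_0 power_Suc endo_ap_mult endo_ap_one bch_part_Suc)

definition bch_deriv :: "'a \<Rightarrow> 'a \<Rightarrow> real \<Rightarrow> 'a" where
  "bch_deriv x y t = (\<Sum>rs\<in>bch_index (step G).
    ((-1) ^ (length rs - 1) / (real (length rs) * bch_fact rs) * t ^ (bch_deg rs - 1)) *\<^sub>R bch_word x y rs)"

lemma mult_has_vector_derivative:
  "((\<lambda>t. mult G (t *\<^sub>R x) (t *\<^sub>R y)) has_vector_derivative bch_deriv x y t) (at t)"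
proof -
  have pos: "0 < bch_deg rs" if "rs \<in> bch_index (step G)" for rs
    using that by (cases rs) (auto simp: bch_index_def)
  show ?thesis
    unfolding mult_bch bch_deriv_def bch_word_scaleR scaleR_scaleR
  proof (intro has_vector_derivative_sum)
    fix rs assume rs: "rs \<in> bch_index (step G)"
    let ?c = "(-1) ^ (length rs - 1) / (real (length rs) * real (bch_deg rs) * bch_fact rs)"
    have "((\<lambda>t. ?c * t ^ bch_deg rs) has_real_derivative ?c * (bch_deg rs * t ^ (bch_deg rs - 1))) (at t)"
      using DERIV_pow[of "bch_deg rs" t] by (intro DERIV_cmult) simp
    moreover have "?c * (bch_deg rs * t ^ (bch_deg rs - 1)) =
       (-1) ^ (length rs - 1) / (real (length rs) * bch_fact rs) * t ^ (bch_deg rs - 1)"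
      using pos[OF rs] bch_fact_pos[of rs] by simp
    ultimately show "((\<lambda>t. (?c * t ^ bch_deg rs) *\<^sub>R bch_word x y rs) has_vector_derivative
       ((-1) ^ (length rs - 1) / (real (length rs) * bch_fact rs) * t ^ (bch_deg rs - 1)) *\<^sub>R bch_word x y rs) (at t)"
      using has_vector_derivative_scaleR[OF _ has_vector_derivative_const] by fastforce
  qed
qed

text \<open>Grouped by the number of blocks, the series is a power series in the product of
  exponentials minus 1, applied to the single-block part. Its coefficients
  \<open>(-1) ^ k / (k + 1)\<close> are those of log(1 + X) / X.\<close>

lemma bch_deriv_eq: "(bch_deriv x y t, 0) =
   endo_ap (fps_eval nil_bound (exp_ad (t *\<^sub>R x) * exp_ad (t *\<^sub>R y) - 1) fps_g) (x + ead (t *\<^sub>R x) y, 0)"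
proof -
  let ?c = "\<lambda>rs. ((-1) ^ (length rs - 1) / (real (length rs) * bch_fact rs) * t ^ (bch_deg rs - 1)) *\<^sub>R bch_word x y rs"
  define \<Omega> where "\<Omega> = {rs. set rs \<subseteq> blocks \<and> length rs \<in> {1..nil_bound}}"
  have fin: "finite \<Omega>"
    by (rule finite_subset[OF _ finite_lists_length_le[OF finite_blocks, of nil_bound]]) (auto simp: \<Omega>_def)
  have el: "r \<le> bch_deg rs \<and> s \<le> bch_deg rs" if "(r, s) \<in> set rs" for r s rs
    using that by (induction rs) auto
  have len: "length rs \<le> bch_deg rs" if "\<forall>(r, s)\<in>set rs. 0 < r + s" for rs
    using that by (induction rs) (auto simp: Suc_le_eq split: prod.splits)
  have "bch_deriv x y t = (\<Sum>rs\<in>\<Omega>. ?c rs)"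
    unfolding bch_deriv_def
  proof (rule sum.mono_neutral_left[OF fin])
    show "bch_index (step G) \<subseteq> \<Omega>"
    proof
      fix rs assume rs: "rs \<in> bch_index (step G)"
      then have *: "rs \<noteq> []" "\<forall>(r, s)\<in>set rs. 0 < r + s" "bch_deg rs \<le> step G"
        by (auto simp: bch_index_def bch_deg_def)
      have "set rs \<subseteq> blocks"
      proof safe
        fix r s assume "(r, s) \<in> set rs"
        with el[OF this] * nil_bound(4) show "(r, s) \<in> blocks" unfolding blocks_def by fastforce
      qed
      moreover have "length rs \<in> {1..nil_bound}"
        using * len[OF *(2)] nil_bound(4) by (cases rs) auto
      ultimately show "rs \<in> \<Omega>" by (simp add: \<Omega>_def)
    qed
    show "\<forall>rs\<in>\<Omega> - bch_index (step G). ?c rs = 0"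
    proof
      fix rs assume rs: "rs \<in> \<Omega> - bch_index (step G)"
      then have "step G < bch_deg rs"
        by (auto simp: \<Omega>_def bch_index_def bch_deg_def blocks_def subset_iff not_le)
      then have "bch_word x y rs = 0" unfolding bch_word_def
        by (intro lie_word_eq_0) (simp add: length_bch_letters)
      then show "?c rs = 0" by simp
    qed
  qed
  also have "\<dots> = (\<Sum>k<nil_bound. \<Sum>rs\<in>{rs\<in>\<Omega>. length rs - 1 = k}. ?c rs)"
    by (rule sum.group[symmetric, OF fin]) (auto simp: \<Omega>_def)
  also have "\<dots> = (\<Sum>k<nil_bound. ((-1) ^ k / real (Suc k)) *\<^sub>R bch_part x y t k)"
  proof (intro sum.cong refl)
    fix k assume "k \<in> {..<nil_bound}"
    then have "{rs\<in>\<Omega>. length rs - 1 = k} = block_lists (Suc k)"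
      by (auto simp: \<Omega>_def block_lists_def)
    then show "(\<Sum>rs\<in>{rs\<in>\<Omega>. length rs - 1 = k}. ?c rs) = ((-1) ^ k / real (Suc k)) *\<^sub>R bch_part x y t k"
      by (simp add: bch_part_def scaleR_sum_right block_lists_def)
  qed
  finally have *: "bch_deriv x y t = (\<Sum>k<nil_bound. ((-1) ^ k / real (Suc k)) *\<^sub>R bch_part x y t k)" .
  have "endo_ap (fps_eval nil_bound (exp_ad (t *\<^sub>R x) * exp_ad (t *\<^sub>R y) - 1) fps_g) (bch_part x y t 0, 0) =
     (\<Sum>k<nil_bound. ((-1) ^ k / real (Suc k)) *\<^sub>R (bch_part x y t k, 0))"
    by (simp add: fps_eval_def endo_ap_sum endo_ap_scaleR endo_ap_exp_ad_mult_power fps_g_def del: scaleR_Pair of_nat_Suc)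
  then show ?thesis
    by (simp add: * bch_part_0 sum_prod)
qed

text \<open>The curve is the inverse of \<open>A t = exp_ad (t x) * exp_ad (t y)\<close>, for which
  \<open>A' = ad_ext u * A\<close> with \<open>u = x + ead (t x) y\<close>. The second summand of
  \<open>u\<close> arises when \<open>ad_ext y\<close> is moved past the exponential of
  \<open>x\<close>.\<close>

lemma exp_ad_mult_deriv:
  "((\<lambda>t. exp_ad (t *\<^sub>R - y) * exp_ad (t *\<^sub>R - x)) has_vector_derivative
     - (exp_ad (t *\<^sub>R - y) * exp_ad (t *\<^sub>R - x) * ad_ext (x + ead (t *\<^sub>R x) y))) (at t)"
proof -
  have *: "exp_ad (t *\<^sub>R - x) * ad_ext (ead (t *\<^sub>R x) y) = ad_ext y * exp_ad (t *\<^sub>R - x)"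
  proof -
    have "exp_ad (t *\<^sub>R - x) * ad_ext (ead (t *\<^sub>R x) y) = exp_ad (- (t *\<^sub>R x)) * (ad_ext (ead (t *\<^sub>R x) y) * exp_ad (t *\<^sub>R x)) * exp_ad (- (t *\<^sub>R x))"
      by (simp add: mult.assoc exp_ad_minus)
    also have "\<dots> = (exp_ad (- (t *\<^sub>R x)) * exp_ad (t *\<^sub>R x)) * ad_ext y * exp_ad (- (t *\<^sub>R x))"
      by (simp only: exp_ad_ad_ext[symmetric] mult.assoc)
    finally show ?thesis by (simp add: exp_ad_minus)
  qed
  have "((\<lambda>t. exp_ad (t *\<^sub>R - y) * exp_ad (t *\<^sub>R - x)) has_vector_derivative
     (exp_ad (t *\<^sub>R - y) * (ad_ext (- x) * exp_ad (t *\<^sub>R - x)) + (ad_ext (- y) * exp_ad (t *\<^sub>R - y)) * exp_ad (t *\<^sub>R - x))) (at t)"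
    by (rule has_vector_derivative_mult[OF exp_ad_scaleR_deriv exp_ad_scaleR_deriv])
  also have "exp_ad (t *\<^sub>R - y) * (ad_ext (- x) * exp_ad (t *\<^sub>R - x)) + (ad_ext (- y) * exp_ad (t *\<^sub>R - y)) * exp_ad (t *\<^sub>R - x)
     = - (exp_ad (t *\<^sub>R - y) * exp_ad (t *\<^sub>R - x) * ad_ext (x + ead (t *\<^sub>R x) y))"
    unfolding exp_ad_ad_ext_commute ad_ext_simps(1) distrib_left mult.assoc[of _ "exp_ad (t *\<^sub>R - x)"] *
    by (simp add: ad_ext_simps(5) mult.assoc)
  finally show ?thesis .
qed

text \<open>The subspace is cut out by linear functionals, and each of them is constant along
  \<open>f\<close> because its derivative vanishes.\<close>

lemma filt_ext_deriv_const:
  assumes der: "\<And>t. (f has_vector_derivative f' t) (at t)" and f': "\<And>t. f' t \<in> filt_ext m"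
  shows "f t - f 0 \<in> filt_ext m"
proof -
  have c: "h (f t) = h (f 0)" if h: "bounded_linear h" "\<And>z. z \<in> filt_ext m \<Longrightarrow> h z = 0" for h :: "'a \<times> real \<Rightarrow> real"
  proof -
    have "((\<lambda>t. h (f t)) has_vector_derivative h (f' t)) (at t)" for t
      by (rule bounded_linear.has_vector_derivative[OF h(1) der])
    then have "((\<lambda>t. h (f t)) has_real_derivative 0) (at t)" for t
      using h(2)[OF f'] by (simp add: has_real_derivative_iff_has_vector_derivative)
    then show ?thesis by (intro DERIV_isconst_all) auto
  qed
  have "fst (f t) \<bullet> b = fst (f 0) \<bullet> b" if "b \<in> Basis" "deg b < m" for b
    by (rule c[of "\<lambda>z. fst z \<bullet> b"])
      (use that in \<open>auto simp: filt_ext_def filt_def intro!: bounded_linear_compose[OF bounded_linear_inner_left bounded_linear_fst]\<close>)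
  moreover have "snd (f t) = snd (f 0)" if "0 < m"
    by (rule c[of snd]) (use that in \<open>auto simp: filt_ext_def intro!: bounded_linear_snd\<close>)
  ultimately show ?thesis by (auto simp: filt_ext_def filt_def inner_diff_left)
qed

text \<open>\<open>filt_endo m\<close> absorbs multiplication by \<open>filt_endo 0\<close> from
  both sides, so \<open>S ^ k - T ^ k\<close> telescopes into it.\<close>

lemma fps_eval_diff_filt_endo:
  assumes "S \<in> filt_endo 0" "T \<in> filt_endo 0" "S - T \<in> filt_endo m"
  shows "fps_eval K S f - fps_eval K T f \<in> filt_endo m"
proof -
  have "S ^ k - T ^ k \<in> filt_endo m" for k
  proof (induction k)
    case (Suc k)
    have "S ^ Suc k - T ^ Suc k = S * (S ^ k - T ^ k) + (S - T) * T ^ k"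
      by (simp add: algebra_simps)
    also have "\<dots> \<in> filt_endo m"
      using Suc assms filt_endo_power[OF assms(2), of k] by (intro subspace_add[OF subspace_filt_endo] filt_endo_mult_0) auto
    finally show ?case .
  qed (simp add: subspace_0[OF subspace_filt_endo])
  then show ?thesis
    unfolding fps_eval_def sum_subtractf[symmetric] scaleR_diff_right[symmetric]
    by (intro subspace_sum subspace_scale subspace_filt_endo)
qed

lemma fps_eval_filt_endo: "T \<in> filt_endo 0 \<Longrightarrow> fps_eval K T f \<in> filt_endo 0"
  unfolding fps_eval_def using filt_endo_power[of T 0] by (intro subspace_sum subspace_scale subspace_filt_endo) auto

text \<open>
  With \<open>A t = exp_ad (t x) * exp_ad (t y)\<close>, \<open>Z t = mult G (t x) (t y)\<close> and \<open>B t = exp_ad (Z t)\<close>, Dynkin's series says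
  \<open>Z' = g(A) u\<close> where \<open>A' = ad_ext u * A\<close>, whereas \<open>B' = ad_ext (phi(ad Z) Z') * B\<close> and \<open>phi(ad Z) g(B) = 1\<close>.
  Hence an agreement of \<open>A\<close> and \<open>B\<close> up to filtration degree \<open>m\<close> improves to degree \<open>m + 1\<close>.
\<close>

lemma exp_ad_mult_aux:
  fixes x y :: 'a
  defines "A \<equiv> \<lambda>t. exp_ad (t *\<^sub>R x) * exp_ad (t *\<^sub>R y)"
    and "B \<equiv> \<lambda>t. exp_ad (mult G (t *\<^sub>R x) (t *\<^sub>R y))"
  shows "A t - B t \<in> filt_endo m"
proof (induction m arbitrary: t)
  case 0
  show ?case unfolding A_def B_def
    by (intro subspace_diff[OF subspace_filt_endo] filt_endo_mult_0 exp_ad_filt_endo)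
next
  case (Suc m)
  define D where "D = (\<lambda>t. exp_ad (t *\<^sub>R - y) * exp_ad (t *\<^sub>R - x))"
  define Z where "Z = (\<lambda>t. mult G (t *\<^sub>R x) (t *\<^sub>R y))"
  define u where "u = (\<lambda>t. x + ead (t *\<^sub>R x) y)"
  define q where "q = (\<lambda>t. \<Sum>k<nil_bound. (1 / fact (Suc k)) *\<^sub>R (br (Z t) ^^ k) (bch_deriv x y t))"
  have A0: "A t \<in> filt_endo 0" and B0: "B t \<in> filt_endo 0" and D0: "D t \<in> filt_endo 0" for t
    unfolding A_def B_def D_def by (intro filt_endo_mult_0 exp_ad_filt_endo)+
  have dB: "(B has_vector_derivative ad_ext (q t) * B t) (at t)" for t
  proof -
    have "((\<lambda>t. nexp nil_bound (ad_ext (Z t))) has_vector_derivative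
      (\<Sum>k<nil_bound. (1 / fact (Suc k)) *\<^sub>R (ad_op (ad_ext (Z t)) ^^ k) (ad_ext (bch_deriv x y t))) * nexp nil_bound (ad_ext (Z t))) (at t)"
    proof (rule nexp_has_vector_derivative[OF _ ad_ext_nilpotent _ nil_bound(1)])
      show "((\<lambda>t. ad_ext (Z t)) has_vector_derivative ad_ext (bch_deriv x y t)) (at t)"
        unfolding Z_def
        by (rule bounded_linear.has_vector_derivative[OF linear_ad_ext[unfolded linear_conv_bounded_linear] mult_has_vector_derivative])
    qed (simp add: ad_op_ad_ext_power br_power_eq_0 ad_ext_simps(3))
    then show ?thesis
      by (simp add: ad_op_ad_ext_power q_def linear_sum[OF linear_ad_ext] ad_ext_simps(2) B_def exp_ad_def Z_def)
  qed
  \<comment> \<open>As phi(ad Z) g(B - 1) = 1, \<open>u\<close> is given by the formula for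
    \<open>q\<close> with \<open>B\<close> in place of \<open>A\<close>. The two operators differ by
    an element of \<open>filt_endo m\<close>, and \<open>(u t, 0)\<close> has degree at least 1:
    this is the degree gained.\<close>
  have q_u: "q t - u t \<in> filt (Suc m)" for t
  proof -
    let ?\<phi> = "fps_eval nil_bound (ad_ext (Z t)) fps_phi"
    have "(q t, 0) = endo_ap ?\<phi> (bch_deriv x y t, 0)"
      by (simp add: q_def fps_eval_def fps_phi_def endo_ap_sum endo_ap_scaleR endo_ap_ad_ext_power sum_prod)
    also have "\<dots> = endo_ap ?\<phi> (endo_ap (fps_eval nil_bound (A t - 1) fps_g) (u t, 0))"
      by (simp add: bch_deriv_eq A_def u_def)
    finally have q: "(q t, 0) = endo_ap (?\<phi> * fps_eval nil_bound (A t - 1) fps_g) (u t, 0)" by simp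
    have u: "(u t, 0) = endo_ap (?\<phi> * fps_eval nil_bound (B t - 1) fps_g) (u t, 0)"
      using phi_g_inverse[OF ad_ext_power_nil_bound nil_bound(3), of "Z t"] by (simp add: B_def exp_ad_def Z_def)
    have "(q t - u t, 0) = (q t, 0) - (u t, 0 :: real)" by simp
    also have "\<dots> = endo_ap (?\<phi> * (fps_eval nil_bound (A t - 1) fps_g - fps_eval nil_bound (B t - 1) fps_g)) (u t, 0)"
      by (subst q, subst u) (simp only: endo_ap_minus right_diff_distrib)
    also have "\<dots> \<in> filt_ext (1 + m)"
    proof (rule filt_endo_D)
      have "ad_ext (Z t) \<in> filt_endo 0" using filt_endo_mono[of 0 1] ad_ext_filt_endo_1 by auto
      then show "?\<phi> * (fps_eval nil_bound (A t - 1) fps_g - fps_eval nil_bound (B t - 1) fps_g) \<in> filt_endo m"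
        by (intro filt_endo_mult_0(1) fps_eval_filt_endo fps_eval_diff_filt_endo subspace_diff[OF subspace_filt_endo _ filt_endo_one] A0 B0)
          (simp_all add: Suc)
      show "(u t, 0) \<in> filt_ext 1" by (simp add: filt_ext_def filt_le_1)
    qed
    finally show ?thesis by (simp add: filt_ext_def)
  qed
  have dC: "((\<lambda>t. D t * B t) has_vector_derivative D t * ad_ext (q t - u t) * B t) (at t)" for t
  proof -
    have "((\<lambda>t. D t * B t) has_vector_derivative D t * (ad_ext (q t) * B t) + - (D t * ad_ext (u t)) * B t) (at t)"
      using has_vector_derivative_mult[OF exp_ad_mult_deriv dB] by (simp add: D_def u_def)
    then show ?thesis by (simp add: ad_ext_simps(4) algebra_simps)
  qed
  \<comment> \<open>The derivative of \<open>D * B\<close> raises degrees by \<open>m + 1\<close>,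
    and \<open>D * B\<close> is 1 at 0. Multiplying by \<open>A\<close>, the inverse of
    \<open>D\<close>, yields \<open>B - A\<close>.\<close>
  have "D t * B t - D 0 * B 0 \<in> filt_endo (Suc m)"
  proof (rule filt_endo_I)
    fix k h assume h: "h \<in> filt_ext k"
    have "((\<lambda>t. endo_ap (D t * B t) h) has_vector_derivative endo_ap (D t * ad_ext (q t - u t) * B t) h) (at t)" for t
      by (rule bounded_linear.has_vector_derivative[OF bounded_bilinear.bounded_linear_left[OF bounded_bilinear_endo_ap] dC])
    moreover have "endo_ap (D t * ad_ext (q t - u t) * B t) h \<in> filt_ext (k + Suc m)" for t
      by (rule filt_endo_D[OF _ h]) (intro filt_endo_mult_0 D0 B0 ad_ext_filt_endo q_u, simp)
    ultimately have "endo_ap (D t * B t) h - endo_ap (D 0 * B 0) h \<in> filt_ext (k + Suc m)"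
      by (rule filt_ext_deriv_const)
    then show "endo_ap (D t * B t - D 0 * B 0) h \<in> filt_ext (k + Suc m)" by (simp only: endo_ap_minus)
  qed
  moreover have "D 0 * B 0 = 1"
  proof -
    have "mult G 0 0 = 0" using mult_minus[OF carnot, of 0] by simp
    then show ?thesis by (simp add: D_def B_def)
  qed
  ultimately have "A t * (D t * B t - 1) \<in> filt_endo (Suc m)"
    by (intro filt_endo_mult_0 A0) simp
  moreover have "A t * D t = 1"
  proof -
    have "A t * D t = exp_ad (t *\<^sub>R x) * (exp_ad (t *\<^sub>R y) * exp_ad (- (t *\<^sub>R y))) * exp_ad (- (t *\<^sub>R x))"
      by (simp add: A_def D_def mult.assoc)
    then show ?thesis by (simp add: exp_ad_minus)
  qed
  then have "A t * (D t * B t - 1) = B t - A t"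
    by (simp add: right_diff_distrib mult.assoc[symmetric])
  ultimately show ?case
    using subspace_neg[OF subspace_filt_endo, of "B t - A t" "Suc m"] by simp
qed

lemma exp_ad_mult: "exp_ad (mult G x y) = exp_ad x * exp_ad y"
proof -
  have "exp_ad (1 *\<^sub>R x) * exp_ad (1 *\<^sub>R y) - exp_ad (mult G (1 *\<^sub>R x) (1 *\<^sub>R y)) = 0"
    by (rule filt_endo_gt_step[OF lessI exp_ad_mult_aux])
  then show ?thesis by simp
qed

section \<open>Group axioms, conjugation and dilations\<close>

lemma mult_assoc: "mult G (mult G x y) z = mult G x (mult G y z)"
  by (rule exp_ad_inj) (simp add: exp_ad_mult mult.assoc)

lemma mult_0_right [simp]: "mult G x 0 = x" and mult_0_left [simp]: "mult G 0 x = x"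
  by (rule exp_ad_inj, simp add: exp_ad_mult)+

lemma mult_minus_right [simp]: "mult G x (- x) = 0" and mult_minus_left [simp]: "mult G (- x) x = 0"
  by (rule exp_ad_inj, simp add: exp_ad_mult exp_ad_minus)+

lemma mult_minus_cancel [simp]: "mult G (- x) (mult G x y) = y" "mult G x (mult G (- x) y) = y"
  "mult G (mult G y x) (- x) = y" "mult G (mult G y (- x)) x = y"
  by (simp_all add: mult_assoc) (simp_all add: mult_assoc[symmetric])

lemma minus_mult: "- mult G x y = mult G (- y) (- x)"
proof -
  have "mult G (mult G x y) (mult G (- y) (- x)) = 0"
    by (simp add: mult_assoc)
  then show ?thesis by (metis mult_minus_cancel(1) mult_0_right)
qed

lemma mult_scaleR_add: "mult G (s *\<^sub>R x) (t *\<^sub>R x) = (s + t) *\<^sub>R x"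
  by (rule exp_ad_inj) (simp only: exp_ad_mult exp_ad_add)

text \<open>Since \<open>exp_ad x\<close> intertwines \<open>ad_ext y\<close> with
  \<open>ad_ext (ead x y)\<close>, it intertwines their powers and hence their exponentials.\<close>

lemma mult_conj: "mult G (mult G x y) (- x) = ead x y"
proof (rule exp_ad_inj)
  have *: "exp_ad x * ad_ext y ^ n = ad_ext (ead x y) ^ n * exp_ad x" for n
  proof (induction n)
    case (Suc n)
    have "exp_ad x * ad_ext y ^ Suc n = (exp_ad x * ad_ext y) * ad_ext y ^ n" by (simp add: mult.assoc)
    also have "\<dots> = ad_ext (ead x y) * (exp_ad x * ad_ext y ^ n)" by (simp add: exp_ad_ad_ext mult.assoc)
    finally show ?case by (simp add: Suc mult.assoc)
  qed simp
  have "exp_ad x * exp_ad y = exp_ad (ead x y) * exp_ad x"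
    unfolding exp_ad_def[of y] exp_ad_def[of "ead x y"] nexp_def sum_distrib_left sum_distrib_right
    by (simp add: *)
  then have "exp_ad x * exp_ad y * exp_ad (- x) = exp_ad (ead x y)"
    by (simp add: mult.assoc exp_ad_minus)
  then show "exp_ad (mult G (mult G x y) (- x)) = exp_ad (ead x y)"
    by (simp add: exp_ad_mult)
qed

lemma dilation_mult: "dilation G s (mult G x y) = mult G (dilation G s x) (dilation G s y)"
proof -
  have w: "dilation G s (lie_word br ws) = lie_word br (map (dilation G s) ws)" for ws
  proof (induction ws)
    case (Cons w ws)
    then show ?case by (cases ws) (simp_all add: dilation_br)
  qed simp
  have l: "map (dilation G s) (bch_letters x y rs) = bch_letters (dilation G s x) (dilation G s y) rs" for rs
    by (induction rs) auto
  show ?thesis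
    unfolding mult_bch linear_sum[OF linear_dilation] linear_scale[OF linear_dilation] bch_word_def w l ..
qed

end

section \<open>Haar measure\<close>

lemma polynomial_function_inner [intro]:
  assumes "polynomial_function f" shows "real_polynomial_function (\<lambda>z. f z \<bullet> b)"
  using assms bounded_linear_inner_left[of b] by (auto simp: polynomial_function_def o_def)

text \<open>With the other coordinates fixed, the map translates the coordinate along
  \<open>b\<close> by a constant. Fubini reduces the claim to translation invariance on the
  line.\<close>

lemma lborel_shear:
  fixes b :: "'a::euclidean_space" and g :: "'a \<Rightarrow> real"
  assumes b: "b \<in> Basis" and g [measurable]: "g \<in> borel_measurable borel"
    and inv: "\<And>y c. g (y + c *\<^sub>R b) = g y"
  shows "distr lborel borel (\<lambda>y. y + g y *\<^sub>R b) = lborel"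
proof -
  interpret product_sigma_finite "\<lambda>_::'a. lborel :: real measure" ..
  define I where "I = Basis - {b}"
  have I: "finite I" "b \<notin> I" "Basis = insert b I" using b by (auto simp: I_def)
  define S where "S = (\<lambda>f :: 'a \<Rightarrow> real. \<Sum>c\<in>Basis. f c *\<^sub>R c)"
  have [measurable]: "S \<in> borel_measurable (\<Pi>\<^sub>M c\<in>Basis. lborel)"
    unfolding S_def by measurable
  have Supd: "S (f(b := t)) = S (f(b := 0)) + t *\<^sub>R b" for f t
  proof -
    have "S (f(b := t)) = t *\<^sub>R b + (\<Sum>c\<in>I. f c *\<^sub>R c)" for t
    proof -
      have "(\<Sum>c\<in>I. (f(b := t)) c *\<^sub>R c) = (\<Sum>c\<in>I. f c *\<^sub>R c)"
        by (intro sum.cong refl) (use I(2) in auto)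
      then show ?thesis unfolding S_def I(3) using I(1,2) by simp
    qed
    then show ?thesis by simp
  qed
  have lb: "(\<integral>\<^sup>+y. h y \<partial>lborel) = (\<integral>\<^sup>+f. (\<integral>\<^sup>+t. h (S (f(b := 0)) + t *\<^sub>R b) \<partial>lborel) \<partial>(\<Pi>\<^sub>M c\<in>I. lborel))"
    if [measurable]: "h \<in> borel_measurable borel" for h
  proof -
    have "(\<integral>\<^sup>+y. h y \<partial>lborel) = (\<integral>\<^sup>+f. h (S f) \<partial>(\<Pi>\<^sub>M c\<in>Basis. lborel))"
      by (subst lborel_eq, subst nn_integral_distr) (simp_all add: S_def)
    also have "\<dots> = (\<integral>\<^sup>+f. (\<integral>\<^sup>+t. h (S (f(b := t))) \<partial>lborel) \<partial>(\<Pi>\<^sub>M c\<in>I. lborel))"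
      unfolding I(3) by (rule product_nn_integral_insert[OF I(1,2)]) (simp add: I(3)[symmetric])
    finally show ?thesis by (subst (asm) Supd)
  qed
  have inv': "g (c *\<^sub>R b + y) = g y" for y c using inv[of y c] by (simp add: add.commute)
  show ?thesis
  proof (rule measure_eqI)
    fix A assume "A \<in> sets (distr lborel borel (\<lambda>y. y + g y *\<^sub>R b))"
    then have A [measurable]: "A \<in> sets borel" by simp
    let ?h = "\<lambda>y. indicator A y :: ennreal"
    have "emeasure (distr lborel borel (\<lambda>y. y + g y *\<^sub>R b)) A = (\<integral>\<^sup>+y. ?h y \<partial>distr lborel borel (\<lambda>y. y + g y *\<^sub>R b))"
      by simp
    also have "\<dots> = (\<integral>\<^sup>+y. ?h (y + g y *\<^sub>R b) \<partial>lborel)"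
      by (rule nn_integral_distr) simp_all
    also have "\<dots> = (\<integral>\<^sup>+f. (\<integral>\<^sup>+t. ?h (S (f(b := 0)) + (g (S (f(b := 0))) + 1 * t) *\<^sub>R b) \<partial>lborel) \<partial>(\<Pi>\<^sub>M c\<in>I. lborel))"
      by (subst lb) (simp_all add: inv inv' algebra_simps)
    also have "\<dots> = (\<integral>\<^sup>+f. (\<integral>\<^sup>+t. ?h (S (f(b := 0)) + t *\<^sub>R b) \<partial>lborel) \<partial>(\<Pi>\<^sub>M c\<in>I. lborel))"
    proof (rule nn_integral_cong)
      fix f :: "'a \<Rightarrow> real"
      show "(\<integral>\<^sup>+t. ?h (S (f(b := 0)) + (g (S (f(b := 0))) + 1 * t) *\<^sub>R b) \<partial>lborel) =
        (\<integral>\<^sup>+t. ?h (S (f(b := 0)) + t *\<^sub>R b) \<partial>lborel)"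
        using nn_integral_real_affine[of "\<lambda>t. ?h (S (f(b := 0)) + t *\<^sub>R b)" 1 "g (S (f(b := 0)))"] by simp
    qed
    also have "\<dots> = (\<integral>\<^sup>+y. ?h y \<partial>lborel)"
      by (rule lb[symmetric]) simp
    finally show "emeasure (distr lborel borel (\<lambda>y. y + g y *\<^sub>R b)) A = emeasure lborel A"
      by simp
  qed simp
qed

section \<open>The group law as a polynomial map\<close>

context carnot_group
begin

lemma polynomial_function_br [intro]:
  assumes "polynomial_function f" "polynomial_function g"
  shows "polynomial_function (\<lambda>z. br (f z) (g z))"
  unfolding br_expand[of "f _"]
  by (intro polynomial_function_sum polynomial_function_mult finite_Basis polynomial_function_const)
    (use assms in \<open>auto simp flip: real_polynomial_function_eq\<close>)

lemma polynomial_function_bch_word: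
  assumes f: "polynomial_function f" and g: "polynomial_function g"
  shows "polynomial_function (\<lambda>z. bch_word (f z) (g z) rs)"
proof -
  have "\<exists>fs. (\<forall>h\<in>set fs. polynomial_function h) \<and> (\<forall>z. bch_letters (f z) (g z) rs = map (\<lambda>h. h z) fs)"
  proof (induction rs)
    case (Cons p rs)
    then obtain fs where fs: "\<forall>h\<in>set fs. polynomial_function h" "\<forall>z. bch_letters (f z) (g z) rs = map (\<lambda>h. h z) fs"
      by auto
    obtain r s where p: "p = (r, s)" by fastforce
    show ?case
      by (rule exI[of _ "replicate r f @ replicate s g @ fs"]) (use fs f g in \<open>auto simp: p set_replicate_conv_if\<close>)
  qed auto
  then obtain fs where fs: "\<forall>h\<in>set fs. polynomial_function h" "\<And>z. bch_letters (f z) (g z) rs = map (\<lambda>h. h z) fs"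
    by auto
  have "polynomial_function (\<lambda>z. lie_word br (map (\<lambda>h. h z) fs))"
    using fs(1)
  proof (induction fs)
    case (Cons h fs)
    then show ?case by (cases fs) auto
  qed simp
  then show ?thesis by (simp add: bch_word_def fs)
qed

lemma polynomial_function_mult_group [intro]:
  "polynomial_function f \<Longrightarrow> polynomial_function g \<Longrightarrow> polynomial_function (\<lambda>z. mult G (f z) (g z))"
  unfolding mult_bch
  by (intro polynomial_function_sum finite_bch_index polynomial_function_cmul polynomial_function_bch_word)

lemma continuous_on_mult_pair: "continuous_on UNIV (\<lambda>(x, y). mult G x y)"
proof -
  have "polynomial_function (\<lambda>z. mult G (fst z) (snd z))"
    by (intro polynomial_function_mult_group polynomial_function_bounded_linear bounded_linear_fst bounded_linear_snd)
  then show ?thesis by (simp add: continuous_on_polymonial_function case_prod_unfold)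
qed

lemma continuous_on_mult_group [continuous_intros]:
  assumes "continuous_on A f" "continuous_on A g" shows "continuous_on A (\<lambda>z. mult G (f z) (g z))"
  using continuous_on_compose2[OF continuous_on_mult_pair continuous_on_Pair[OF assms]] by simp

lemma continuous_on_dilation [continuous_intros]:
  assumes "continuous_on A s" "continuous_on A f" shows "continuous_on A (\<lambda>z. dilation G (s z) (f z))"
  unfolding dilation_eq by (intro continuous_intros assms)

lemma borel_measurable_mult_group [measurable (raw)]:
  assumes [measurable]: "f \<in> borel_measurable M" "g \<in> borel_measurable M"
  shows "(\<lambda>z. mult G (f z) (g z)) \<in> borel_measurable M"
proof -
  have "(\<lambda>(x, y). mult G x y) \<in> borel_measurable (borel \<Otimes>\<^sub>M borel)"
    using borel_measurable_continuous_onI[OF continuous_on_mult_pair] by (simp add: borel_prod)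
  from measurable_compose[OF _ this, of "\<lambda>z. (f z, g z)"] show ?thesis by simp
qed

lemma borel_measurable_dilation [measurable (raw)]:
  assumes [measurable]: "f \<in> borel_measurable M" "s \<in> borel_measurable M"
  shows "(\<lambda>z. dilation G (s z) (f z)) \<in> borel_measurable M"
  unfolding dilation_eq by measurable

section \<open>Invariance of Lebesgue measure under translations and its scaling under
  dilations\<close>

definition bch_rest :: "'a \<Rightarrow> 'a \<Rightarrow> 'a" where "bch_rest x y = mult G x y - (x + y)"

text \<open>Apart from the two single letters every word contains a bracket, so a change of the
  arguments modulo \<open>filt i\<close> is felt only modulo \<open>filt (Suc i)\<close>.
  Translations are thus unipotent triangular in graded coordinates.\<close>

lemma bch_rest_triangular:
  assumes "x - x' \<in> filt i" "y - y' \<in> filt i"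
  shows "bch_rest x y - bch_rest x' y' \<in> filt (Suc i)"
proof -
  let ?S = "{[(1, 0)], [(0, 1)]} :: (nat \<times> nat) list set"
  let ?c = "\<lambda>rs. (-1) ^ (length rs - 1) / (real (length rs) * real (bch_deg rs) * bch_fact rs)"
  have S: "?S \<subseteq> bch_index (step G)"
    using step_pos by (auto simp: bch_index_def)
  have rest: "bch_rest x y = (\<Sum>rs\<in>bch_index (step G) - ?S. ?c rs *\<^sub>R bch_word x y rs)" for x y
  proof -
    have "mult G x y = (\<Sum>rs\<in>bch_index (step G) - ?S. ?c rs *\<^sub>R bch_word x y rs) + (\<Sum>rs\<in>?S. ?c rs *\<^sub>R bch_word x y rs)"
      unfolding mult_bch by (rule sum.subset_diff[OF S finite_bch_index])
    then show ?thesis by (simp add: bch_rest_def bch_word_single)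
  qed
  have deg: "bch_deg rs \<noteq> 1" if rs: "rs \<in> bch_index (step G) - ?S" for rs
  proof
    assume d: "bch_deg rs = 1"
    obtain r s rs' where rs': "rs = (r, s) # rs'"
      using rs by (cases rs) (auto simp: bch_index_def)
    have "rs' = []"
      using rs d by (cases rs') (auto simp: rs' bch_index_def)
    then show False
      using rs d by (auto simp: rs' bch_index_def)
  qed
  have "bch_word x y rs - bch_word x' y' rs \<in> filt (Suc i)" if "rs \<in> bch_index (step G) - ?S" for rs
  proof -
    have rep: "list_all2 (\<lambda>u v. u - v \<in> filt i) (replicate n u) (replicate n v)" if "u - v \<in> filt i" for n u v
      using that by (simp add: list_all2_conv_all_nth)
    have "list_all2 (\<lambda>u v. u - v \<in> filt i) (bch_letters x y rs) (bch_letters x' y' rs)"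
    proof (induction rs)
      case (Cons p rs)
      then show ?case using assms
        by (cases p) (auto intro!: list_all2_appendI rep)
    qed simp
    from lie_word_diff[OF this] show ?thesis
      using deg[OF that] by (simp add: bch_word_def length_bch_letters)
  qed
  then show ?thesis
    unfolding rest sum_subtractf[symmetric] scaleR_diff_right[symmetric]
    by (intro subspace_sum subspace_scale subspace_filt)
qed

text \<open>The map is a composition of shears, one basis vector at a time, highest degrees first.
  When \<open>b\<close> is added, the shifts already made lie in \<open>filt (deg b)\<close>, and
  the \<open>b\<close>-component of \<open>R\<close> is unchanged by them.\<close>

lemma lborel_triangular:
  assumes [measurable]: "R \<in> borel_measurable borel"
    and R: "\<And>y y' i. y - y' \<in> filt i \<Longrightarrow> R y - R y' \<in> filt (Suc i)"
  shows "distr lborel borel (\<lambda>y. y + R y) = lborel"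
proof -
  define \<Phi> where "\<Phi> = (\<lambda>S y. y + (\<Sum>b\<in>S. (R y \<bullet> b) *\<^sub>R b))"
  have inv: "R y \<bullet> b = R y' \<bullet> b" if "b \<in> Basis" "y - y' \<in> filt (deg b)" for b y y'
    using R[OF that(2)] that(1) by (auto simp: filt_def inner_diff_left)
  have "S \<subseteq> Basis \<longrightarrow> distr lborel borel (\<Phi> S) = lborel" if "finite S" for S
    using that
  proof (induction S rule: finite_ranking_induct[where f = "\<lambda>b. - int (deg b)"])
    case empty
    show ?case by (simp add: \<Phi>_def distr_id2)
  next
    case (insert b S)
    show ?case
    proof (cases "b \<in> S")
      case True
      with insert show ?thesis by (simp add: insert_absorb)
    next
      case False
      show ?thesis
      proof
        assume bS: "insert b S \<subseteq> Basis"
        have [measurable]: "\<Phi> S \<in> borel_measurable borel" unfolding \<Phi>_def by measurable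
        let ?T = "\<lambda>z. z + (R z \<bullet> b) *\<^sub>R b"
        have "R (\<Phi> S y) \<bullet> b = R y \<bullet> b" for y
        proof (rule inv)
          have "(\<Sum>c\<in>S. (R y \<bullet> c) *\<^sub>R c) \<in> filt (deg b)"
          proof (intro subspace_sum subspace_scale subspace_filt)
            fix c assume c: "c \<in> S"
            then have "deg b \<le> deg c" using insert.hyps(2)[OF c] by simp
            moreover have "c \<in> filt (deg c)" using layer_filt deg c bS by auto
            ultimately show "c \<in> filt (deg b)" using filt_mono by auto
          qed
          then show "\<Phi> S y - y \<in> filt (deg b)" by (simp add: \<Phi>_def)
        qed (use bS in auto)
        then have "\<Phi> (insert b S) = ?T \<circ> \<Phi> S"
          using False insert.hyps by (auto simp: \<Phi>_def fun_eq_iff algebra_simps)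
        then have "distr lborel borel (\<Phi> (insert b S)) = distr (distr lborel borel (\<Phi> S)) borel ?T"
          by (simp add: distr_distr)
        also have "\<dots> = distr lborel borel ?T"
          using insert.IH bS by simp
        also have "\<dots> = lborel"
        proof (rule lborel_shear)
          fix y c
          have "b \<in> filt (deg b)" using layer_filt deg bS by auto
          then have "y + c *\<^sub>R b - y \<in> filt (deg b)" by (simp add: subspace_scale subspace_filt)
          then show "R (y + c *\<^sub>R b) \<bullet> b = R y \<bullet> b" using bS by (intro inv) auto
        qed (use bS in auto)
        finally show "distr lborel borel (\<Phi> (insert b S)) = lborel" .
      qed
    qed
  qed
  from this[OF finite_Basis] show ?thesis
    by (simp add: \<Phi>_def euclidean_representation)
qed

lemma lborel_left_translation: "distr lborel borel (mult G x) = lborel"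
  and lborel_right_translation: "distr lborel borel (\<lambda>y. mult G y x) = lborel"
proof -
  have m: "(\<lambda>y. mult G x y - y) \<in> borel_measurable borel" "(\<lambda>y. mult G y x - y) \<in> borel_measurable borel"
    by measurable
  have "distr lborel borel (\<lambda>y. y + (mult G x y - y)) = lborel"
  proof (rule lborel_triangular[OF m(1)])
    fix y y' i assume "y - y' \<in> filt i"
    then have "bch_rest x y - bch_rest x y' \<in> filt (Suc i)"
      by (intro bch_rest_triangular) (auto simp: subspace_0 subspace_filt)
    then show "mult G x y - y - (mult G x y' - y') \<in> filt (Suc i)"
      by (simp add: bch_rest_def algebra_simps)
  qed
  then show "distr lborel borel (mult G x) = lborel" by simp
  have "distr lborel borel (\<lambda>y. y + (mult G y x - y)) = lborel"
  proof (rule lborel_triangular[OF m(2)])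
    fix y y' i assume "y - y' \<in> filt i"
    then have "bch_rest y x - bch_rest y' x \<in> filt (Suc i)"
      by (intro bch_rest_triangular) (auto simp: subspace_0 subspace_filt)
    then show "mult G y x - y - (mult G y' x - y') \<in> filt (Suc i)"
      by (simp add: bch_rest_def algebra_simps)
  qed
  then show "distr lborel borel (\<lambda>y. mult G y x) = lborel" by simp
qed

lemma nn_integral_left_translation:
  assumes [measurable]: "f \<in> borel_measurable borel"
  shows "(\<integral>\<^sup>+y. f (mult G x y) \<partial>lborel) = (\<integral>\<^sup>+y. f y \<partial>lborel)"
  using nn_integral_distr[of "mult G x" lborel borel f] by (simp add: lborel_left_translation)

lemma integral_left_translation:
  fixes f :: "'a \<Rightarrow> real" assumes [measurable]: "f \<in> borel_measurable borel"
  shows "(\<integral>y. f (mult G x y) \<partial>lborel) = (\<integral>y. f y \<partial>lborel)"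
  using integral_distr[of "mult G x" lborel borel f] by (simp add: lborel_left_translation)

lemma integral_right_translation:
  fixes f :: "'a \<Rightarrow> real" assumes [measurable]: "f \<in> borel_measurable borel"
  shows "(\<integral>y. f (mult G y x) \<partial>lborel) = (\<integral>y. f y \<partial>lborel)"
  using integral_distr[of "\<lambda>y. mult G y x" lborel borel f] by (simp add: lborel_right_translation)

abbreviation Q :: nat where "Q \<equiv> hom_dim G"

lemma lborel_dilation:
  assumes "0 < s"
  shows "lborel = density (distr lborel borel (dilation G s)) (\<lambda>_. ennreal (s ^ Q))"
proof -
  have "(\<Prod>b\<in>Basis. \<bar>s ^ deg b\<bar>) = s ^ Q"
    using assms by (simp add: hom_dim_eq power_sum)
  then show ?thesis
    using lborel_affine_euclidean[of "\<lambda>b. s ^ deg b" 0] assms by (simp add: dilation_eq[abs_def])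
qed

lemma nn_integral_dilation:
  assumes [measurable]: "f \<in> borel_measurable borel" and s: "0 < s"
  shows "(\<integral>\<^sup>+y. f y \<partial>lborel) = ennreal (s ^ Q) * (\<integral>\<^sup>+y. f (dilation G s y) \<partial>lborel)"
  by (subst lborel_dilation[OF s]) (simp add: nn_integral_density nn_integral_distr nn_integral_cmult)

lemma integral_dilation:
  fixes f :: "'a \<Rightarrow> real"
  assumes [measurable]: "f \<in> borel_measurable borel" and s: "0 < s"
  shows "(\<integral>y. f y \<partial>lborel) = s ^ Q * (\<integral>y. f (dilation G s y) \<partial>lborel)"
  using s by (subst lborel_dilation[OF s]) (simp add: integral_density integral_distr)

end

section \<open>Calculus along left-invariant fields\<close>

lemma real_polynomial_has_derivative:
  fixes q :: "'z::euclidean_space \<Rightarrow> real"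
  assumes "real_polynomial_function q"
  shows "\<exists>q'. (\<forall>z. (q has_derivative q' z) (at z)) \<and> real_polynomial_function (\<lambda>zv. q' (fst zv) (snd zv))"
  using assms
proof (induction q rule: real_polynomial_function.induct)
  case (linear f)
  then have "real_polynomial_function (\<lambda>zv :: 'z \<times> 'z. f (snd zv))"
    by (intro real_polynomial_function.intros(1) bounded_linear_compose[OF linear bounded_linear_snd])
  then show ?case
    using bounded_linear_imp_has_derivative[OF linear] by (intro exI[of _ "\<lambda>z. f"]) auto
next
  case (const c)
  show ?case by (rule exI[of _ "\<lambda>_ _. 0"]) auto
next
  case (add f g)
  then obtain f' g' where
    f': "\<And>z. (f has_derivative f' z) (at z)" "real_polynomial_function (\<lambda>zv. f' (fst zv) (snd zv))" and
    g': "\<And>z. (g has_derivative g' z) (at z)" "real_polynomial_function (\<lambda>zv. g' (fst zv) (snd zv))"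
    by metis
  show ?case
    by (rule exI[of _ "\<lambda>z v. f' z v + g' z v"]) (auto intro: has_derivative_add f' g')
next
  case (mult f g)
  then obtain f' g' where
    f': "\<And>z. (f has_derivative f' z) (at z)" "real_polynomial_function (\<lambda>zv. f' (fst zv) (snd zv))" and
    g': "\<And>z. (g has_derivative g' z) (at z)" "real_polynomial_function (\<lambda>zv. g' (fst zv) (snd zv))"
    by metis
  have fst: "real_polynomial_function (\<lambda>zv :: 'z \<times> 'z. h (fst zv))" if "real_polynomial_function h" for h
    using real_polynomial_function_compose[OF polynomial_function_bounded_linear[OF bounded_linear_fst] that]
    by (simp add: o_def)
  show ?case
    by (rule exI[of _ "\<lambda>z v. f z * g' z v + f' z v * g z"])
      (auto intro!: has_derivative_mult f' g' fst mult.hyps)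
qed

lemma polynomial_has_derivative:
  fixes p :: "'z::euclidean_space \<Rightarrow> 'w::euclidean_space"
  assumes "polynomial_function p"
  shows "\<exists>p'. (\<forall>z. (p has_derivative p' z) (at z)) \<and> polynomial_function (\<lambda>zv. p' (fst zv) (snd zv))"
proof -
  have "\<exists>q'. (\<forall>z. ((\<lambda>z. p z \<bullet> b) has_derivative q' z) (at z)) \<and> real_polynomial_function (\<lambda>zv. q' (fst zv) (snd zv))" for b
    by (rule real_polynomial_has_derivative) (use assms in auto)
  then obtain q' where q': "\<And>b z. ((\<lambda>z. p z \<bullet> b) has_derivative q' b z) (at z)"
    "\<And>b. real_polynomial_function (\<lambda>zv. q' b (fst zv) (snd zv))" by metis
  have "((\<lambda>z. \<Sum>b\<in>Basis. (p z \<bullet> b) *\<^sub>R b) has_derivative (\<lambda>v. \<Sum>b\<in>Basis. q' b z v *\<^sub>R b)) (at z)" for z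
    by (intro has_derivative_sum has_derivative_scaleR_left q')
  then have "(p has_derivative (\<lambda>v. \<Sum>b\<in>Basis. q' b z v *\<^sub>R b)) (at z)" for z
    by (simp add: euclidean_representation)
  moreover have "polynomial_function (\<lambda>zv. \<Sum>b\<in>Basis. q' b (fst zv) (snd zv) *\<^sub>R b)"
    by (intro polynomial_function_sum polynomial_function_mult polynomial_function_const finite_Basis)
      (use q'(2) in \<open>simp add: real_polynomial_function_eq\<close>)
  ultimately show ?thesis by (intro exI[of _ "\<lambda>z v. \<Sum>b\<in>Basis. q' b z v *\<^sub>R b"]) simp
qed

lemma polynomial_function_compose2:
  "polynomial_function f \<Longrightarrow> polynomial_function g \<Longrightarrow> polynomial_function (\<lambda>z. g (f z))"
  using polynomial_function_compose[of f g] by (simp add: o_def)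

lemma polynomial_function_Pair:
  fixes f :: "'z::euclidean_space \<Rightarrow> 'u::euclidean_space" and g :: "'z \<Rightarrow> 'w::euclidean_space"
  assumes "polynomial_function f" "polynomial_function g"
  shows "polynomial_function (\<lambda>z. (f z, g z))"
proof -
  have "polynomial_function (\<lambda>z. (f z, 0) + (0, g z))"
    by (intro polynomial_function_add polynomial_function_compose2[OF assms(1), of "\<lambda>u. (u, 0)"]
        polynomial_function_compose2[OF assms(2), of "\<lambda>u. (0, u)"] polynomial_function_bounded_linear
        bounded_linear_Pair bounded_linear_ident bounded_linear_zero)
  then show ?thesis by simp
qed

section \<open>Compactly supported functions and differentiation under the integral sign\<close>

definition csupp :: "('a::euclidean_space \<Rightarrow> real) \<Rightarrow> bool" where
  "csupp v \<longleftrightarrow> continuous_on UNIV v \<and> (\<exists>R. \<forall>y. R < norm y \<longrightarrow> v y = 0)"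

lemma integral_bounded_support:
  fixes g :: "'a::euclidean_space \<Rightarrow> real"
  assumes g: "continuous_on UNIV g" "\<And>y. R < norm y \<Longrightarrow> g y = 0"
  shows "integrable lborel g" "(\<integral>y. g y \<partial>lborel) = integral (cbox (- (R *\<^sub>R One)) (R *\<^sub>R One)) g"
proof -
  let ?C = "cbox (- (R *\<^sub>R One)) (R *\<^sub>R One) :: 'a set"
  have "y \<in> ?C" if "norm y \<le> R" for y
    using order_trans[OF Basis_le_norm that] by (auto simp: mem_box abs_le_iff minus_le_iff)
  then have ind: "indicator ?C y *\<^sub>R g y = g y" for y
    using g(2)[of y] by (cases "norm y \<le> R") auto
  have int: "set_integrable lborel ?C g"
    unfolding set_integrable_def
    by (rule borel_integrable_compact) (use g(1) continuous_on_subset in auto)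
  then show "integrable lborel g" by (simp only: set_integrable_def ind)
  show "(\<integral>y. g y \<partial>lborel) = integral ?C g"
    using set_borel_integral_eq_integral(2)[OF int] by (simp only: set_lebesgue_integral_def ind)
qed

lemma csupp_integrable: "csupp v \<Longrightarrow> integrable lborel v"
  unfolding csupp_def using integral_bounded_support(1) by blast

lemma csupp_cont: "csupp v \<Longrightarrow> continuous_on A v"
  unfolding csupp_def using continuous_on_subset by blast

lemma csupp_mult: "csupp v \<Longrightarrow> continuous_on UNIV h \<Longrightarrow> csupp (\<lambda>y. v y * h y)" "csupp v \<Longrightarrow> continuous_on UNIV h \<Longrightarrow> csupp (\<lambda>y. h y * v y)"
  unfolding csupp_def by (auto intro!: continuous_intros)

lemma continuous_on_cball_bounded:
  fixes f :: "'b::euclidean_space \<Rightarrow> 'c::real_normed_vector"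
  assumes "continuous_on (cball 0 R) f"
  obtains B where "0 < B" "\<And>y. norm y \<le> R \<Longrightarrow> norm (f y) \<le> B"
proof -
  have "bounded (f ` cball 0 R)"
    by (intro compact_imp_bounded compact_continuous_image assms compact_cball)
  then show thesis using that by (auto simp: bounded_pos)
qed

lemma csupp_bounded: assumes "csupp v" obtains C where "0 < C" "\<And>y. \<bar>v y\<bar> \<le> C"
proof -
  obtain R where R: "\<And>y. R < norm y \<Longrightarrow> v y = 0" using assms by (auto simp: csupp_def)
  obtain B where B: "0 < B" "\<And>y. norm y \<le> R \<Longrightarrow> \<bar>v y\<bar> \<le> B"
    using continuous_on_cball_bounded[OF csupp_cont[OF assms]] unfolding real_norm_def by blast
  then have "\<bar>v y\<bar> \<le> B" for y using R[of y] by (cases "norm y \<le> R") auto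
  with B(1) show ?thesis using that by blast
qed

text \<open>Both integrands vanish outside one box for all parameters, so the Leibniz rule for
  compact boxes applies.\<close>

lemma integral_param_deriv:
  fixes f f' :: "real \<Rightarrow> 'a::euclidean_space \<Rightarrow> real"
  assumes der: "\<And>t y. ((\<lambda>t. f t y) has_real_derivative f' t y) (at t)"
    and cont: "\<And>t. continuous_on UNIV (f t)" "continuous_on UNIV (\<lambda>(t, y). f' t y)"
    and supp: "\<And>t y. R < norm y \<Longrightarrow> f t y = 0" "\<And>t y. R < norm y \<Longrightarrow> f' t y = 0"
  shows "((\<lambda>t. \<integral>y. f t y \<partial>lborel) has_real_derivative (\<integral>y. f' t y \<partial>lborel)) (at t)"
    and "isCont (\<lambda>t. \<integral>y. f' t y \<partial>lborel) t"
proof -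
  let ?C = "cbox (- (R *\<^sub>R One)) (R *\<^sub>R One) :: 'a set"
  have cont': "continuous_on UNIV (f' t)" for t
  proof -
    have "continuous_on UNIV (\<lambda>y. case (t, y) of (t, y) \<Rightarrow> f' t y)"
      by (rule continuous_on_compose2[OF cont(2)]) (auto intro!: continuous_intros)
    then show ?thesis by simp
  qed
  have eq: "(\<integral>y. f t y \<partial>lborel) = integral ?C (f t)" "(\<integral>y. f' t y \<partial>lborel) = integral ?C (f' t)" for t
    using integral_bounded_support(2)[OF cont(1) supp(1)] integral_bounded_support(2)[OF cont' supp(2)] by auto
  show "((\<lambda>t. \<integral>y. f t y \<partial>lborel) has_real_derivative (\<integral>y. f' t y \<partial>lborel)) (at t)"
    unfolding eq
  proof (rule leibniz_rule_field_derivative[where U = UNIV, simplified])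
    show "f t integrable_on ?C" for t
      by (rule integrable_continuous) (use cont(1) continuous_on_subset in blast)
    show "continuous_on (UNIV \<times> ?C) (\<lambda>(t, y). f' t y)"
      using cont(2) continuous_on_subset by blast
  qed (use der in auto)
  have "continuous_on {t - 1..t + 1} (\<lambda>t. integral ?C (f' t))"
    by (rule integral_continuous_on_param) (use cont(2) continuous_on_subset in blast)
  then show "isCont (\<lambda>t. \<integral>y. f' t y \<partial>lborel) t"
    unfolding eq by (rule continuous_on_interior) simp
qed

section \<open>Left-invariant fields: integration by parts and commutators\<close>

context carnot_group
begin

definition dmult :: "'a \<Rightarrow> 'a \<Rightarrow> 'a \<Rightarrow> 'a" where
  "dmult x y = frechet_derivative (mult G x) (at y)"

text \<open>\<open>dmult x y v\<close> is the derivative of the product, a polynomial in both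
  factors, in the direction \<open>(0, v)\<close>. It is therefore polynomial in \<open>x\<close>,
  \<open>y\<close> and \<open>v\<close> jointly.\<close>

lemma dmult_joint: "\<exists>M'. (\<forall>x y v. (mult G x has_derivative dmult x y) (at y) \<and> dmult x y v = M' ((x, y), (0 :: 'a, v))) \<and> polynomial_function M'"
proof -
  have "polynomial_function (\<lambda>z. mult G (fst z) (snd z))"
    by (intro polynomial_function_mult_group polynomial_function_bounded_linear bounded_linear_fst bounded_linear_snd)
  from polynomial_has_derivative[OF this] obtain M' where
    M': "\<And>z. ((\<lambda>z. mult G (fst z) (snd z)) has_derivative M' z) (at z)" "polynomial_function (\<lambda>zv. M' (fst zv) (snd zv))"
    by blast
  have d: "(mult G x has_derivative (\<lambda>v. M' (x, y) (0, v))) (at y)" for x y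
  proof -
    have "((\<lambda>y. (x, y)) has_derivative (\<lambda>v. (0, v))) (at y)"
      by (intro derivative_intros)
    from has_derivative_compose[OF this M'(1)] show ?thesis by simp
  qed
  have "dmult x y = (\<lambda>v. M' (x, y) (0, v))" for x y
    unfolding dmult_def by (rule frechet_derivative_at[OF d, symmetric])
  then have "(mult G x has_derivative dmult x y) (at y) \<and> dmult x y v = M' (fst ((x, y), (0, v))) (snd ((x, y), (0 :: 'a, v)))" for x y v
    using d by simp
  then show ?thesis using M'(2) by (intro exI[of _ "\<lambda>zv. M' (fst zv) (snd zv)"]) blast
qed

lemma has_derivative_dmult: "(mult G x has_derivative dmult x y) (at y)"
  using dmult_joint by blast

lemma polynomial_function_dmult:
  fixes f g h :: "'z::euclidean_space \<Rightarrow> 'a"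
  assumes "polynomial_function f" "polynomial_function g" "polynomial_function h"
  shows "polynomial_function (\<lambda>z. dmult (f z) (g z) (h z))"
proof -
  obtain M' where M': "\<And>x y v. dmult x y v = M' ((x, y), (0 :: 'a, v))" "polynomial_function M'"
    using dmult_joint by blast
  have "polynomial_function (\<lambda>z. ((f z, g z), (0 :: 'a, h z)))"
    by (intro polynomial_function_Pair assms polynomial_function_const)
  from polynomial_function_compose2[OF this M'(2)] show ?thesis unfolding M'(1) .
qed

lemma linear_dmult: "linear (dmult x y)"
  using has_derivative_dmult by (rule has_derivative_linear)

lemma left_inv_field_eq: "left_inv_field G b y = dmult y 0 b"
  by (simp add: left_inv_field_def dmult_def)

text \<open>Left translation by \<open>y\<close> after left translation by \<open>- y\<close> is the
  identity; differentiate at \<open>y\<close>. A vector \<open>v\<close> at \<open>y\<close> thus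
  has coefficients \<open>dmult (- y) y v\<close> in the left-invariant frame, and these are
  polynomial.\<close>

lemma dmult_inverse: "dmult y 0 (dmult (- y) y v) = v"
proof -
  have "((\<lambda>z. mult G y (mult G (- y) z)) has_derivative (\<lambda>v. dmult y (mult G (- y) y) (dmult (- y) y v))) (at y)"
    by (rule has_derivative_compose[OF has_derivative_dmult has_derivative_dmult])
  then have "((\<lambda>z. z) has_derivative (\<lambda>v. dmult y 0 (dmult (- y) y v))) (at y)"
    by simp
  then have "(\<lambda>v. dmult y 0 (dmult (- y) y v)) = (\<lambda>v. v)"
    by (rule has_derivative_unique[OF _ has_derivative_ident])
  then show ?thesis by meson
qed

text \<open>The flow of the left-invariant field of \<open>b\<close> is right translation by
  \<open>t b\<close>. Defining the derivative along this flow ties it directly to the right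
  invariance of the measure.\<close>

definition hasX :: "'a \<Rightarrow> ('a \<Rightarrow> real) \<Rightarrow> ('a \<Rightarrow> real) \<Rightarrow> bool" where
  "hasX b v v' \<longleftrightarrow> (\<forall>y. ((\<lambda>t. v (mult G y (t *\<^sub>R b))) has_real_derivative v' y) (at 0))"

lemma hasX_at:
  assumes "hasX b v v'"
  shows "((\<lambda>t. v (mult G y (t *\<^sub>R b))) has_real_derivative v' (mult G y (t *\<^sub>R b))) (at t)"
proof -
  have "((\<lambda>h. v (mult G (mult G y (t *\<^sub>R b)) (h *\<^sub>R b))) has_real_derivative v' (mult G y (t *\<^sub>R b))) (at 0)"
    using assms by (simp add: hasX_def)
  then have "((\<lambda>h. v (mult G y ((h + t) *\<^sub>R b))) has_real_derivative v' (mult G y (t *\<^sub>R b))) (at 0)"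
    by (simp add: mult_assoc mult_scaleR_add add.commute)
  then show ?thesis using DERIV_shift[of "\<lambda>h. v (mult G y (h *\<^sub>R b))" _ 0 t] by simp
qed

lemma has_derivative_imp_hasX:
  assumes "\<And>y. (v has_derivative D y) (at y)"
  shows "hasX b v (\<lambda>y. D y (left_inv_field G b y))"
  unfolding hasX_def left_inv_field_eq
proof
  fix y
  have "((\<lambda>t. mult G y (t *\<^sub>R b)) has_derivative (\<lambda>h. dmult y (0 *\<^sub>R b) (h *\<^sub>R b))) (at 0)"
    by (rule has_derivative_compose[OF _ has_derivative_dmult])
      (rule bounded_linear_imp_has_derivative[OF bounded_linear_scaleR_left])
  then have "((\<lambda>t. v (mult G y (t *\<^sub>R b))) has_derivative (\<lambda>h. D (mult G y (0 *\<^sub>R b)) (dmult y (0 *\<^sub>R b) (h *\<^sub>R b)))) (at 0)"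
    by (rule has_derivative_compose[OF _ assms])
  moreover have "D y (dmult y 0 (h *\<^sub>R b)) = h * D y (dmult y 0 b)" for h
    using linear_scale[OF linear_dmult] linear_scale[OF has_derivative_linear[OF assms]] by simp
  ultimately show "((\<lambda>t. v (mult G y (t *\<^sub>R b))) has_real_derivative D y (dmult y 0 b)) (at 0)"
    by (simp add: has_field_derivative_def mult_commute_abs)
qed

text \<open>The derivative is a family over all directions \<open>b\<close>, linear in
  \<open>b\<close>, so that commutators and combinations of fields can be handled with first
  derivatives alone.\<close>

definition lie_C1 :: "('a \<Rightarrow> real) \<Rightarrow> ('a \<Rightarrow> 'a \<Rightarrow> real) \<Rightarrow> bool" where
  "lie_C1 v v' \<longleftrightarrow> csupp v \<and> (\<forall>b. hasX b v (v' b) \<and> csupp (v' b)) \<and> (\<forall>y. linear (\<lambda>b. v' b y))"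

lemma csupp_right_translation: "csupp v \<Longrightarrow> csupp (\<lambda>y. v (mult G y x))"
proof -
  assume v: "csupp v"
  then obtain R where R: "\<And>y. R < norm y \<Longrightarrow> v y = 0" by (auto simp: csupp_def)
  have "continuous_on (cball 0 R) (\<lambda>z. mult G z (- x))" by (intro continuous_intros)
  then obtain R' where R': "\<And>z. norm z \<le> R \<Longrightarrow> norm (mult G z (- x)) \<le> R'"
    using continuous_on_cball_bounded by blast
  have "v (mult G y x) = 0" if "R' < norm y" for y
    using R'[of "mult G y x"] R[of "mult G y x"] that by (cases "norm (mult G y x) \<le> R") auto
  moreover have "continuous_on UNIV (\<lambda>y. v (mult G y x))"
    by (rule continuous_on_compose2[OF csupp_cont[OF v, of UNIV]]) (auto intro!: continuous_intros)
  ultimately show ?thesis by (auto simp: csupp_def)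
qed

lemma translate_deriv:
  assumes X: "hasX c v v'" and v: "continuous_on UNIV v" "continuous_on UNIV v'" and h: "csupp h"
  shows "((\<lambda>t. \<integral>y. v (mult G y (t *\<^sub>R c)) * h y \<partial>lborel) has_real_derivative (\<integral>y. v' y * h y \<partial>lborel)) (at 0)"
proof -
  obtain R where R: "\<And>y. R < norm y \<Longrightarrow> h y = 0" using h by (auto simp: csupp_def)
  have "((\<lambda>t. \<integral>y. v (mult G y (t *\<^sub>R c)) * h y \<partial>lborel) has_real_derivative (\<integral>y. v' (mult G y (0 *\<^sub>R c)) * h y \<partial>lborel)) (at 0)"
  proof (rule integral_param_deriv(1)[where R = R and f' = "\<lambda>t y. v' (mult G y (t *\<^sub>R c)) * h y"])
    show "((\<lambda>t. v (mult G y (t *\<^sub>R c)) * h y) has_real_derivative v' (mult G y (t *\<^sub>R c)) * h y) (at t)" for t y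
      by (rule DERIV_cmult_right[OF hasX_at[OF X]])
    show "continuous_on UNIV (\<lambda>y. v (mult G y (t *\<^sub>R c)) * h y)" for t
      by (intro continuous_on_mult csupp_cont[OF h] continuous_on_compose2[OF v(1)] continuous_intros) auto
    show "continuous_on UNIV (\<lambda>(t, y). v' (mult G y (t *\<^sub>R c)) * h y)"
      unfolding case_prod_unfold
      by (intro continuous_on_mult continuous_on_compose2[OF v(2)] continuous_on_compose2[OF csupp_cont[OF h, of UNIV]] continuous_intros) auto
  qed (use R in auto)
  then show ?thesis by simp
qed

lemma lie_C1D: assumes "lie_C1 v v'" shows "csupp v" "hasX b v (v' b)" "csupp (v' b)" "linear (\<lambda>b. v' b y)"
  using assms by (auto simp: lie_C1_def)

text \<open>Right invariance moves the translation by \<open>t c\<close> from \<open>v\<close> to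
  \<open>\<psi>\<close>, where it becomes the translation by \<open>- t c\<close>. The claim is the
  derivative at \<open>t = 0\<close>.\<close>

lemma integration_by_parts:
  assumes v: "lie_C1 v v'" and \<psi>: "lie_C1 \<psi> \<psi>'"
  shows "(\<integral>y. v' c y * \<psi> y \<partial>lborel) = - (\<integral>y. v y * \<psi>' c y \<partial>lborel)"
proof -
  let ?I = "\<lambda>t. \<integral>y. v (mult G y (t *\<^sub>R c)) * \<psi> y \<partial>lborel"
  let ?J = "\<lambda>t. \<integral>y. \<psi> (mult G y (t *\<^sub>R c)) * v y \<partial>lborel"
  note [measurable] = borel_measurable_continuous_onI[OF csupp_cont[OF lie_C1D(1)[OF v]]]
    borel_measurable_continuous_onI[OF csupp_cont[OF lie_C1D(1)[OF \<psi>]]]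
  have IJ: "?I t = ?J (- t)" for t
    using integral_right_translation[of "\<lambda>y. \<psi> (mult G y (- t *\<^sub>R c)) * v y" "t *\<^sub>R c"]
    by (simp add: mult.commute)
  have I: "(?I has_real_derivative (\<integral>y. v' c y * \<psi> y \<partial>lborel)) (at 0)"
    by (rule translate_deriv[OF lie_C1D(2)[OF v] csupp_cont[OF lie_C1D(1)[OF v]] csupp_cont[OF lie_C1D(3)[OF v]] lie_C1D(1)[OF \<psi>]])
  have J: "(?J has_real_derivative (\<integral>y. \<psi>' c y * v y \<partial>lborel)) (at 0)"
    by (rule translate_deriv[OF lie_C1D(2)[OF \<psi>] csupp_cont[OF lie_C1D(1)[OF \<psi>]] csupp_cont[OF lie_C1D(3)[OF \<psi>]] lie_C1D(1)[OF v]])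
  have "((\<lambda>t. ?J (- t)) has_real_derivative - (\<integral>y. \<psi>' c y * v y \<partial>lborel)) (at 0)"
    using J DERIV_mirror[of ?J _ 0] by simp
  with I show ?thesis unfolding IJ by (auto dest: DERIV_unique simp: mult.commute)
qed

lemma endo_ap_exp_ad: "endo_ap (exp_ad x) (v, 0) = (ead x v, 0)"
  unfolding exp_ad_def nexp_def ead_def by (simp add: endo_ap_sum endo_ap_scaleR endo_ap_ad_ext_power sum_prod)

lemma ead_deriv: "((\<lambda>t. ead (t *\<^sub>R x) v) has_vector_derivative br x v) (at 0)"
proof -
  have "((\<lambda>t. endo_ap (exp_ad (t *\<^sub>R x)) (v, 0)) has_vector_derivative endo_ap (ad_ext x * exp_ad (0 *\<^sub>R x)) (v, 0)) (at 0)"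
    by (rule bounded_linear.has_vector_derivative[OF bounded_bilinear.bounded_linear_left[OF bounded_bilinear_endo_ap] exp_ad_scaleR_deriv])
  from bounded_linear.has_vector_derivative[OF bounded_linear_fst this]
  show ?thesis by (simp add: endo_ap_exp_ad)
qed

lemma ead_scaleR: "ead x (s *\<^sub>R v) = s *\<^sub>R ead x v"
  using endo_ap_exp_ad[of x "s *\<^sub>R v"] linear_scale[OF linear_endo_ap, of "exp_ad x" s "(v, 0)"] by (simp add: endo_ap_exp_ad)

text \<open>
  Only first derivatives are needed: conjugation by \<open>t c\<close> turns \<open>s b\<close> into \<open>s ead (t c) b\<close>, and
  the identity is the \<open>s\<close>- and \<open>t\<close>-derivative at \<open>0\<close> of an equality of translated integrals.
\<close>

lemma weak_commutator:
  assumes v: "lie_C1 v v'" and \<psi>: "lie_C1 \<psi> \<psi>'"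
  shows "(\<integral>y. v y * \<psi>' (br b c) y \<partial>lborel) = (\<integral>y. v' c y * \<psi>' b y \<partial>lborel) - (\<integral>y. v' b y * \<psi>' c y \<partial>lborel)"
proof -
  note cont = csupp_cont[OF lie_C1D(1)[OF v]] csupp_cont[OF lie_C1D(3)[OF v]] csupp_cont[OF lie_C1D(1)[OF \<psi>]] csupp_cont[OF lie_C1D(3)[OF \<psi>]]
  note [measurable] = borel_measurable_continuous_onI[OF cont(1)] borel_measurable_continuous_onI[OF cont(3)]
  \<comment> \<open>The direction \<open>b\<close> conjugated by \<open>- t c\<close>; its
    derivative at \<open>t = 0\<close> is \<open>br (- c) b = br b c\<close>.\<close>
  define bt where "bt = (\<lambda>t. ead (t *\<^sub>R - c) b)"
  \<comment> \<open>Right invariance, used twice: with the translation by \<open>- t c\<close>, and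
    with the conjugated translation by \<open>- s (bt t)\<close>.\<close>
  have id: "(\<integral>y. \<psi> (mult G y (s *\<^sub>R b)) * v (mult G y (t *\<^sub>R c)) \<partial>lborel) =
      (\<integral>y. v (mult G y (- s *\<^sub>R bt t)) * \<psi> (mult G y (t *\<^sub>R - c)) \<partial>lborel)" for s t
  proof -
    have w: "mult G (s *\<^sub>R bt t) (- (t *\<^sub>R c)) = mult G (- (t *\<^sub>R c)) (s *\<^sub>R b)"
    proof -
      have "s *\<^sub>R bt t = ead (- (t *\<^sub>R c)) (s *\<^sub>R b)" by (simp add: bt_def ead_scaleR)
      also have "\<dots> = mult G (mult G (- (t *\<^sub>R c)) (s *\<^sub>R b)) (- (- (t *\<^sub>R c)))"
        by (rule mult_conj[symmetric])
      finally show ?thesis by (simp only: mult_minus_cancel(4))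
    qed
    have "(\<integral>y. \<psi> (mult G y (s *\<^sub>R b)) * v (mult G y (t *\<^sub>R c)) \<partial>lborel) =
       (\<integral>y. \<psi> (mult G (mult G y (- (t *\<^sub>R c))) (s *\<^sub>R b)) * v (mult G (mult G y (- (t *\<^sub>R c))) (t *\<^sub>R c)) \<partial>lborel)"
      by (rule integral_right_translation[symmetric]) simp
    also have "\<dots> = (\<integral>y. \<psi> (mult G (mult G y (s *\<^sub>R bt t)) (- (t *\<^sub>R c))) * v y \<partial>lborel)"
      by (simp add: mult_assoc w del: mult_minus_cancel)
    also have "\<dots> = (\<integral>y. \<psi> (mult G (mult G (mult G y (- (s *\<^sub>R bt t))) (s *\<^sub>R bt t)) (- (t *\<^sub>R c))) * v (mult G y (- (s *\<^sub>R bt t))) \<partial>lborel)"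
      by (rule integral_right_translation[symmetric]) simp
    finally show ?thesis by (simp add: mult.commute)
  qed
  \<comment> \<open>The derivative at \<open>s = 0\<close>. The moving direction \<open>bt t\<close>
    is expanded in the basis, which turns the later derivative in \<open>t\<close> into a product
    rule for scalar functions.\<close>
  have bt: "(\<integral>y. \<psi>' b y * v (mult G y (t *\<^sub>R c)) \<partial>lborel) = - (\<Sum>e\<in>Basis. (bt t \<bullet> e) * (\<integral>y. \<psi> (mult G y (t *\<^sub>R - c)) * v' e y \<partial>lborel))" for t
  proof -
    have 1: "((\<lambda>s. \<integral>y. \<psi> (mult G y (s *\<^sub>R b)) * v (mult G y (t *\<^sub>R c)) \<partial>lborel) has_real_derivative
        (\<integral>y. \<psi>' b y * v (mult G y (t *\<^sub>R c)) \<partial>lborel)) (at 0)"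
      by (rule translate_deriv[OF lie_C1D(2)[OF \<psi>] cont(3,4) csupp_right_translation[OF lie_C1D(1)[OF v]]])
    let ?J = "\<lambda>s. \<integral>y. v (mult G y (s *\<^sub>R bt t)) * \<psi> (mult G y (t *\<^sub>R - c)) \<partial>lborel"
    have "(?J has_real_derivative (\<integral>y. v' (bt t) y * \<psi> (mult G y (t *\<^sub>R - c)) \<partial>lborel)) (at 0)"
      by (rule translate_deriv[OF lie_C1D(2)[OF v] cont(1,2) csupp_right_translation[OF lie_C1D(1)[OF \<psi>]]])
    then have "((\<lambda>s. ?J (- s)) has_real_derivative - (\<integral>y. v' (bt t) y * \<psi> (mult G y (t *\<^sub>R - c)) \<partial>lborel)) (at 0)"
      using DERIV_mirror[of ?J _ 0] by simp
    with 1 have "(\<integral>y. \<psi>' b y * v (mult G y (t *\<^sub>R c)) \<partial>lborel) = - (\<integral>y. v' (bt t) y * \<psi> (mult G y (t *\<^sub>R - c)) \<partial>lborel)"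
      unfolding id by (auto dest: DERIV_unique)
    also have "(\<integral>y. v' (bt t) y * \<psi> (mult G y (t *\<^sub>R - c)) \<partial>lborel) =
       (\<integral>y. (\<Sum>e\<in>Basis. (bt t \<bullet> e) * (\<psi> (mult G y (t *\<^sub>R - c)) * v' e y)) \<partial>lborel)"
    proof (rule Bochner_Integration.integral_cong[OF refl])
      fix y
      have "v' (\<Sum>e\<in>Basis. (bt t \<bullet> e) *\<^sub>R e) y = (\<Sum>e\<in>Basis. (bt t \<bullet> e) * v' e y)"
        using linear_sum[OF lie_C1D(4)[OF v, of y], of "\<lambda>e. (bt t \<bullet> e) *\<^sub>R e" Basis] linear_scale[OF lie_C1D(4)[OF v, of y]]
        by simp
      then show "v' (bt t) y * \<psi> (mult G y (t *\<^sub>R - c)) = (\<Sum>e\<in>Basis. (bt t \<bullet> e) * (\<psi> (mult G y (t *\<^sub>R - c)) * v' e y))"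
        by (simp add: euclidean_representation sum_distrib_left sum_distrib_right algebra_simps)
    qed
    also have "\<dots> = (\<Sum>e\<in>Basis. (bt t \<bullet> e) * (\<integral>y. \<psi> (mult G y (t *\<^sub>R - c)) * v' e y \<partial>lborel))"
      by (subst Bochner_Integration.integral_sum)
        (auto intro!: integrable_mult_right csupp_integrable csupp_mult(1) csupp_right_translation lie_C1D(1)[OF \<psi>] cont)
    finally show ?thesis .
  qed
  have L: "((\<lambda>t. \<integral>y. \<psi>' b y * v (mult G y (t *\<^sub>R c)) \<partial>lborel) has_real_derivative (\<integral>y. v' c y * \<psi>' b y \<partial>lborel)) (at 0)"
    using translate_deriv[OF lie_C1D(2)[OF v] cont(1,2) lie_C1D(3)[OF \<psi>], of c b] by (simp add: mult.commute)
  have e: "((\<lambda>t. \<integral>y. \<psi> (mult G y (t *\<^sub>R - c)) * v' e y \<partial>lborel) has_real_derivative (\<integral>y. \<psi>' (- c) y * v' e y \<partial>lborel)) (at 0)" for e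
    by (rule translate_deriv[OF lie_C1D(2)[OF \<psi>] cont(3,4) lie_C1D(3)[OF v]])
  have bte: "((\<lambda>t. bt t \<bullet> e) has_real_derivative br (- c) b \<bullet> e) (at 0)" for e
    unfolding bt_def has_real_derivative_iff_has_vector_derivative
    by (rule bounded_linear.has_vector_derivative[OF bounded_linear_inner_left ead_deriv])
  have bt0: "bt 0 = b" unfolding bt_def using endo_ap_exp_ad[of 0 b] by simp
  have "((\<lambda>t. - (\<Sum>e\<in>Basis. (bt t \<bullet> e) * (\<integral>y. \<psi> (mult G y (t *\<^sub>R - c)) * v' e y \<partial>lborel))) has_real_derivative
    - (\<Sum>e\<in>Basis. (br (- c) b \<bullet> e) * (\<integral>y. \<psi> (mult G y (0 *\<^sub>R - c)) * v' e y \<partial>lborel) + (\<integral>y. \<psi>' (- c) y * v' e y \<partial>lborel) * (bt 0 \<bullet> e))) (at 0)"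
    by (intro DERIV_minus DERIV_sum DERIV_mult bte e)
  with L have "(\<integral>y. v' c y * \<psi>' b y \<partial>lborel) =
    - (\<Sum>e\<in>Basis. (br (- c) b \<bullet> e) * (\<integral>y. \<psi> y * v' e y \<partial>lborel) + (\<integral>y. \<psi>' (- c) y * v' e y \<partial>lborel) * (b \<bullet> e))"
    unfolding bt bt0 by (auto dest: DERIV_unique)
  moreover have comb: "(\<Sum>e\<in>Basis. (u \<bullet> e) * (\<integral>y. h y * v' e y \<partial>lborel)) = (\<integral>y. h y * v' u y \<partial>lborel)" if h: "continuous_on UNIV h" for h u
  proof -
    have "(\<Sum>e\<in>Basis. (u \<bullet> e) * (\<integral>y. h y * v' e y \<partial>lborel)) = (\<integral>y. (\<Sum>e\<in>Basis. (u \<bullet> e) * (h y * v' e y)) \<partial>lborel)"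
      by (subst Bochner_Integration.integral_sum)
        (auto intro!: integrable_mult_right csupp_integrable csupp_mult(2) lie_C1D(3)[OF v] h)
    also have "\<dots> = (\<integral>y. h y * v' u y \<partial>lborel)"
    proof (rule Bochner_Integration.integral_cong[OF refl])
      fix y
      have "v' (\<Sum>e\<in>Basis. (u \<bullet> e) *\<^sub>R e) y = (\<Sum>e\<in>Basis. (u \<bullet> e) * v' e y)"
        using linear_sum[OF lie_C1D(4)[OF v, of y], of "\<lambda>e. (u \<bullet> e) *\<^sub>R e" Basis] linear_scale[OF lie_C1D(4)[OF v, of y]]
        by simp
      then show "(\<Sum>e\<in>Basis. (u \<bullet> e) * (h y * v' e y)) = h y * v' u y"
        by (simp add: euclidean_representation sum_distrib_left algebra_simps)
    qed
    finally show ?thesis .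
  qed
  ultimately have "(\<integral>y. v' c y * \<psi>' b y \<partial>lborel) = - (\<integral>y. \<psi> y * v' (br (- c) b) y \<partial>lborel) - (\<integral>y. \<psi>' (- c) y * v' b y \<partial>lborel)"
    using comb[OF cont(3), of "br (- c) b"] comb[OF cont(4), of b "- c"]
    by (simp add: sum.distrib mult.commute[of _ "b \<bullet> _"])
  moreover have "br (- c) b = br b c" by (simp add: br_minus_left br_swap[of c b])
  moreover have "\<psi>' (- c) y = - \<psi>' c y" for y by (rule linear_neg[OF lie_C1D(4)[OF \<psi>]])
  ultimately show ?thesis
    using integration_by_parts[OF v \<psi>, of "br b c"] by (simp add: mult.commute)
qed

end

section \<open>Bump functions of finite smoothness\<close>

lemma DERIV_max_power:
  fixes u :: real
  assumes j: "2 \<le> j"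
  shows "((\<lambda>u. max 0 u ^ j) has_real_derivative real j * max 0 u ^ (j - 1)) (at u)"
proof (cases u "0 :: real" rule: linorder_cases)
  case less
  have "((\<lambda>u. 0) has_real_derivative 0) (at u)" by simp
  then have "((\<lambda>u. max 0 u ^ j) has_real_derivative 0) (at u)"
    by (rule has_field_derivative_transform_within_open[of _ _ _ "{..<0}"]) (use less j in auto)
  then show ?thesis using less j by (simp add: power_0_left)
next
  case greater
  have "((\<lambda>u. u ^ j) has_real_derivative real j * u ^ (j - 1)) (at u)"
    by (auto intro!: derivative_eq_intros)
  then have "((\<lambda>u. max 0 u ^ j) has_real_derivative real j * u ^ (j - 1)) (at u)"
    by (rule has_field_derivative_transform_within_open[of _ _ _ "{0<..}"]) (use greater in auto)
  then show ?thesis using greater by simp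
next
  case equal
  have "((\<lambda>h. max 0 h ^ j / h) \<longlongrightarrow> 0) (at (0::real))"
  proof (rule Lim_null_comparison)
    have "norm (max 0 h ^ j / h) \<le> \<bar>h\<bar> ^ (j - 1)" if "h \<noteq> 0" for h :: real
    proof -
      have "\<bar>h\<bar> ^ j = \<bar>h\<bar> ^ (j - 1) * \<bar>h\<bar>"
        using j power_Suc2[of "\<bar>h\<bar>" "j - 1"] by simp
      moreover have "max 0 h ^ j \<le> \<bar>h\<bar> ^ j" by (rule power_mono) auto
      ultimately show ?thesis using that by (simp add: field_simps)
    qed
    then show "\<forall>\<^sub>F h in at 0. norm (max 0 h ^ j / h) \<le> \<bar>h\<bar> ^ (j - 1)"
      by (auto simp: eventually_at_filter)
    have "((\<lambda>h. \<bar>h\<bar> ^ (j - 1)) \<longlongrightarrow> \<bar>0 :: real\<bar> ^ (j - 1)) (at 0)"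
      by (intro tendsto_intros)
    moreover have "\<bar>0 :: real\<bar> ^ (j - 1) = 0" using j by simp
    ultimately show "((\<lambda>h::real. \<bar>h\<bar> ^ (j - 1)) \<longlongrightarrow> 0) (at 0)" by (simp only:)
  qed
  then show ?thesis using equal j by (simp add: has_field_derivative_iff power_0_left)
qed

definition bump :: "'a::euclidean_space \<Rightarrow> real" where "bump y = max 0 (1 - y \<bullet> y)"

text \<open>Left-invariant fields have polynomial coefficients, so they send a polynomial times
  \<open>bump ^ j\<close> to a polynomial times \<open>bump ^ (j - 1)\<close>. The exponent counts
  the derivatives still available.\<close>

definition bump_poly :: "('a::euclidean_space \<Rightarrow> real) \<Rightarrow> nat \<Rightarrow> 'a \<Rightarrow> real" where
  "bump_poly q j y = q y * bump y ^ j"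

lemma bump_eq_0: "1 < norm y \<Longrightarrow> bump y = 0"
proof -
  assume "1 < norm y"
  then have "1 < norm y ^ 2" by simp
  then show ?thesis by (simp add: bump_def power2_norm_eq_inner)
qed

lemma bump_bounds: "0 \<le> bump y" "bump y \<le> 1"
  by (auto simp: bump_def)

lemma continuous_on_bump: "continuous_on A bump"
  unfolding bump_def by (intro continuous_intros)

lemma continuous_on_real_polynomial: "real_polynomial_function q \<Longrightarrow> continuous_on A q"
  using continuous_on_polymonial_function real_polynomial_function_eq by blast

lemma continuous_on_bump_poly: "real_polynomial_function q \<Longrightarrow> continuous_on A (bump_poly q j)"
  unfolding bump_poly_def by (intro continuous_intros continuous_on_bump continuous_on_real_polynomial)

lemma bump_poly_eq_0: "1 \<le> j \<Longrightarrow> 1 < norm y \<Longrightarrow> bump_poly q j y = 0"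
  by (simp add: bump_poly_def bump_eq_0)

context carnot_group
begin

lemma linear_left_inv_field: "linear (\<lambda>b. left_inv_field G b y)"
  unfolding left_inv_field_eq by (rule linear_dmult)

lemma polynomial_function_left_inv_field: "polynomial_function (left_inv_field G b)"
  unfolding left_inv_field_eq[abs_def] by (intro polynomial_function_dmult polynomial_function_const polynomial_function_id)

lemma lie_C1_bump_poly:
  assumes q: "real_polynomial_function q" and j: "2 \<le> j"
  shows "\<exists>q'. (\<forall>b. real_polynomial_function (q' b)) \<and> lie_C1 (bump_poly q j) (\<lambda>b. bump_poly (q' b) (j - 1))"
proof -
  obtain dq where dq: "\<And>z. (q has_derivative dq z) (at z)" "real_polynomial_function (\<lambda>zv. dq (fst zv) (snd zv))"
    using real_polynomial_has_derivative[OF q] by blast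
  let ?X = "left_inv_field G"
  \<comment> \<open>The product rule, with
    \<open>bump ^ j = (1 - y \<bullet> y) * bump ^ (j - 1)\<close> used to split off a common power
    of \<open>bump\<close>; outside the unit ball both sides of that identity are 0 because
    \<open>2 \<le> j\<close>.\<close>
  define q' where "q' = (\<lambda>b y. dq y (?X b y) * (1 - y \<bullet> y) - 2 * real j * q y * (y \<bullet> ?X b y))"
  define D where "D = (\<lambda>y v. q y * (real j * bump y ^ (j - 1) * (- 2 * (y \<bullet> v))) + dq y v * bump y ^ j)"
  have poly: "real_polynomial_function (q' b)" for b
  proof -
    have "real_polynomial_function (\<lambda>y. dq y (?X b y))"
      using real_polynomial_function_compose[OF polynomial_function_Pair[OF polynomial_function_id polynomial_function_left_inv_field] dq(2), of b]
      by (simp add: o_def)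
    moreover have "real_polynomial_function (\<lambda>y. y \<bullet> f y)" if "polynomial_function f" for f :: "'a \<Rightarrow> 'a"
    proof -
      have "real_polynomial_function (\<lambda>y. \<Sum>e\<in>Basis. (y \<bullet> e) * (f y \<bullet> e))"
        by (intro real_polynomial_function_sum finite_Basis real_polynomial_function.intros(4)
            polynomial_function_inner that polynomial_function_id)
      then show ?thesis by (simp flip: euclidean_inner)
    qed
    ultimately show ?thesis
      unfolding q'_def using q polynomial_function_left_inv_field
      by (intro real_polynomial_function_diff real_polynomial_function.intros(2,4)) auto
  qed
  have bumpD: "((\<lambda>y. bump y ^ j) has_derivative (\<lambda>v. real j * bump y ^ (j - 1) * (- 2 * (y \<bullet> v)))) (at y)" for y :: 'a
  proof -
    have "((\<lambda>y. 1 - y \<bullet> y) has_derivative (\<lambda>v. - 2 * (y \<bullet> v))) (at y)"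
      by (auto intro!: derivative_eq_intros simp: inner_commute)
    from has_derivative_compose[OF this DERIV_max_power[OF j, unfolded has_field_derivative_def]]
    show ?thesis by (simp add: bump_def)
  qed
  have der: "(bump_poly q j has_derivative D y) (at y)" for y
    unfolding bump_poly_def[abs_def] D_def by (rule has_derivative_mult[OF dq(1) bumpD])
  have eq: "D y (?X b y) = bump_poly (q' b) (j - 1) y" for b y
  proof -
    have "bump y ^ j = (1 - y \<bullet> y) * bump y ^ (j - 1)"
    proof (cases "bump y = 0")
      case True
      then show ?thesis using j by (simp add: power_0_left)
    next
      case False
      then have "bump y = 1 - y \<bullet> y" by (simp add: bump_def max_def split: if_splits)
      then show ?thesis using j power_Suc[of "bump y" "j - 1"] by simp
    qed
    then show ?thesis by (simp only: D_def bump_poly_def q'_def) (simp add: algebra_simps)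
  qed
  have "hasX b (bump_poly q j) (bump_poly (q' b) (j - 1))" for b
    using has_derivative_imp_hasX[OF der, of b] by (simp add: eq)
  moreover have "linear (\<lambda>b. bump_poly (q' b) (j - 1) y)" for y
    unfolding eq[symmetric]
    using linear_compose[OF linear_left_inv_field has_derivative_linear[OF der]] by (simp add: o_def)
  moreover have ccW: "csupp (bump_poly q i)" if "1 \<le> i" "real_polynomial_function q" for i q
    unfolding csupp_def using bump_poly_eq_0[OF that(1)] continuous_on_bump_poly[OF that(2)] by blast
  ultimately have "lie_C1 (bump_poly q j) (\<lambda>b. bump_poly (q' b) (j - 1))"
    unfolding lie_C1_def using ccW[OF _ q, of j] ccW[OF _ poly, of "j - 1"] j by simp
  with poly show ?thesis by blast
qed

section \<open>Functionals that involve horizontal derivatives only\<close>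

definition horizontal_rep_by :: "('a \<Rightarrow> 'a \<Rightarrow> real) \<Rightarrow> (('a \<Rightarrow> 'a \<Rightarrow> real) \<Rightarrow> real) \<Rightarrow> bool" where
  "horizontal_rep_by \<omega> T \<longleftrightarrow> (\<forall>b. continuous_on UNIV (\<omega> b) \<and> (\<forall>y. 1 < norm y \<longrightarrow> \<omega> b y = 0)) \<and>
     (\<forall>\<psi> \<psi>'. lie_C1 \<psi> \<psi>' \<longrightarrow> T \<psi>' = (\<Sum>b\<in>hbasis G. \<integral>y. \<omega> b y * \<psi>' b y \<partial>lborel))"

text \<open>One family of densities serves all \<open>\<psi>\<close>. Their continuity and their
  support in the unit ball are what the later bound of the kernel rests on.\<close>

definition horizontal_rep :: "(('a \<Rightarrow> 'a \<Rightarrow> real) \<Rightarrow> real) \<Rightarrow> bool" where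
  "horizontal_rep T \<longleftrightarrow> (\<exists>\<omega>. horizontal_rep_by \<omega> T)"

lemma horizontal_rep_byD:
  assumes "horizontal_rep_by \<omega> T"
  shows "continuous_on UNIV (\<omega> b)" "1 < norm y \<Longrightarrow> \<omega> b y = 0"
    "lie_C1 \<psi> \<psi>' \<Longrightarrow> T \<psi>' = (\<Sum>b\<in>hbasis G. \<integral>y. \<omega> b y * \<psi>' b y \<partial>lborel)"
  using assms unfolding horizontal_rep_by_def by blast+

lemma horizontal_rep_cong:
  assumes "horizontal_rep T" "\<And>\<psi> \<psi>'. lie_C1 \<psi> \<psi>' \<Longrightarrow> T \<psi>' = T' \<psi>'" shows "horizontal_rep T'"
proof -
  obtain \<omega> where "horizontal_rep_by \<omega> T" using assms(1) by (auto simp: horizontal_rep_def)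
  then have "horizontal_rep_by \<omega> T'" using assms(2) unfolding horizontal_rep_by_def by simp
  then show ?thesis by (auto simp: horizontal_rep_def)
qed

lemma horizontal_rep_0: "horizontal_rep (\<lambda>_. 0)"
  unfolding horizontal_rep_def horizontal_rep_by_def by (rule exI[of _ "\<lambda>_ _. 0"]) auto

lemma horizontal_rep_add:
  assumes "horizontal_rep T1" "horizontal_rep T2" shows "horizontal_rep (\<lambda>\<psi>'. T1 \<psi>' + T2 \<psi>')"
proof -
  obtain \<omega>1 \<omega>2 where \<omega>: "horizontal_rep_by \<omega>1 T1" "horizontal_rep_by \<omega>2 T2"
    using assms by (auto simp: horizontal_rep_def)
  note 1 = horizontal_rep_byD[OF \<omega>(1)] and 2 = horizontal_rep_byD[OF \<omega>(2)]
  show ?thesis unfolding horizontal_rep_def horizontal_rep_by_def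
  proof (rule exI[of _ "\<lambda>b y. \<omega>1 b y + \<omega>2 b y"], intro conjI allI impI)
    fix \<psi> \<psi>' assume V: "lie_C1 \<psi> \<psi>'"
    have "integrable lborel (\<lambda>y. \<omega>1 b y * \<psi>' b y)" "integrable lborel (\<lambda>y. \<omega>2 b y * \<psi>' b y)" for b
      using 1(1) 2(1) by (auto intro!: csupp_integrable csupp_mult(2) lie_C1D(3)[OF V])
    then show "T1 \<psi>' + T2 \<psi>' = (\<Sum>b\<in>hbasis G. \<integral>y. (\<omega>1 b y + \<omega>2 b y) * \<psi>' b y \<partial>lborel)"
      by (simp add: 1(3)[OF V] 2(3)[OF V] distrib_right sum.distrib)
  qed (use 1 2 in \<open>auto intro!: continuous_intros\<close>)
qed

lemma horizontal_rep_cmult: assumes "horizontal_rep T" shows "horizontal_rep (\<lambda>\<psi>'. a * T \<psi>')"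
proof -
  obtain \<omega>1 where \<omega>: "horizontal_rep_by \<omega>1 T"
    using assms by (auto simp: horizontal_rep_def)
  note 1 = horizontal_rep_byD[OF \<omega>]
  show ?thesis unfolding horizontal_rep_def horizontal_rep_by_def
    by (rule exI[of _ "\<lambda>b y. a * \<omega>1 b y"])
      (use 1 in \<open>auto intro!: continuous_intros simp: mult.assoc sum_distrib_left\<close>)
qed

lemma horizontal_rep_sum: "finite I \<Longrightarrow> (\<And>i. i \<in> I \<Longrightarrow> horizontal_rep (T i)) \<Longrightarrow> horizontal_rep (\<lambda>\<psi>'. \<Sum>i\<in>I. T i \<psi>')"
  by (induction I rule: finite_induct) (auto intro: horizontal_rep_0 horizontal_rep_add)

lemma finite_hbasis: "finite (hbasis G)"
  by (simp add: hbasis_def)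

lemma horizontal_rep_layer_1:
  assumes c: "c \<in> V 1" and q: "real_polynomial_function q" and j: "1 \<le> j"
  shows "horizontal_rep (\<lambda>\<psi>'. \<integral>y. bump_poly q j y * \<psi>' c y \<partial>lborel)"
  unfolding horizontal_rep_def horizontal_rep_by_def
proof (rule exI[of _ "\<lambda>b y. (c \<bullet> b) * bump_poly q j y"], intro conjI allI impI)
  fix \<psi> \<psi>' assume V: "lie_C1 \<psi> \<psi>'"
  have "\<psi>' c y = (\<Sum>b\<in>hbasis G. (c \<bullet> b) * \<psi>' b y)" for y
    using linear_sum[OF lie_C1D(4)[OF V, of y], of "\<lambda>b. (c \<bullet> b) *\<^sub>R b" "hbasis G"] linear_scale[OF lie_C1D(4)[OF V, of y]]
    by (simp flip: layer1_expand[OF c])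
  moreover have "integrable lborel (\<lambda>y. bump_poly q j y * \<psi>' b y)" for b
    by (intro csupp_integrable csupp_mult(2) lie_C1D(3)[OF V] continuous_on_bump_poly q)
  ultimately show "(\<integral>y. bump_poly q j y * \<psi>' c y \<partial>lborel) = (\<Sum>b\<in>hbasis G. \<integral>y. (c \<bullet> b) * bump_poly q j y * \<psi>' b y \<partial>lborel)"
    by (simp add: sum_distrib_left mult.left_commute[of "bump_poly q j _"] mult.assoc)
qed (use j in \<open>auto intro!: continuous_intros continuous_on_bump_poly q simp: bump_poly_eq_0\<close>)

text \<open>For \<open>c = br x y\<close> with \<open>x\<close> horizontal and \<open>y\<close> in
  layer \<open>i\<close>, \<open>weak_commutator\<close> trades the field of \<open>c\<close> for
  those of \<open>x\<close> and \<open>y\<close>, with one derivative falling on the bump. The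
  \<open>x\<close>-term is horizontal, the \<open>y\<close>-term is covered by induction. Every
  layer consumes one power of the bump, whence \<open>i \<le> j\<close>.\<close>

lemma horizontal_rep_layer:
  assumes "1 \<le> i" "c \<in> V i" "real_polynomial_function q" "i \<le> j"
  shows "horizontal_rep (\<lambda>\<psi>'. \<integral>y. bump_poly q j y * \<psi>' c y \<partial>lborel)"
  using assms
proof (induction i arbitrary: c q j rule: dec_induct)
  case base
  then show ?case by (intro horizontal_rep_layer_1)
next
  case (step i)
  note IH = step.IH and q = step.prems(2) and ij = \<open>1 \<le> i\<close> step.prems(3)
  have int: "integrable lborel (\<lambda>y. bump_poly q j y * \<psi>' b y)" if "lie_C1 \<psi> \<psi>'" for b \<psi> \<psi>'
    by (intro csupp_integrable csupp_mult(2) lie_C1D(3)[OF that] continuous_on_bump_poly q)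
  have "c \<in> span {br x y | x y. x \<in> V 1 \<and> y \<in> V i}"
    using step span_bracket[of i] by simp
  then show ?case
  proof (induction rule: span_induct_alt)
    case base
    show ?case
    proof (rule horizontal_rep_cong[OF horizontal_rep_0])
      fix \<psi> \<psi>' assume V: "lie_C1 \<psi> \<psi>'"
      show "0 = (\<integral>y. bump_poly q j y * \<psi>' 0 y \<partial>lborel)"
        using linear_0[OF lie_C1D(4)[OF V]] by simp
    qed
  next
    case (step a u v)
    obtain x y where u: "u = br x y" "x \<in> V 1" "y \<in> V i" using step.hyps by auto
    obtain q' where q': "\<And>b. real_polynomial_function (q' b)" "lie_C1 (bump_poly q j) (\<lambda>b. bump_poly (q' b) (j - 1))"
      using lie_C1_bump_poly[OF q, of j] ij by (metis Suc_1 Suc_le_mono le_trans)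
    have "horizontal_rep (\<lambda>\<psi>'. (\<integral>z. bump_poly (q' y) (j - 1) z * \<psi>' x z \<partial>lborel) + (- 1) * (\<integral>z. bump_poly (q' x) (j - 1) z * \<psi>' y z \<partial>lborel))"
      using u ij by (intro horizontal_rep_add horizontal_rep_cmult horizontal_rep_layer_1 IH q'(1)) auto
    then have "horizontal_rep (\<lambda>\<psi>'. \<integral>z. bump_poly q j z * \<psi>' u z \<partial>lborel)"
      by (rule horizontal_rep_cong) (simp add: weak_commutator[OF q'(2)] u(1))
    then have "horizontal_rep (\<lambda>\<psi>'. a * (\<integral>z. bump_poly q j z * \<psi>' u z \<partial>lborel) + (\<integral>z. bump_poly q j z * \<psi>' v z \<partial>lborel))"
      by (intro horizontal_rep_add horizontal_rep_cmult step.IH)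
    then show ?case
    proof (rule horizontal_rep_cong)
      fix \<psi> \<psi>' assume V: "lie_C1 \<psi> \<psi>'"
      have "\<psi>' (a *\<^sub>R u + v) y = a * \<psi>' u y + \<psi>' v y" for y
        using linear_add[OF lie_C1D(4)[OF V]] linear_scale[OF lie_C1D(4)[OF V]] by simp
      then show "a * (\<integral>z. bump_poly q j z * \<psi>' u z \<partial>lborel) + (\<integral>z. bump_poly q j z * \<psi>' v z \<partial>lborel) =
        (\<integral>y. bump_poly q j y * \<psi>' (a *\<^sub>R u + v) y \<partial>lborel)"
        using int[OF V] by (simp add: distrib_left mult.left_commute[of "bump_poly q j _"])
    qed
  qed
qed

text \<open>The exponent exceeds every degree, so \<open>horizontal_rep_layer\<close> applies to all
  basis directions. The weight is not normalised; its integral is divided out when the kernel is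
  formed.\<close>

definition \<omega>0 :: "'a \<Rightarrow> real" where "\<omega>0 = bump_poly (\<lambda>_. 1) (Suc (step G))"

text \<open>By \<open>dmult_inverse\<close> the Euler field has polynomial coefficients
  \<open>a b\<close> in the left-invariant frame; multiplied by the weight they are of the form
  \<open>bump_poly\<close>, and each direction can be made horizontal.\<close>

lemma euler_horizontal_rep:
  "\<exists>\<omega>. (\<forall>b. continuous_on UNIV (\<omega> b) \<and> (\<forall>y. 1 < norm y \<longrightarrow> \<omega> b y = 0)) \<and>
     (\<forall>\<psi> D. (\<forall>y. (\<psi> has_derivative D y) (at y)) \<longrightarrow> lie_C1 \<psi> (\<lambda>b y. D y (left_inv_field G b y)) \<longrightarrow>
       (\<integral>y. \<omega>0 y * D y (euler y) \<partial>lborel) = (\<Sum>b\<in>hbasis G. \<integral>y. \<omega> b y * D y (left_inv_field G b y) \<partial>lborel))"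
proof -
  define a where "a = (\<lambda>b y. dmult (- y) y (euler y) \<bullet> b)"
  have poly: "real_polynomial_function (a b)" for b
    unfolding a_def using linear_euler
    by (intro polynomial_function_inner polynomial_function_dmult polynomial_function_id polynomial_function_minus
        polynomial_function_bounded_linear) (simp add: linear_conv_bounded_linear)
  have "horizontal_rep (\<lambda>\<psi>'. \<Sum>b\<in>Basis. \<integral>y. bump_poly (a b) (Suc (step G)) y * \<psi>' b y \<partial>lborel)"
    by (intro horizontal_rep_sum finite_Basis horizontal_rep_layer[where i = "deg b" for b] poly) (use deg in \<open>auto intro: le_SucI\<close>)
  then obtain \<omega> where "horizontal_rep_by \<omega> (\<lambda>\<psi>'. \<Sum>b\<in>Basis. \<integral>y. bump_poly (a b) (Suc (step G)) y * \<psi>' b y \<partial>lborel)"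
    by (auto simp: horizontal_rep_def)
  note \<omega> = horizontal_rep_byD[OF this]
  have "(\<integral>y. \<omega>0 y * D y (euler y) \<partial>lborel) = (\<Sum>b\<in>hbasis G. \<integral>y. \<omega> b y * D y (left_inv_field G b y) \<partial>lborel)"
    if D: "\<And>y. (\<psi> has_derivative D y) (at y)" and V: "lie_C1 \<psi> (\<lambda>b y. D y (left_inv_field G b y))" for \<psi> D
  proof -
    have "\<omega>0 y * D y (euler y) = (\<Sum>b\<in>Basis. bump_poly (a b) (Suc (step G)) y * D y (left_inv_field G b y))" for y
    proof -
      note lin = linear_dmult[of y 0] has_derivative_linear[OF D, of y]
      have "euler y = dmult y 0 (\<Sum>b\<in>Basis. a b y *\<^sub>R b)"
        by (simp add: a_def euclidean_representation dmult_inverse)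
      also have "\<dots> = (\<Sum>b\<in>Basis. a b y *\<^sub>R left_inv_field G b y)"
        by (simp add: linear_sum[OF lin(1)] linear_scale[OF lin(1)] left_inv_field_eq)
      finally have "D y (euler y) = (\<Sum>b\<in>Basis. a b y * D y (left_inv_field G b y))"
        by (simp add: linear_sum[OF lin(2)] linear_scale[OF lin(2)])
      then show ?thesis by (simp add: \<omega>0_def bump_poly_def sum_distrib_left algebra_simps)
    qed
    moreover have "integrable lborel (\<lambda>y. bump_poly (a b) (Suc (step G)) y * D y (left_inv_field G b y))" for b
      by (intro csupp_integrable csupp_mult(2) lie_C1D(3)[OF V] continuous_on_bump_poly poly)
    ultimately show ?thesis by (simp add: \<omega>(3)[OF V])
  qed
  with \<omega>(1,2) show ?thesis by blast
qed

end

section \<open>Radial integrals and fractional integration\<close>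

lemma nn_integral_powr_Icc:
  fixes \<gamma> c :: real
  assumes "0 < \<gamma>" "0 \<le> c"
  shows "(\<integral>\<^sup>+t. ennreal (t powr (\<gamma> - 1)) * indicator {0..c} t \<partial>lborel) = ennreal (c powr \<gamma> / \<gamma>)"
  using nn_integral_has_integral_lebesgue'[OF _ has_integral_powr_from_0[of "\<gamma> - 1" c]] assms by simp

lemma nn_integral_powr_atLeast:
  fixes \<gamma> c :: real
  assumes "\<gamma> < 0" "0 < c"
  shows "(\<integral>\<^sup>+t. ennreal (t powr (\<gamma> - 1)) * indicator {c..} t \<partial>lborel) = ennreal (- (c powr \<gamma>) / \<gamma>)"
  using nn_integral_has_integral_lebesgue'[OF _ has_integral_powr_to_inf[of "\<gamma> - 1" c]] assms by simp

text \<open>Tonelli for the region under the graph: \<open>u x powr q\<close> is \<open>q\<close>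
  times the integral of \<open>t powr (q - 1)\<close> up to \<open>u x\<close>.\<close>

lemma layer_cake:
  fixes u :: "'a::euclidean_space \<Rightarrow> real"
  assumes [measurable]: "u \<in> borel_measurable borel" and u: "\<And>x. 0 \<le> u x" and q: "0 < q"
  shows "(\<integral>\<^sup>+x. ennreal (u x powr q) \<partial>lborel) =
    (\<integral>\<^sup>+t. ennreal (q * t powr (q - 1)) * indicator {0..} t * emeasure lborel {x. t \<le> u x} \<partial>lborel)"
proof -
  have "ennreal (u x powr q) = (\<integral>\<^sup>+t. ennreal (q * t powr (q - 1)) * indicator {0..} t * indicator {x. t \<le> u x} x \<partial>lborel)" for x
  proof -
    have "ennreal (u x powr q) = ennreal q * ennreal (u x powr q / q)"
      using q by (simp add: ennreal_mult[symmetric])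
    also have "\<dots> = (\<integral>\<^sup>+t. ennreal q * (ennreal (t powr (q - 1)) * indicator {0..u x} t) \<partial>lborel)"
      by (simp add: nn_integral_cmult nn_integral_powr_Icc[OF q u])
    also have "\<dots> = (\<integral>\<^sup>+t. ennreal (q * t powr (q - 1)) * indicator {0..} t * indicator {x. t \<le> u x} x \<partial>lborel)"
      using q by (intro nn_integral_cong) (auto simp: ennreal_mult' indicator_def)
    finally show ?thesis .
  qed
  then have "(\<integral>\<^sup>+x. ennreal (u x powr q) \<partial>lborel) =
     (\<integral>\<^sup>+x. \<integral>\<^sup>+t. ennreal (q * t powr (q - 1)) * indicator {0..} t * indicator {x. t \<le> u x} x \<partial>lborel \<partial>lborel)"
    by simp
  also have "\<dots> = (\<integral>\<^sup>+t. \<integral>\<^sup>+x. ennreal (q * t powr (q - 1)) * indicator {0..} t * indicator {x. t \<le> u x} x \<partial>lborel \<partial>lborel)"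
  proof (rule lborel_pair.Fubini')
    have "(\<lambda>z. indicator {x. fst z \<le> u x} (snd z) :: ennreal) = indicator {z. fst z \<le> u (snd z)}"
      by (auto simp: indicator_def)
    then have [measurable]: "(\<lambda>z. indicator {x. fst z \<le> u x} (snd z) :: ennreal) \<in> borel_measurable (lborel \<Otimes>\<^sub>M lborel)"
      by simp
    show "(\<lambda>(t, x). ennreal (q * t powr (q - 1)) * indicator {0..} t * indicator {x. t \<le> u x} x) \<in> borel_measurable (lborel \<Otimes>\<^sub>M lborel)"
      unfolding case_prod_unfold by measurable
  qed
  also have "\<dots> = (\<integral>\<^sup>+t. ennreal (q * t powr (q - 1)) * indicator {0..} t * emeasure lborel {x. t \<le> u x} \<partial>lborel)"
    by (simp add: nn_integral_cmult)
  finally show ?thesis .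
qed

section \<open>Homogeneous norms: compact balls and radial integrals\<close>

locale carnot_norm = carnot_group +
  fixes N :: "'a \<Rightarrow> real"
  assumes norm_N: "hom_norm G N"
begin

lemma N_cont: "continuous_on A N"
  and N_nonneg [simp]: "0 \<le> N x"
  and N_eq_0: "N x = 0 \<longleftrightarrow> x = 0"
  and N_minus [simp]: "N (- x) = N x"
  and N_dilation: "0 < s \<Longrightarrow> N (dilation G s x) = s * N x"
  using norm_N continuous_on_subset[of UNIV N A] unfolding hom_norm_def by auto

lemma N_measurable [measurable]: "N \<in> borel_measurable borel"
  by (rule borel_measurable_continuous_onI[OF N_cont])

lemma N_mult_minus_swap: "N (mult G (- x) z) = N (mult G (- z) x)"
  using N_minus[of "mult G (- x) z"] by (simp add: minus_mult)

text \<open>\<open>N\<close> has a positive minimum on the Euclidean unit sphere. A point outside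
  the unit ball reaches the sphere by a dilation with factor at most 1, which does not increase
  \<open>N\<close>.\<close>

lemma N_small: "\<exists>m>0. \<forall>y. N y < m \<longrightarrow> norm y < 1"
proof -
  obtain b :: 'a where b: "b \<in> Basis" using nonempty_Basis by blast
  then have "sphere (0 :: 'a) 1 \<noteq> {}" by (auto intro!: exI[of _ b])
  then obtain y0 where y0: "norm y0 = 1" "\<And>y. norm y = 1 \<Longrightarrow> N y0 \<le> N y"
    using continuous_attains_inf[OF compact_sphere _ N_cont, of 0 1] by (auto simp: dist_norm)
  have "0 < N y0" using N_eq_0[of y0] N_nonneg[of y0] y0(1) by (auto simp: order_less_le)
  moreover have "N y0 \<le> N y" if y: "1 \<le> norm y" for y
  proof -
    have "\<exists>s\<ge>0. s \<le> 1 \<and> norm (dilation G s y) = 1"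
      by (rule IVT') (use y in \<open>auto intro!: continuous_intros\<close>)
    then obtain s where s: "0 \<le> s" "s \<le> 1" "norm (dilation G s y) = 1" by blast
    then have "s \<noteq> 0" by auto
    then have "N y0 \<le> s * N y" using y0(2)[OF s(3)] s N_dilation[of s y] by simp
    also have "\<dots> \<le> 1 * N y" by (rule mult_right_mono) (use s in auto)
    finally show ?thesis by simp
  qed
  ultimately show ?thesis by (intro exI[of _ "N y0"]) (auto simp: not_le[symmetric])
qed

lemma compact_N_le: "compact {y. N y \<le> r}"
proof -
  obtain m where m: "0 < m" "\<And>y. N y < m \<Longrightarrow> norm y < 1" using N_small by blast
  \<comment> \<open>Chosen so that \<open>s * \<bar>r\<bar> < m\<close>: the dilated set then lies
    in the Euclidean unit ball.\<close>
  define s where "s = m / (2 * (\<bar>r\<bar> + 1))"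
  have s: "0 < s" using m by (simp add: s_def)
  have "{y. N y \<le> r} \<subseteq> dilation G (1 / s) ` cball 0 1"
  proof
    fix y assume "y \<in> {y. N y \<le> r}"
    then have "N (dilation G s y) \<le> s * \<bar>r\<bar>" using s by (simp add: N_dilation)
    also have "\<dots> < m"
    proof -
      have "s * (\<bar>r\<bar> + 1) = m / 2" by (simp add: s_def field_simps)
      then show ?thesis using s m by (simp add: algebra_simps)
    qed
    finally have "norm (dilation G s y) < 1" by (rule m(2))
    moreover have "y = dilation G (1 / s) (dilation G s y)"
      using s by (simp add: dilation_dilation)
    ultimately show "y \<in> dilation G (1 / s) ` cball 0 1" by (intro image_eqI[of _ _ "dilation G s y"]) auto
  qed
  moreover have "compact (dilation G (1 / s) ` cball 0 1)"
    by (intro compact_continuous_image continuous_intros) auto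
  ultimately have "bounded {y. N y \<le> r}" using compact_imp_bounded bounded_subset by blast
  moreover have "closed {y. N y \<le> r}"
    by (intro closed_Collect_le N_cont continuous_on_const)
  ultimately show ?thesis by (simp add: compact_eq_bounded_closed)
qed

definition vol :: real where "vol = measure lborel {y. N y \<le> 1}"

lemma vol_nonneg [simp]: "0 \<le> vol" by (simp add: vol_def)

lemma emeasure_N_le_1: "emeasure lborel {y. N y \<le> 1} = ennreal vol"
  unfolding vol_def using emeasure_compact_finite[OF compact_N_le, of 1]
  by (simp add: emeasure_eq_ennreal_measure less_top)

lemma emeasure_N_le: "0 < r \<Longrightarrow> emeasure lborel {y. N y \<le> r} = ennreal (r ^ Q * vol)"
proof -
  assume r: "0 < r"
  have "emeasure lborel {y. N y \<le> r} = (\<integral>\<^sup>+y. indicator {y. N y \<le> r} y \<partial>lborel)"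
    by simp
  also have "\<dots> = ennreal (r ^ Q) * (\<integral>\<^sup>+y. indicator {y. N y \<le> r} (dilation G r y) \<partial>lborel)"
    by (rule nn_integral_dilation) (use r in auto)
  also have "(\<lambda>y. indicator {y. N y \<le> r} (dilation G r y) :: ennreal) = indicator {y. N y \<le> 1}"
    using r by (auto simp: indicator_def N_dilation)
  finally show ?thesis using r by (simp add: emeasure_N_le_1 ennreal_mult)
qed

lemma N_powr_le_iff:
  fixes \<beta> t n :: real
  assumes "\<beta> < 0" "0 < t" "0 < n" shows "t \<le> n powr \<beta> \<longleftrightarrow> n \<le> t powr (1 / \<beta>)"
proof -
  have "(t powr (1 / \<beta>)) powr \<beta> = t powr 1" unfolding powr_powr using assms(1) by simp
  then have "t = (t powr (1 / \<beta>)) powr \<beta>" using assms(2) by simp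
  then have "t \<le> n powr \<beta> \<longleftrightarrow> (t powr (1 / \<beta>)) powr \<beta> \<le> n powr \<beta>" by simp
  also have "\<dots> \<longleftrightarrow> n \<le> t powr (1 / \<beta>)"
    using assms powr_less_mono2_neg[of \<beta> "t powr (1 / \<beta>)" n] powr_mono2'[of \<beta> n "t powr (1 / \<beta>)"]
    by (cases "n \<le> t powr (1 / \<beta>)") (auto simp: not_le)
  finally show ?thesis .
qed

text \<open>The superlevel set is contained in the closed ball of radius
  \<open>t powr (1 / \<beta>)\<close>, whose volume is a \<open>Q\<close>-th power of the radius.
  The identity is not in the set, as \<open>0 powr \<beta> = 0\<close>.\<close>

lemma emeasure_N_powr_ge:
  assumes "\<beta> < 0" "0 < t"
  shows "emeasure lborel {y. t \<le> N y powr \<beta>} \<le> ennreal (vol * t powr (Q / \<beta>))"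
proof -
  have "{y. t \<le> N y powr \<beta>} \<subseteq> {y. N y \<le> t powr (1 / \<beta>)}"
    using N_powr_le_iff[OF assms] assms(2) by (auto simp: order_less_le) (metis N_nonneg order_less_le powr_0 not_le)
  then have "emeasure lborel {y. t \<le> N y powr \<beta>} \<le> emeasure lborel {y. N y \<le> t powr (1 / \<beta>)}"
    by (intro emeasure_mono) auto
  also have "\<dots> = ennreal ((t powr (1 / \<beta>)) ^ Q * vol)" using assms by (intro emeasure_N_le) simp
  also have "(t powr (1 / \<beta>)) ^ Q = t powr (Q / \<beta>)"
    using assms by (simp add: powr_powr flip: powr_realpow)
  finally show ?thesis by (simp add: mult.commute)
qed

text \<open>The layer cake formula replaces polar coordinates. Levels below 1 contribute at most the
  volume of the unit ball; above, the superlevel sets have measure of order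
  \<open>t powr (Q / \<beta>)\<close>, and \<open>Q / \<beta> < - 1\<close>.\<close>

lemma radial_inner_finite:
  assumes "\<beta> < 0" "- real Q < \<beta>"
  shows "(\<integral>\<^sup>+y. ennreal (N y powr \<beta>) * indicator {y. N y < 1} y \<partial>lborel) < \<infinity>"
proof -
  let ?u = "\<lambda>y. N y powr \<beta> * indicator {y. N y < 1} y"
  have "(\<integral>\<^sup>+y. ennreal (N y powr \<beta>) * indicator {y. N y < 1} y \<partial>lborel) = (\<integral>\<^sup>+y. ennreal (?u y powr 1) \<partial>lborel)"
    by (intro nn_integral_cong) (auto simp: indicator_def)
  also have "\<dots> = (\<integral>\<^sup>+t. ennreal (1 * t powr (1 - 1)) * indicator {0..} t * emeasure lborel {y. t \<le> ?u y} \<partial>lborel)"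
    by (rule layer_cake) auto
  also have "\<dots> \<le> (\<integral>\<^sup>+t. ennreal vol * indicator {0..1} t + ennreal vol * (ennreal (t powr ((Q / \<beta> + 1) - 1)) * indicator {1..} t) \<partial>lborel)"
  proof (rule nn_integral_mono)
    fix t :: real
    consider "t \<le> 0" | "0 < t" "t \<le> 1" | "1 < t" by linarith
    then show "ennreal (1 * t powr (1 - 1)) * indicator {0..} t * emeasure lborel {y. t \<le> ?u y} \<le>
      ennreal vol * indicator {0..1} t + ennreal vol * (ennreal (t powr ((Q / \<beta> + 1) - 1)) * indicator {1..} t)"
    proof cases
      case 1
      then show ?thesis by (cases "t = 0") (auto simp: indicator_def)
    next
      case 2
      then have "{y. t \<le> ?u y} \<subseteq> {y. N y \<le> 1}" by (auto simp: indicator_def split: if_splits)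
      then have "emeasure lborel {y. t \<le> ?u y} \<le> ennreal vol"
        using emeasure_mono[of "{y. t \<le> ?u y}" "{y. N y \<le> 1}" lborel] by (simp add: emeasure_N_le_1)
      then show ?thesis using 2 by (simp add: indicator_def add_increasing2)
    next
      case 3
      then have "{y. t \<le> ?u y} \<subseteq> {y. t \<le> N y powr \<beta>}" by (auto simp: indicator_def split: if_splits)
      then have "emeasure lborel {y. t \<le> ?u y} \<le> emeasure lborel {y. t \<le> N y powr \<beta>}"
        by (intro emeasure_mono) auto
      also have "\<dots> \<le> ennreal (vol * t powr (Q / \<beta>))" by (rule emeasure_N_powr_ge) (use 3 assms in auto)
      finally show ?thesis using 3 by (simp add: ennreal_mult)
    qed
  qed
  also have "\<dots> = ennreal vol + ennreal vol * ennreal (- (1 powr (Q / \<beta> + 1)) / (Q / \<beta> + 1))"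
  proof -
    have neg: "Q / \<beta> + 1 < 0" using assms by (simp add: field_simps)
    show ?thesis
      using nn_integral_powr_atLeast[OF neg, of 1]
      by (subst nn_integral_add) (auto simp: nn_integral_cmult)
  qed
  also have "\<dots> < \<infinity>" by (simp add: ennreal_mult_less_top)
  finally show ?thesis .
qed

text \<open>Outside the unit ball the function is at most 1, so only levels up to 1 occur, and there
  \<open>t powr (Q / \<beta>)\<close> is integrable because
  \<open>Q / \<beta> > - 1\<close>.\<close>

lemma radial_outer_finite:
  assumes "\<beta> < - real Q" "0 < Q"
  shows "(\<integral>\<^sup>+y. ennreal (N y powr \<beta>) * indicator {y. 1 \<le> N y} y \<partial>lborel) < \<infinity>"
proof -
  let ?u = "\<lambda>y. N y powr \<beta> * indicator {y. 1 \<le> N y} y"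
  have \<beta>: "\<beta> < 0" using assms by simp
  have "(\<integral>\<^sup>+y. ennreal (N y powr \<beta>) * indicator {y. 1 \<le> N y} y \<partial>lborel) = (\<integral>\<^sup>+y. ennreal (?u y powr 1) \<partial>lborel)"
    by (intro nn_integral_cong) (auto simp: indicator_def)
  also have "\<dots> = (\<integral>\<^sup>+t. ennreal (1 * t powr (1 - 1)) * indicator {0..} t * emeasure lborel {y. t \<le> ?u y} \<partial>lborel)"
    by (rule layer_cake) auto
  also have "\<dots> \<le> (\<integral>\<^sup>+t. ennreal vol * (ennreal (t powr ((Q / \<beta> + 1) - 1)) * indicator {0..1} t) \<partial>lborel)"
  proof (rule nn_integral_mono)
    fix t :: real
    consider "t \<le> 0" | "0 < t" "t \<le> 1" | "1 < t" by linarith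
    then show "ennreal (1 * t powr (1 - 1)) * indicator {0..} t * emeasure lborel {y. t \<le> ?u y} \<le>
      ennreal vol * (ennreal (t powr ((Q / \<beta> + 1) - 1)) * indicator {0..1} t)"
    proof cases
      case 1
      then show ?thesis by (cases "t = 0") (auto simp: indicator_def)
    next
      case 3
      have "?u y \<le> 1" for y using \<beta> powr_mono2'[of \<beta> 1 "N y"] by (auto simp: indicator_def)
      then have "{y. t \<le> ?u y} = {}" using 3 by (auto simp: not_le intro: le_less_trans)
      then show ?thesis by simp
    next
      case 2
      then have "{y. t \<le> ?u y} \<subseteq> {y. t \<le> N y powr \<beta>}" by (auto simp: indicator_def split: if_splits)
      then have "emeasure lborel {y. t \<le> ?u y} \<le> emeasure lborel {y. t \<le> N y powr \<beta>}"
        by (intro emeasure_mono) auto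
      also have "\<dots> \<le> ennreal (vol * t powr (Q / \<beta>))" by (rule emeasure_N_powr_ge) (use 2 \<beta> in auto)
      finally show ?thesis using 2 by (simp add: ennreal_mult)
    qed
  qed
  also have "\<dots> = ennreal vol * ennreal (1 powr (Q / \<beta> + 1) / (Q / \<beta> + 1))"
  proof -
    have pos: "0 < Q / \<beta> + 1" using assms by (simp add: field_simps)
    show ?thesis
      using nn_integral_powr_Icc[OF pos, of 1] by (subst nn_integral_cmult) auto
  qed
  also have "\<dots> < \<infinity>" by (simp add: ennreal_mult_less_top)
  finally show ?thesis .
qed

lemma radial_inner_scale:
  assumes "0 < \<rho>"
  shows "(\<integral>\<^sup>+y. ennreal (N y powr \<beta>) * indicator {y. N y < \<rho>} y \<partial>lborel) =
    ennreal (\<rho> powr (\<beta> + Q)) * (\<integral>\<^sup>+y. ennreal (N y powr \<beta>) * indicator {y. N y < 1} y \<partial>lborel)"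
    and radial_outer_scale: "(\<integral>\<^sup>+y. ennreal (N y powr \<beta>) * indicator {y. \<rho> \<le> N y} y \<partial>lborel) =
    ennreal (\<rho> powr (\<beta> + Q)) * (\<integral>\<^sup>+y. ennreal (N y powr \<beta>) * indicator {y. 1 \<le> N y} y \<partial>lborel)"
proof -
  have e: "ennreal (\<rho> ^ Q) * (ennreal (\<rho> powr \<beta>) * X) = ennreal (\<rho> powr (\<beta> + Q)) * X" for X
    using assms by (simp add: powr_add powr_realpow ennreal_mult mult_ac)
  have s: "(\<integral>\<^sup>+y. ennreal (N y powr \<beta>) * indicator S y \<partial>lborel) =
    ennreal (\<rho> powr (\<beta> + Q)) * (\<integral>\<^sup>+y. ennreal (N y powr \<beta>) * indicator S' y \<partial>lborel)"
    if [measurable]: "S \<in> sets borel" "S' \<in> sets borel" and S: "\<And>y. dilation G \<rho> y \<in> S \<longleftrightarrow> y \<in> S'" for S S'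
  proof -
    have "(\<integral>\<^sup>+y. ennreal (N y powr \<beta>) * indicator S y \<partial>lborel) =
      ennreal (\<rho> ^ Q) * (\<integral>\<^sup>+y. ennreal (N (dilation G \<rho> y) powr \<beta>) * indicator S (dilation G \<rho> y) \<partial>lborel)"
      by (rule nn_integral_dilation) (use assms in auto)
    also have "(\<integral>\<^sup>+y. ennreal (N (dilation G \<rho> y) powr \<beta>) * indicator S (dilation G \<rho> y) \<partial>lborel) =
      (\<integral>\<^sup>+y. ennreal (\<rho> powr \<beta>) * (ennreal (N y powr \<beta>) * indicator S' y) \<partial>lborel)"
      using assms by (intro nn_integral_cong) (auto simp: N_dilation powr_mult ennreal_mult indicator_def S)
    also have "\<dots> = ennreal (\<rho> powr \<beta>) * (\<integral>\<^sup>+y. ennreal (N y powr \<beta>) * indicator S' y \<partial>lborel)"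
      by (rule nn_integral_cmult) measurable
    finally show ?thesis by (simp only: e)
  qed
  show "(\<integral>\<^sup>+y. ennreal (N y powr \<beta>) * indicator {y. N y < \<rho>} y \<partial>lborel) =
    ennreal (\<rho> powr (\<beta> + Q)) * (\<integral>\<^sup>+y. ennreal (N y powr \<beta>) * indicator {y. N y < 1} y \<partial>lborel)"
    by (rule s) (use assms in \<open>auto simp: N_dilation\<close>)
  show "(\<integral>\<^sup>+y. ennreal (N y powr \<beta>) * indicator {y. \<rho> \<le> N y} y \<partial>lborel) =
    ennreal (\<rho> powr (\<beta> + Q)) * (\<integral>\<^sup>+y. ennreal (N y powr \<beta>) * indicator {y. 1 \<le> N y} y \<partial>lborel)"
    by (rule s) (use assms in \<open>auto simp: N_dilation\<close>)
qed

end

section \<open>The fractional integral for exponents p > 1\<close>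

context carnot_norm
begin

definition riesz_kernel :: "'a \<Rightarrow> 'a \<Rightarrow> real" where "riesz_kernel x z = N (mult G (- x) z) powr (1 - real Q)"
definition riesz :: "('a \<Rightarrow> real) \<Rightarrow> 'a \<Rightarrow> ennreal" where
  "riesz f z = (\<integral>\<^sup>+x. ennreal (f x * riesz_kernel x z) \<partial>lborel)"

lemma riesz_kernel_nonneg [simp]: "0 \<le> riesz_kernel x z" by (simp add: riesz_kernel_def)

lemma riesz_kernel_measurable [measurable (raw)]:
  assumes [measurable]: "f \<in> borel_measurable M" "g \<in> borel_measurable M"
  shows "(\<lambda>w. riesz_kernel (f w) (g w)) \<in> borel_measurable M"
  unfolding riesz_kernel_def by measurable

lemma riesz_measurable [measurable]:
  assumes [measurable]: "f \<in> borel_measurable borel" shows "riesz f \<in> borel_measurable borel"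
proof -
  have "(\<lambda>z. \<integral>\<^sup>+x. ennreal (f x * riesz_kernel x z) \<partial>lborel) \<in> borel_measurable lborel"
    by (rule lborel.borel_measurable_nn_integral) measurable
  then show ?thesis by (simp add: riesz_def[abs_def])
qed

lemma nn_integral_N_right:
  assumes [measurable]: "h \<in> borel_measurable borel"
  shows "(\<integral>\<^sup>+z. h (N (mult G (- x) z)) \<partial>lborel) = (\<integral>\<^sup>+y. h (N y) \<partial>lborel)"
  by (rule nn_integral_left_translation) measurable

lemma nn_integral_N_left:
  assumes [measurable]: "h \<in> borel_measurable borel"
  shows "(\<integral>\<^sup>+x. h (N (mult G (- x) z)) \<partial>lborel) = (\<integral>\<^sup>+y. h (N y) \<partial>lborel)"
  unfolding N_mult_minus_swap[of _ z] by (rule nn_integral_N_right) measurable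

text \<open>The kernel is homogeneous of degree \<open>1 - Q\<close>, so its mass on a ball of
  radius \<open>\<rho>\<close> is \<open>\<rho>\<close> times the mass on the unit ball. The summand
  1 makes the constant positive.\<close>

definition kernel_mass :: real where
  "kernel_mass = enn2real (\<integral>\<^sup>+y. ennreal (N y powr (1 - real Q)) * indicator {y. N y < 1} y \<partial>lborel) + 1"

lemma kernel_mass_pos: "0 < kernel_mass" by (simp add: kernel_mass_def add_nonneg_pos)

lemma radial_kernel_mass:
  assumes "1 < Q" "0 < \<rho>"
  shows "(\<integral>\<^sup>+y. ennreal (N y powr (1 - real Q)) * indicator {y. N y < \<rho>} y \<partial>lborel) \<le> ennreal (kernel_mass * \<rho>)"
proof -
  let ?X = "\<integral>\<^sup>+y. ennreal (N y powr (1 - real Q)) * indicator {y. N y < 1} y \<partial>lborel"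
  have "?X < \<infinity>" by (rule radial_inner_finite) (use assms in auto)
  then have "?X = ennreal (enn2real ?X)" by simp
  also have "\<dots> \<le> ennreal kernel_mass" by (intro ennreal_leI) (simp add: kernel_mass_def)
  finally have X: "?X \<le> ennreal kernel_mass" .
  have "(\<integral>\<^sup>+y. ennreal (N y powr (1 - real Q)) * indicator {y. N y < \<rho>} y \<partial>lborel) = ennreal \<rho> * ?X"
    using assms by (subst radial_inner_scale) simp_all
  also have "\<dots> \<le> ennreal \<rho> * ennreal kernel_mass" by (intro mult_left_mono X) simp
  finally show ?thesis using assms by (simp add: ennreal_mult' mult.commute)
qed

lemma riesz_kernel_inner:
  assumes "1 < Q" "0 < \<rho>"
  shows "(\<integral>\<^sup>+x. ennreal (riesz_kernel x z) * indicator {x. N (mult G (- x) z) < \<rho>} x \<partial>lborel) \<le> ennreal (kernel_mass * \<rho>)"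
    and "(\<integral>\<^sup>+z. ennreal (riesz_kernel x z) * indicator {z. N (mult G (- x) z) < \<rho>} z \<partial>lborel) \<le> ennreal (kernel_mass * \<rho>)"
proof -
  let ?h = "\<lambda>n. ennreal (n powr (1 - real Q)) * indicator {..<\<rho>} n"
  have e: "(\<integral>\<^sup>+y. ?h (N y) \<partial>lborel) = (\<integral>\<^sup>+y. ennreal (N y powr (1 - real Q)) * indicator {y. N y < \<rho>} y \<partial>lborel)"
    by (intro nn_integral_cong) (auto simp: indicator_def)
  have "(\<integral>\<^sup>+x. ennreal (riesz_kernel x z) * indicator {x. N (mult G (- x) z) < \<rho>} x \<partial>lborel) = (\<integral>\<^sup>+x. ?h (N (mult G (- x) z)) \<partial>lborel)"
    by (intro nn_integral_cong) (auto simp: indicator_def riesz_kernel_def)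
  also have "\<dots> = (\<integral>\<^sup>+y. ?h (N y) \<partial>lborel)" by (rule nn_integral_N_left) measurable
  finally show "(\<integral>\<^sup>+x. ennreal (riesz_kernel x z) * indicator {x. N (mult G (- x) z) < \<rho>} x \<partial>lborel) \<le> ennreal (kernel_mass * \<rho>)"
    using radial_kernel_mass[OF assms] by (simp only: e)
  have "(\<integral>\<^sup>+z. ennreal (riesz_kernel x z) * indicator {z. N (mult G (- x) z) < \<rho>} z \<partial>lborel) = (\<integral>\<^sup>+z. ?h (N (mult G (- x) z)) \<partial>lborel)"
    by (intro nn_integral_cong) (auto simp: indicator_def riesz_kernel_def)
  also have "\<dots> = (\<integral>\<^sup>+y. ?h (N y) \<partial>lborel)" by (rule nn_integral_N_right) measurable
  finally show "(\<integral>\<^sup>+z. ennreal (riesz_kernel x z) * indicator {z. N (mult G (- x) z) < \<rho>} z \<partial>lborel) \<le> ennreal (kernel_mass * \<rho>)"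
    using radial_kernel_mass[OF assms] by (simp only: e)
qed

text \<open>Hoelder's inequality by way of Young's: the factor
  \<open>\<rho> powr (\<alpha> / p)\<close> is shifted from \<open>f\<close> to the kernel so that
  both resulting terms are of order \<open>\<rho> powr - \<alpha>\<close>. The conjugate power of
  the kernel is integrable at infinity since \<open>p < Q\<close> means
  \<open>\<beta> < - Q\<close>.\<close>

lemma riesz_tail:
  assumes p: "1 < p" "p < real Q"
  obtains B where "0 < B" "\<And>f \<rho> z. f \<in> borel_measurable borel \<Longrightarrow> (\<And>x. 0 \<le> f x) \<Longrightarrow>
    (\<integral>\<^sup>+x. ennreal (f x powr p) \<partial>lborel) \<le> 1 \<Longrightarrow> 0 < \<rho> \<Longrightarrow>
    (\<integral>\<^sup>+x. ennreal (f x * riesz_kernel x z) * indicator {x. \<rho> \<le> N (mult G (- x) z)} x \<partial>lborel) \<le> ennreal (B * \<rho> powr (- ((real Q - p) / p)))"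
proof -
  define p' where "p' = p / (p - 1)"
  define \<beta> where "\<beta> = (1 - real Q) * p'"
  define \<alpha> where "\<alpha> = (real Q - p) / p"
  have p': "1 < p'" "1 / p + 1 / p' = 1" using p by (auto simp: p'_def field_simps)
  have \<beta>: "\<beta> < - real Q" using p by (simp add: \<beta>_def p'_def field_simps)
  let ?X = "\<integral>\<^sup>+y. ennreal (N y powr \<beta>) * indicator {y. 1 \<le> N y} y \<partial>lborel"
  have "?X < \<infinity>" by (rule radial_outer_finite[OF \<beta>]) (use p in linarith)
  then have X: "?X = ennreal (enn2real ?X)" by simp
  define B where "B = 1 + enn2real ?X"
  have B: "0 < B" by (simp add: B_def add_pos_nonneg)
  have "(\<integral>\<^sup>+x. ennreal (f x * riesz_kernel x z) * indicator {x. \<rho> \<le> N (mult G (- x) z)} x \<partial>lborel) \<le> ennreal (B * \<rho> powr - \<alpha>)"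
    if [measurable]: "f \<in> borel_measurable borel" and f: "\<And>x. 0 \<le> f x" "(\<integral>\<^sup>+x. ennreal (f x powr p) \<partial>lborel) \<le> 1" and \<rho>: "0 < \<rho>"
    for f \<rho> z
  proof -
    let ?h = "\<lambda>n. ennreal (n powr \<beta>) * indicator {\<rho>..} n"
    let ?c = "\<rho> powr (\<alpha> / p)"
    have c: "0 < ?c" using \<rho> by simp
    have "ennreal (f x * riesz_kernel x z) * indicator {x. \<rho> \<le> N (mult G (- x) z)} x \<le>
       ennreal (\<rho> powr - \<alpha>) * ennreal (f x powr p) + ennreal (\<rho> powr (\<alpha> / (p - 1))) * ?h (N (mult G (- x) z))" for x
    proof (cases "\<rho> \<le> N (mult G (- x) z)")
      case True
      have "(f x / ?c) * (riesz_kernel x z * ?c) \<le> (f x / ?c) powr p / p + (riesz_kernel x z * ?c) powr p' / p'"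
        by (rule Youngs_inequality[OF p(1) p']) (use f(1) c in auto)
      also have "\<dots> \<le> (f x / ?c) powr p + (riesz_kernel x z * ?c) powr p'"
        using p p' by (intro add_mono) (auto simp: divide_le_eq mult_le_cancel_left1)
      also have "(f x / ?c) powr p = \<rho> powr - \<alpha> * f x powr p"
        using f(1) p \<rho> by (simp add: powr_divide powr_powr powr_minus field_simps)
      also have "(riesz_kernel x z * ?c) powr p' = \<rho> powr (\<alpha> / (p - 1)) * N (mult G (- x) z) powr \<beta>"
      proof -
        have "\<alpha> / p * p' = \<alpha> / (p - 1)" using p by (simp add: p'_def)
        then show ?thesis by (simp add: powr_mult powr_powr riesz_kernel_def \<beta>_def mult.commute)
      qed
      finally have "f x * riesz_kernel x z \<le> \<rho> powr - \<alpha> * f x powr p + \<rho> powr (\<alpha> / (p - 1)) * N (mult G (- x) z) powr \<beta>"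
        using c by simp
      then show ?thesis using True
        by (simp add: ennreal_mult[symmetric] ennreal_plus[symmetric] ennreal_leI del: ennreal_plus)
    qed simp
    then have "(\<integral>\<^sup>+x. ennreal (f x * riesz_kernel x z) * indicator {x. \<rho> \<le> N (mult G (- x) z)} x \<partial>lborel) \<le>
      (\<integral>\<^sup>+x. ennreal (\<rho> powr - \<alpha>) * ennreal (f x powr p) + ennreal (\<rho> powr (\<alpha> / (p - 1))) * ?h (N (mult G (- x) z)) \<partial>lborel)"
      by (rule nn_integral_mono)
    also have "\<dots> = ennreal (\<rho> powr - \<alpha>) * (\<integral>\<^sup>+x. ennreal (f x powr p) \<partial>lborel) +
        ennreal (\<rho> powr (\<alpha> / (p - 1))) * (\<integral>\<^sup>+x. ?h (N (mult G (- x) z)) \<partial>lborel)"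
      by (subst nn_integral_add) (auto simp: nn_integral_cmult)
    also have "(\<integral>\<^sup>+x. ?h (N (mult G (- x) z)) \<partial>lborel) = (\<integral>\<^sup>+y. ?h (N y) \<partial>lborel)"
      by (rule nn_integral_N_left) measurable
    also have "\<dots> = (\<integral>\<^sup>+y. ennreal (N y powr \<beta>) * indicator {y. \<rho> \<le> N y} y \<partial>lborel)"
      by (intro nn_integral_cong) (auto simp: indicator_def)
    also have "\<dots> = ennreal (\<rho> powr (\<beta> + Q)) * ?X" by (rule radial_outer_scale[OF \<rho>])
    also have "ennreal (\<rho> powr (\<alpha> / (p - 1))) * (ennreal (\<rho> powr (\<beta> + Q)) * ?X) = ennreal (\<rho> powr - \<alpha> * enn2real ?X)"
    proof -
      have "\<alpha> / (p - 1) + (\<beta> + Q) = - \<alpha>"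
        using p by (simp add: \<alpha>_def \<beta>_def p'_def divide_simps) (simp add: algebra_simps power2_eq_square)
      then have "\<rho> powr (\<alpha> / (p - 1)) * \<rho> powr (\<beta> + Q) = \<rho> powr - \<alpha>" by (simp flip: powr_add)
      then show ?thesis by (subst X) (simp add: ennreal_mult[symmetric] mult.assoc[symmetric])
    qed
    also have "ennreal (\<rho> powr - \<alpha>) * (\<integral>\<^sup>+x. ennreal (f x powr p) \<partial>lborel) + ennreal (\<rho> powr - \<alpha> * enn2real ?X)
      \<le> ennreal (\<rho> powr - \<alpha>) * 1 + ennreal (\<rho> powr - \<alpha> * enn2real ?X)"
      by (intro add_mono mult_left_mono f(2)) auto
    also have "\<dots> = ennreal (B * \<rho> powr - \<alpha>)"
      by (simp add: B_def algebra_simps flip: ennreal_plus)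
    finally show ?thesis .
  qed
  then show thesis using that[OF B] by (simp add: \<alpha>_def)
qed

text \<open>At level \<open>t\<close> the kernel is split at distance \<open>\<rho> t\<close> and
  \<open>f\<close> at height \<open>s\<close>: the far part is at most \<open>t / 2\<close>, and
  near values of \<open>f\<close> up to \<open>s\<close> give at most \<open>t / 4\<close>. Where
  the whole integral is at least \<open>t\<close>, the rest is at least \<open>t / 4\<close>, and
  Markov's inequality bounds the measure of that set. Only points with
  \<open>t powr (1 + a) < E * f x\<close> enter, so integrating over \<open>t\<close> yields
  \<open>f powr p\<close>: a strong type bound with neither a maximal function nor
  interpolation.\<close>

lemma hls:
  assumes p: "1 < p" "p < real Q"
  obtains C where "\<And>f. f \<in> borel_measurable borel \<Longrightarrow> (\<And>x. 0 \<le> f x) \<Longrightarrow>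
    (\<integral>\<^sup>+x. ennreal (f x powr p) \<partial>lborel) \<le> 1 \<Longrightarrow>
    (\<integral>\<^sup>+z. ennreal (enn2real (riesz f z) powr (p * real Q / (real Q - p))) \<partial>lborel) \<le> ennreal C"
proof -
  have Q1: "1 < Q" using p by linarith
  \<comment> \<open>Chosen so that the tail at distance \<open>\<rho>\<close> decays like
    \<open>\<rho> powr - (1 / a)\<close>; the target exponent becomes
    \<open>p * (1 + a)\<close>.\<close>
  define a where "a = p / (real Q - p)"
  have a: "0 < a" using p by (simp add: a_def)
  have ia: "(real Q - p) / p = 1 / a" using p by (simp add: a_def)
  define q where "q = p * (1 + a)"
  have q: "q = p * real Q / (real Q - p)" using p by (simp add: q_def a_def field_simps)
  have q1: "1 < q" unfolding q_def by (rule less_1_mult) (use p a in auto)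
  \<comment> \<open>The exponent left in the integral over the levels. As
    \<open>\<gamma> / (1 + a) = p - 1\<close>, it restores the \<open>p\<close>-th power of
    \<open>f\<close>.\<close>
  define \<gamma> where "\<gamma> = (p - 1) * (1 + a)"
  have \<gamma>: "0 < \<gamma>" "\<gamma> = q - 1 - a" using p a by (simp add: \<gamma>_def) (simp add: \<gamma>_def q_def algebra_simps)
  obtain B where B: "0 < B" "\<And>f \<rho> z. f \<in> borel_measurable borel \<Longrightarrow> (\<And>x. 0 \<le> f x) \<Longrightarrow>
    (\<integral>\<^sup>+x. ennreal (f x powr p) \<partial>lborel) \<le> 1 \<Longrightarrow> 0 < \<rho> \<Longrightarrow>
    (\<integral>\<^sup>+x. ennreal (f x * riesz_kernel x z) * indicator {x. \<rho> \<le> N (mult G (- x) z)} x \<partial>lborel) \<le> ennreal (B * \<rho> powr - (1 / a))"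
    by (rule riesz_tail[OF p, unfolded ia]) blast
  define A where "A = kernel_mass"
  have A: "0 < A" using kernel_mass_pos by (simp add: A_def)
  define E where "E = 4 * A * (2 * B) powr a"
  have E: "0 < E" using A B(1) by (simp add: E_def)
  define D where "D = q * E"
  have D: "0 < D" using E q1 by (simp add: D_def)
  \<comment> \<open>The solution of \<open>B * \<rho> powr - (1 / a) = t / 2\<close>.\<close>
  define \<rho> where "\<rho> = (\<lambda>t. (t / (2 * B)) powr - a)"
  have \<rho>_eq: "4 * A * \<rho> t = E * t powr - a" if "0 < t" for t
    using that B(1) by (simp add: \<rho>_def E_def powr_divide powr_minus field_simps)
  have "(\<integral>\<^sup>+z. ennreal (enn2real (riesz f z) powr q) \<partial>lborel) \<le> ennreal (D / \<gamma> * E powr (p - 1))"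
    if [measurable]: "f \<in> borel_measurable borel" and f: "\<And>x. 0 \<le> f x" "(\<integral>\<^sup>+x. ennreal (f x powr p) \<partial>lborel) \<le> 1" for f
  proof -
    let ?u = "\<lambda>z. enn2real (riesz f z)"
    have level: "emeasure lborel {z. t \<le> ?u z} \<le> ennreal (E * t powr (- a - 1)) *
        (\<integral>\<^sup>+x. ennreal (f x) * indicator {x. t powr (1 + a) < E * f x} x \<partial>lborel)" if t: "0 < t" for t
    proof -
      \<comment> \<open>The near kernel has mass at most \<open>A * \<rho> t\<close>, so values of
        \<open>f\<close> up to \<open>s\<close> contribute at most \<open>t / 4\<close>.\<close>
      define s where "s = t / (4 * A * \<rho> t)"
      have \<rho>t: "0 < \<rho> t" using t B(1) by (simp add: \<rho>_def)
      have s: "0 < s" using t A \<rho>t by (simp add: s_def)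
      have sf: "s < f x \<longleftrightarrow> t powr (1 + a) < E * f x" for x
        unfolding s_def \<rho>_eq[OF t] using E t by (simp add: powr_add powr_minus field_simps)
      define M where "M = (\<lambda>z. \<integral>\<^sup>+x. ennreal (f x) * indicator {x. s < f x} x * (ennreal (riesz_kernel x z) * indicator {x. N (mult G (- x) z) < \<rho> t} x) \<partial>lborel)"
      have meas: "(\<lambda>(x, z). ennreal (f x) * indicator {x. s < f x} x * (ennreal (riesz_kernel x z) * indicator {x. N (mult G (- x) z) < \<rho> t} x)) \<in> borel_measurable (lborel \<Otimes>\<^sub>M lborel)"
      proof -
        have "(\<lambda>(x, z). indicator {x. N (mult G (- x) z) < \<rho> t} x :: ennreal) = indicator {w. N (mult G (- fst w) (snd w)) < \<rho> t}"
          by (auto simp: indicator_def)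
        then have [measurable]: "(\<lambda>(x, z). indicator {x. N (mult G (- x) z) < \<rho> t} x :: ennreal) \<in> borel_measurable (lborel \<Otimes>\<^sub>M lborel)"
          by simp
        show ?thesis by measurable
      qed
      then have [measurable]: "M \<in> borel_measurable borel"
        unfolding M_def using lborel.borel_measurable_nn_integral[of "\<lambda>z x. ennreal (f x) * indicator {x. s < f x} x * (ennreal (riesz_kernel x z) * indicator {x. N (mult G (- x) z) < \<rho> t} x)" lborel]
        measurable_pair_swap[OF meas] by (simp add: case_prod_unfold)
      have split: "riesz f z \<le> M z + ennreal (3 * t / 4)" for z
      proof -
        let ?I = "indicator {x. N (mult G (- x) z) < \<rho> t} :: 'a \<Rightarrow> ennreal"
        have "riesz f z \<le> (\<integral>\<^sup>+x. (ennreal (f x) * indicator {x. s < f x} x * (ennreal (riesz_kernel x z) * ?I x)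
          + ennreal s * (ennreal (riesz_kernel x z) * ?I x)) + ennreal (f x * riesz_kernel x z) * indicator {x. \<rho> t \<le> N (mult G (- x) z)} x \<partial>lborel)"
          unfolding riesz_def
        proof (rule nn_integral_mono)
          fix x
          show "ennreal (f x * riesz_kernel x z) \<le> (ennreal (f x) * indicator {x. s < f x} x * (ennreal (riesz_kernel x z) * ?I x)
          + ennreal s * (ennreal (riesz_kernel x z) * ?I x)) + ennreal (f x * riesz_kernel x z) * indicator {x. \<rho> t \<le> N (mult G (- x) z)} x"
          proof (cases "\<rho> t \<le> N (mult G (- x) z)")
            case False
            then show ?thesis
            proof (cases "s < f x")
              case True
              then show ?thesis using False f(1)[of x] s by (simp add: ennreal_mult add_increasing2)
            next
              case False
              then have "ennreal (f x * riesz_kernel x z) \<le> ennreal (s * riesz_kernel x z)"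
                using mult_right_mono[of "f x" s "riesz_kernel x z"] by (intro ennreal_leI) auto
              then show ?thesis using False \<open>\<not> \<rho> t \<le> _\<close> s by (simp add: ennreal_mult)
            qed
          qed (simp add: add_increasing)
        qed
        also have "\<dots> = M z + ennreal s * (\<integral>\<^sup>+x. ennreal (riesz_kernel x z) * ?I x \<partial>lborel) +
           (\<integral>\<^sup>+x. ennreal (f x * riesz_kernel x z) * indicator {x. \<rho> t \<le> N (mult G (- x) z)} x \<partial>lborel)"
          unfolding M_def by (simp add: nn_integral_add nn_integral_cmult)
        also have "\<dots> \<le> M z + ennreal s * ennreal (A * \<rho> t) + ennreal (B * \<rho> t powr - (1 / a))"
          unfolding A_def by (intro add_mono mult_left_mono riesz_kernel_inner(1)[OF Q1 \<rho>t] B(2) f \<rho>t) auto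
        also have "ennreal s * ennreal (A * \<rho> t) = ennreal (t / 4)"
          using s A \<rho>t by (simp add: ennreal_mult[symmetric] s_def)
        also have "B * \<rho> t powr - (1 / a) = t / 2"
          using t B(1) a by (simp add: \<rho>_def powr_powr)
        also have "M z + ennreal (t / 4) + ennreal (t / 2) = M z + ennreal (3 * t / 4)"
          using t by (simp add: add.assoc flip: ennreal_plus)
        finally show ?thesis .
      qed
      have "{z. t \<le> ?u z} \<subseteq> {z\<in>UNIV. 1 \<le> ennreal (4 / t) * M z}"
      proof
        fix z assume "z \<in> {z. t \<le> ?u z}"
        then have z: "t \<le> ?u z" by simp
        \<comment> \<open>\<open>enn2real\<close> never exceeds its argument, infinity being sent to
          0.\<close>
        have "ennreal t \<le> riesz f z" using z by (cases "riesz f z") auto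
        also note split[of z]
        also have "ennreal t = ennreal (3 * t / 4) + ennreal (t / 4)"
          using t by (simp flip: ennreal_plus)
        finally have "ennreal (3 * t / 4) + ennreal (t / 4) \<le> ennreal (3 * t / 4) + M z"
          by (simp only: add.commute)
        then have "ennreal (t / 4) \<le> M z"
          unfolding ennreal_add_left_cancel_le by simp
        then have "ennreal (4 / t) * ennreal (t / 4) \<le> ennreal (4 / t) * M z"
          by (intro mult_left_mono) auto
        then show "z \<in> {z\<in>UNIV. 1 \<le> ennreal (4 / t) * M z}" using t by (simp flip: ennreal_mult)
      qed
      then have "emeasure lborel {z. t \<le> ?u z} \<le> emeasure lborel {z\<in>UNIV. 1 \<le> ennreal (4 / t) * M z}"
        by (intro emeasure_mono) auto
      also have "\<dots> \<le> ennreal (4 / t) * (\<integral>\<^sup>+z. M z * indicator UNIV z \<partial>lborel)"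
        by (rule nn_integral_Markov_inequality) auto
      also have "(\<integral>\<^sup>+z. M z * indicator UNIV z \<partial>lborel) = (\<integral>\<^sup>+x. \<integral>\<^sup>+z. ennreal (f x) * indicator {x. s < f x} x * (ennreal (riesz_kernel x z) * indicator {z. N (mult G (- x) z) < \<rho> t} z) \<partial>lborel \<partial>lborel)"
        unfolding M_def using lborel_pair.Fubini'[OF meas] by (simp add: indicator_def)
      also have "\<dots> = (\<integral>\<^sup>+x. ennreal (f x) * indicator {x. s < f x} x * (\<integral>\<^sup>+z. ennreal (riesz_kernel x z) * indicator {z. N (mult G (- x) z) < \<rho> t} z \<partial>lborel) \<partial>lborel)"
        by (intro nn_integral_cong nn_integral_cmult) measurable
      also have "\<dots> \<le> (\<integral>\<^sup>+x. ennreal (f x) * indicator {x. s < f x} x * ennreal (A * \<rho> t) \<partial>lborel)"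
        unfolding A_def by (intro nn_integral_mono mult_left_mono riesz_kernel_inner(2)[OF Q1 \<rho>t]) auto
      also have "\<dots> = ennreal (A * \<rho> t) * (\<integral>\<^sup>+x. ennreal (f x) * indicator {x. s < f x} x \<partial>lborel)"
        by (subst nn_integral_multc) (auto simp: mult.commute)
      finally have "emeasure lborel {z. t \<le> ?u z} \<le> ennreal (4 / t) * (ennreal (A * \<rho> t) * (\<integral>\<^sup>+x. ennreal (f x) * indicator {x. s < f x} x \<partial>lborel))"
        by (simp add: mult_left_mono)
      also have "\<dots> = ennreal (4 / t * (A * \<rho> t)) * (\<integral>\<^sup>+x. ennreal (f x) * indicator {x. s < f x} x \<partial>lborel)"
        by (subst ennreal_mult[of "4 / t"]) (use t A \<rho>t in \<open>simp_all only: mult.assoc, auto\<close>)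
      also have "4 / t * (A * \<rho> t) = E * t powr (- a - 1)"
      proof -
        have "4 / t * (A * \<rho> t) = (4 * A * \<rho> t) / t" by simp
        then show ?thesis unfolding \<rho>_eq[OF t] using t by (simp add: powr_diff)
      qed
      finally show ?thesis unfolding sf .
    qed
    have "(\<integral>\<^sup>+z. ennreal (?u z powr q) \<partial>lborel) =
      (\<integral>\<^sup>+t. ennreal (q * t powr (q - 1)) * indicator {0..} t * emeasure lborel {z. t \<le> ?u z} \<partial>lborel)"
      by (rule layer_cake) (use q1 in auto)
    also have "\<dots> \<le> (\<integral>\<^sup>+t. \<integral>\<^sup>+x. ennreal (f x) * (ennreal D * (ennreal (t powr (\<gamma> - 1)) * indicator {0..(E * f x) powr (1 / (1 + a))} t)) \<partial>lborel \<partial>lborel)"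
    proof (rule nn_integral_mono)
      fix t :: real
      show "ennreal (q * t powr (q - 1)) * indicator {0..} t * emeasure lborel {z. t \<le> ?u z} \<le>
        (\<integral>\<^sup>+x. ennreal (f x) * (ennreal D * (ennreal (t powr (\<gamma> - 1)) * indicator {0..(E * f x) powr (1 / (1 + a))} t)) \<partial>lborel)"
      proof (cases "0 < t")
        case False
        then show ?thesis by (cases "t = 0") (auto simp: indicator_def)
      next
        case t: True
        have ind: "indicator {x. t powr (1 + a) < E * f x} x \<le> (indicator {0..(E * f x) powr (1 / (1 + a))} t :: ennreal)" for x
        proof (cases "t powr (1 + a) < E * f x")
          case True
          then have "(t powr (1 + a)) powr (1 / (1 + a)) \<le> (E * f x) powr (1 / (1 + a))"
            using a by (intro powr_mono2) auto
          then show ?thesis using t a by (simp add: powr_powr indicator_def)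
        qed simp
        have "ennreal (q * t powr (q - 1)) * indicator {0..} t * emeasure lborel {z. t \<le> ?u z} \<le>
          ennreal (q * t powr (q - 1)) * (ennreal (E * t powr (- a - 1)) * (\<integral>\<^sup>+x. ennreal (f x) * indicator {x. t powr (1 + a) < E * f x} x \<partial>lborel))"
          using t by (simp add: mult_left_mono level[OF t])
        also have "\<dots> = ennreal ((q * t powr (q - 1)) * (E * t powr (- a - 1))) * (\<integral>\<^sup>+x. ennreal (f x) * indicator {x. t powr (1 + a) < E * f x} x \<partial>lborel)"
          by (subst ennreal_mult[of "q * t powr (q - 1)"]) (use E q1 in \<open>simp_all only: mult.assoc, auto\<close>)
        also have "(q * t powr (q - 1)) * (E * t powr (- a - 1)) = D * t powr (\<gamma> - 1)"
        proof -
          have "t powr (q - 1) * t powr (- a - 1) = t powr (\<gamma> - 1)"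
            unfolding powr_add[symmetric] \<gamma>(2) by (simp add: algebra_simps)
          then show ?thesis by (simp add: D_def mult_ac)
        qed
        also have "ennreal (D * t powr (\<gamma> - 1)) * (\<integral>\<^sup>+x. ennreal (f x) * indicator {x. t powr (1 + a) < E * f x} x \<partial>lborel) =
          (\<integral>\<^sup>+x. ennreal (D * t powr (\<gamma> - 1)) * (ennreal (f x) * indicator {x. t powr (1 + a) < E * f x} x) \<partial>lborel)"
          by (rule nn_integral_cmult[symmetric]) measurable
        also have "\<dots> \<le> (\<integral>\<^sup>+x. ennreal (f x) * (ennreal D * (ennreal (t powr (\<gamma> - 1)) * indicator {0..(E * f x) powr (1 / (1 + a))} t)) \<partial>lborel)"
        proof (rule nn_integral_mono)
          fix x
          have "ennreal (D * t powr (\<gamma> - 1)) * (ennreal (f x) * indicator {x. t powr (1 + a) < E * f x} x) \<le>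
            ennreal (D * t powr (\<gamma> - 1)) * (ennreal (f x) * indicator {0..(E * f x) powr (1 / (1 + a))} t)"
            by (intro mult_left_mono ind) auto
          also have "\<dots> = ennreal (f x) * (ennreal D * (ennreal (t powr (\<gamma> - 1)) * indicator {0..(E * f x) powr (1 / (1 + a))} t))"
            using D by (simp add: ennreal_mult mult_ac)
          finally show "ennreal (D * t powr (\<gamma> - 1)) * (ennreal (f x) * indicator {x. t powr (1 + a) < E * f x} x) \<le>
            ennreal (f x) * (ennreal D * (ennreal (t powr (\<gamma> - 1)) * indicator {0..(E * f x) powr (1 / (1 + a))} t))" .
        qed
        finally show ?thesis .
      qed
    qed
    also have "\<dots> = (\<integral>\<^sup>+x. \<integral>\<^sup>+t. ennreal (f x) * (ennreal D * (ennreal (t powr (\<gamma> - 1)) * indicator {0..(E * f x) powr (1 / (1 + a))} t)) \<partial>lborel \<partial>lborel)"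
    proof (rule lborel_pair.Fubini')
      have "(\<lambda>(x, t). indicator {0..(E * f x) powr (1 / (1 + a))} t :: ennreal) = indicator {w. 0 \<le> snd w \<and> snd w \<le> (E * f (fst w)) powr (1 / (1 + a))}"
        by (auto simp: indicator_def)
      then have [measurable]: "(\<lambda>(x, t). indicator {0..(E * f x) powr (1 / (1 + a))} t :: ennreal) \<in> borel_measurable (lborel \<Otimes>\<^sub>M lborel)"
        by simp
      show "(\<lambda>(x, t). ennreal (f x) * (ennreal D * (ennreal (t powr (\<gamma> - 1)) * indicator {0..(E * f x) powr (1 / (1 + a))} t))) \<in> borel_measurable (lborel \<Otimes>\<^sub>M lborel)"
        by measurable
    qed
    also have "\<dots> = (\<integral>\<^sup>+x. ennreal (D / \<gamma> * E powr (p - 1)) * ennreal (f x powr p) \<partial>lborel)"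
    proof (rule nn_integral_cong)
      fix x
      let ?\<tau> = "(E * f x) powr (1 / (1 + a))"
      have "(\<integral>\<^sup>+t. ennreal (f x) * (ennreal D * (ennreal (t powr (\<gamma> - 1)) * indicator {0..?\<tau>} t)) \<partial>lborel) =
        ennreal (f x) * (ennreal D * ennreal (?\<tau> powr \<gamma> / \<gamma>))"
        using nn_integral_powr_Icc[OF \<gamma>(1), of ?\<tau>] by (simp add: nn_integral_cmult)
      also have "?\<tau> powr \<gamma> = E powr (p - 1) * f x powr (p - 1)"
        using a f(1)[of x] E by (simp add: powr_powr \<gamma>_def powr_mult)
      also have "ennreal (f x) * (ennreal D * ennreal (E powr (p - 1) * f x powr (p - 1) / \<gamma>)) =
        ennreal (f x * (D * (E powr (p - 1) * f x powr (p - 1) / \<gamma>)))"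
        by (simp only: ennreal_mult'[OF f(1)] ennreal_mult'[OF less_imp_le[OF D]])
      also have "f x * (D * (E powr (p - 1) * f x powr (p - 1) / \<gamma>)) = (D / \<gamma> * E powr (p - 1)) * f x powr p"
      proof -
        have "f x * f x powr (p - 1) = f x powr p"
          using f(1)[of x] by (cases "f x = 0") (auto simp: powr_diff)
        then show ?thesis by (simp add: mult_ac)
      qed
      also have "ennreal (D / \<gamma> * E powr (p - 1) * f x powr p) = ennreal (D / \<gamma> * E powr (p - 1)) * ennreal (f x powr p)"
        using D \<gamma>(1) by (intro ennreal_mult) auto
      finally show "(\<integral>\<^sup>+t. ennreal (f x) * (ennreal D * (ennreal (t powr (\<gamma> - 1)) * indicator {0..?\<tau>} t)) \<partial>lborel) =
        ennreal (D / \<gamma> * E powr (p - 1)) * ennreal (f x powr p)" .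
    qed
    also have "\<dots> = ennreal (D / \<gamma> * E powr (p - 1)) * (\<integral>\<^sup>+x. ennreal (f x powr p) \<partial>lborel)"
      by (rule nn_integral_cmult) measurable
    also have "\<dots> \<le> ennreal (D / \<gamma> * E powr (p - 1)) * 1"
      by (intro mult_left_mono f(2)) auto
    finally show ?thesis by simp
  qed
  then show thesis using that unfolding q by blast
qed

end

section \<open>A horizontal representation formula\<close>

definition C1c :: "('a::euclidean_space \<Rightarrow> real) \<Rightarrow> ('a \<Rightarrow> 'a \<Rightarrow> real) \<Rightarrow> bool" where
  "C1c \<phi> D \<longleftrightarrow> (\<forall>x. (\<phi> has_derivative D x) (at x)) \<and> (\<forall>v. continuous_on UNIV (\<lambda>x. D x v)) \<and>
     (\<exists>R. \<forall>x. R < norm x \<longrightarrow> \<phi> x = 0)"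

lemma C1cD:
  assumes "C1c \<phi> D"
  shows "(\<phi> has_derivative D x) (at x)" "linear (D x)" "csupp \<phi>"
proof -
  show d: "(\<phi> has_derivative D x) (at x)" for x using assms by (simp add: C1c_def)
  show "linear (D x)" by (rule has_derivative_linear[OF d])
  have "continuous_on UNIV \<phi>"
    using d by (intro continuous_at_imp_continuous_on) (auto intro: has_derivative_continuous)
  then show "csupp \<phi>" using assms by (auto simp: csupp_def C1c_def)
qed

lemma C1c_support:
  assumes "C1c \<phi> D" obtains R where "\<And>x v. R < norm x \<Longrightarrow> D x v = 0"
proof -
  obtain R where R: "\<And>x. R < norm x \<Longrightarrow> \<phi> x = 0" using assms by (auto simp: C1c_def)
  have "D x v = 0" if x: "R < norm x" for x v
  proof -
    have "open {x :: 'a. R < norm x}" by (intro open_Collect_less continuous_intros)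
    then have "((\<lambda>x. 0) has_derivative D x) (at x)"
      by (rule has_derivative_transform_within_open[OF C1cD(1)[OF assms]]) (use x R in auto)
    from has_derivative_unique[OF this has_derivative_const] show ?thesis by simp
  qed
  then show thesis by (rule that)
qed

lemma C1c_continuous:
  assumes C: "C1c \<phi> D" and f: "continuous_on A f" and g: "continuous_on A g"
  shows "continuous_on A (\<lambda>z. D (f z) (g z))"
proof -
  have eq: "D x v = (\<Sum>b\<in>Basis. (v \<bullet> b) * D x b)" for x v
    using linear_sum[OF C1cD(2)[OF C], of x "\<lambda>b. (v \<bullet> b) *\<^sub>R b" Basis] linear_scale[OF C1cD(2)[OF C], of x]
    by (simp add: euclidean_representation)
  have c: "continuous_on A (\<lambda>z. D (f z) b)" for b
    using C by (intro continuous_on_compose2[OF _ f, of UNIV "\<lambda>x. D x b"]) (auto simp: C1c_def)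
  have "continuous_on A (\<lambda>z. \<Sum>b\<in>Basis. (g z \<bullet> b) * D (f z) b)"
    by (intro continuous_intros g c)
  then show ?thesis by (simp only: eq[symmetric])
qed

section \<open>Pulling test functions back along dilations and left translations\<close>

context carnot_group
begin

lemma continuous_on_dmult [continuous_intros]:
  assumes "continuous_on A f" "continuous_on A g" "continuous_on A h"
  shows "continuous_on A (\<lambda>z. dmult (f z) (g z) (h z))"
proof -
  obtain M' where M': "\<And>x y v. dmult x y v = M' ((x, y), (0 :: 'a, v))" "polynomial_function M'"
    using dmult_joint by blast
  show ?thesis unfolding M'(1)
    by (intro continuous_on_compose2[OF continuous_on_polymonial_function[OF M'(2), of UNIV]] continuous_intros assms) auto
qed

lemma csupp_left_dilation:
  assumes v: "csupp v" and s: "0 < s" shows "csupp (\<lambda>y. v (mult G x (dilation G s y)))"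
proof -
  obtain R where R: "\<And>y. R < norm y \<Longrightarrow> v y = 0" using v by (auto simp: csupp_def)
  let ?i = "\<lambda>z. dilation G (1 / s) (mult G (- x) z)"
  have "continuous_on (cball 0 R) ?i" by (intro continuous_intros)
  then obtain R' where R': "\<And>z. norm z \<le> R \<Longrightarrow> norm (?i z) \<le> R'"
    using continuous_on_cball_bounded by blast
  have "v (mult G x (dilation G s y)) = 0" if "R' < norm y" for y
    using R'[of "mult G x (dilation G s y)"] R[of "mult G x (dilation G s y)"] that s
    by (cases "norm (mult G x (dilation G s y)) \<le> R") (auto simp: dilation_dilation)
  moreover have "continuous_on UNIV (\<lambda>y. v (mult G x (dilation G s y)))"
    by (rule continuous_on_compose2[OF csupp_cont[OF v, of UNIV]]) (auto intro!: continuous_intros)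
  ultimately show ?thesis by (auto simp: csupp_def)
qed

definition lie_D :: "('a \<Rightarrow> 'a \<Rightarrow> real) \<Rightarrow> 'a \<Rightarrow> 'a \<Rightarrow> real" where
  "lie_D D b z = D z (left_inv_field G b z)"

lemma csupp_lie_D: assumes C: "C1c \<phi> D" shows "csupp (lie_D D b)"
proof -
  obtain R where "\<And>x v. R < norm x \<Longrightarrow> D x v = 0" by (rule C1c_support[OF C]) blast
  moreover have "continuous_on UNIV (\<lambda>z. D z (left_inv_field G b z))"
    by (intro C1c_continuous[OF C] continuous_on_polymonial_function polynomial_function_left_inv_field continuous_intros)
  ultimately show ?thesis by (auto simp: csupp_def lie_D_def)
qed

lemma linear_lie_D: assumes C: "C1c \<phi> D" shows "linear (\<lambda>b. lie_D D b z)"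
  unfolding lie_D_def using linear_compose[OF linear_left_inv_field C1cD(2)[OF C]] by (simp add: o_def)

lemma hasX_C1c: "C1c \<phi> D \<Longrightarrow> hasX b \<phi> (lie_D D b)"
  unfolding lie_D_def by (rule has_derivative_imp_hasX[OF C1cD(1)])

text \<open>Dilations are automorphisms and left translations commute with right ones, so the flow
  of \<open>b\<close> is carried to the flow of \<open>dilation G s b\<close>. Both sides of the
  second claim are the derivative of one curve.\<close>

lemma lie_C1_dilated:
  fixes x :: 'a
  assumes C: "C1c \<phi> D" and s: "0 < s"
  defines "DD \<equiv> \<lambda>y v. D (mult G x (dilation G s y)) (dmult x (dilation G s y) (dilation G s v))"
  shows "((\<lambda>y. \<phi> (mult G x (dilation G s y))) has_derivative DD y) (at y)"
    and "DD y (left_inv_field G b y) = lie_D D (dilation G s b) (mult G x (dilation G s y))"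
    and "lie_C1 (\<lambda>y. \<phi> (mult G x (dilation G s y))) (\<lambda>b y. DD y (left_inv_field G b y))"
proof -
  let ?\<psi> = "\<lambda>y. \<phi> (mult G x (dilation G s y))"
  show d: "(?\<psi> has_derivative DD y) (at y)" for y
    unfolding DD_def
    by (rule has_derivative_compose[OF has_derivative_compose[OF _ has_derivative_dmult] C1cD(1)[OF C]])
      (rule linear_imp_has_derivative[OF linear_dilation])
  show e: "DD y (left_inv_field G b y) = lie_D D (dilation G s b) (mult G x (dilation G s y))" for b y
  proof (rule DERIV_unique)
    show "((\<lambda>t. ?\<psi> (mult G y (t *\<^sub>R b))) has_real_derivative DD y (left_inv_field G b y)) (at 0)"
      using has_derivative_imp_hasX[OF d, of b] by (simp add: hasX_def)
    show "((\<lambda>t. ?\<psi> (mult G y (t *\<^sub>R b))) has_real_derivative lie_D D (dilation G s b) (mult G x (dilation G s y))) (at 0)"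
      using hasX_C1c[OF C, of "dilation G s b"]
      by (simp add: hasX_def dilation_mult linear_scale[OF linear_dilation] mult_assoc[symmetric])
  qed
  show "lie_C1 ?\<psi> (\<lambda>b y. DD y (left_inv_field G b y))"
    unfolding lie_C1_def
  proof (intro conjI allI)
    show "csupp ?\<psi>" by (rule csupp_left_dilation[OF C1cD(3)[OF C] s])
    show "hasX b ?\<psi> (\<lambda>y. DD y (left_inv_field G b y))" for b
      by (rule has_derivative_imp_hasX[OF d])
    show "csupp (\<lambda>y. DD y (left_inv_field G b y))" for b
      unfolding e by (rule csupp_left_dilation[OF csupp_lie_D[OF C] s])
    show "linear (\<lambda>b. DD y (left_inv_field G b y))" for y
      using linear_compose[OF linear_left_inv_field has_derivative_linear[OF d]] by (simp add: o_def)
  qed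
qed

lemma \<omega>0_props: "continuous_on A \<omega>0" "1 < norm y \<Longrightarrow> \<omega>0 y = 0" "0 \<le> \<omega>0 y" "\<omega>0 y \<le> 1"
proof -
  show "continuous_on A \<omega>0" unfolding \<omega>0_def by (rule continuous_on_bump_poly) (rule real_polynomial_function.intros(2))
  show "1 < norm y \<Longrightarrow> \<omega>0 y = 0" by (simp add: \<omega>0_def bump_poly_eq_0)
  show "0 \<le> \<omega>0 y" by (simp add: \<omega>0_def bump_poly_def bump_bounds)
  show "\<omega>0 y \<le> 1" using power_le_one[OF bump_bounds, of y "Suc (step G)"] by (simp add: \<omega>0_def bump_poly_def)
qed

lemma \<omega>0_integral_pos: "0 < (\<integral>y. \<omega>0 y \<partial>lborel)"
proof -
  \<comment> \<open>A lower bound for the weight on the ball of radius 1/2, where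
    \<open>bump\<close> is at least 3/4.\<close>
  let ?c = "(3 / 4 :: real) ^ Suc (step G)"
  have int: "integrable lborel \<omega>0"
    using integral_bounded_support(1)[OF \<omega>0_props(1,2)] .
  have fin: "emeasure lborel (ball (0 :: 'a) (1 / 2)) < \<infinity>"
    by (rule emeasure_bounded_finite) simp
  have "0 < ?c * measure lborel (ball (0 :: 'a) (1 / 2))"
    using content_ball_pos[of "1 / 2" "0 :: 'a"] by simp
  also have "\<dots> = (\<integral>y. ?c * indicator (ball (0 :: 'a) (1 / 2)) y \<partial>lborel)"
    by simp
  also have "\<dots> \<le> (\<integral>y. \<omega>0 y \<partial>lborel)"
  proof (rule integral_mono[OF _ int])
    show "integrable lborel (\<lambda>y. ?c * indicator (ball (0 :: 'a) (1 / 2)) y)"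
      using fin by (intro integrable_mult_right integrable_real_indicator) auto
    fix y :: 'a
    show "?c * indicator (ball 0 (1 / 2)) y \<le> \<omega>0 y"
    proof (cases "y \<in> ball 0 (1 / 2)")
      case True
      then have "norm y ^ 2 \<le> (1 / 2) ^ 2" by (intro power_mono) auto
      then have "y \<bullet> y \<le> 1 / 4" by (simp add: power2_norm_eq_inner power2_eq_square[of "1 / 2 :: real"])
      then have "3 / 4 \<le> bump y" by (simp add: bump_def)
      then have "?c \<le> bump y ^ Suc (step G)" by (intro power_mono) auto
      then show ?thesis using True by (simp add: \<omega>0_def bump_poly_def)
    qed (simp add: \<omega>0_props)
  qed
  finally show ?thesis .
qed

end

section \<open>The kernel obtained by integrating over dilations\<close>

context carnot_norm
begin

text \<open>What the substitution \<open>z = dilation G s y\<close> makes of a density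
  \<open>w\<close> in \<open>y\<close> integrated over all \<open>s > 0\<close>; the result is
  homogeneous of degree \<open>1 - Q\<close>.\<close>

definition dilation_kernel :: "('a \<Rightarrow> real) \<Rightarrow> 'a \<Rightarrow> real" where
  "dilation_kernel w z = (\<integral>s. indicator {0<..} s * ((1 / s) ^ Q * w (dilation G (1 / s) z)) \<partial>lborel)"

text \<open>\<open>w (dilation G (1 / s) z) \<noteq> 0\<close> forces
  \<open>N z \<le> B * s\<close>, so the integral of \<open>s powr - Q\<close> starts at
  \<open>N z / B\<close> and converges as \<open>1 < Q\<close>. The absolute integral is bounded, as
  Fubini requires it.\<close>

lemma dilation_kernel_bound:
  assumes w: "continuous_on UNIV w" "\<And>y. 1 < norm y \<Longrightarrow> w y = 0" and Q: "1 < Q"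
  obtains C where "0 \<le> C" "\<And>z. z \<noteq> 0 \<Longrightarrow>
    (\<integral>\<^sup>+s. ennreal \<bar>indicator {0<..} s * ((1 / s) ^ Q * w (dilation G (1 / s) z))\<bar> \<partial>lborel) \<le> ennreal (C * N z powr (1 - real Q))"
proof -
  have "csupp w" using w by (auto simp: csupp_def)
  then obtain c where c: "0 < c" "\<And>y. \<bar>w y\<bar> \<le> c" using csupp_bounded by blast
  obtain B where B: "0 < B" "\<And>y. norm y \<le> 1 \<Longrightarrow> N y \<le> B"
    using continuous_on_cball_bounded[OF N_cont] N_nonneg by (metis abs_of_nonneg real_norm_def)
  define C where "C = c * (1 / B) powr (1 - real Q) / (real Q - 1)"
  have "(\<integral>\<^sup>+s. ennreal \<bar>indicator {0<..} s * ((1 / s) ^ Q * w (dilation G (1 / s) z))\<bar> \<partial>lborel) \<le> ennreal (C * N z powr (1 - real Q))"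
    if z: "z \<noteq> 0" for z
  proof -
    have Nz: "0 < N z" using z N_eq_0[of z] N_nonneg[of z] by (simp add: order_less_le)
    have "(\<integral>\<^sup>+s. ennreal \<bar>indicator {0<..} s * ((1 / s) ^ Q * w (dilation G (1 / s) z))\<bar> \<partial>lborel) \<le>
      (\<integral>\<^sup>+s. ennreal c * (ennreal (s powr ((1 - real Q) - 1)) * indicator {N z / B..} s) \<partial>lborel)"
    proof (rule nn_integral_mono)
      fix s :: real
      show "ennreal \<bar>indicator {0<..} s * ((1 / s) ^ Q * w (dilation G (1 / s) z))\<bar> \<le>
        ennreal c * (ennreal (s powr ((1 - real Q) - 1)) * indicator {N z / B..} s)"
      proof (cases "0 < s \<and> w (dilation G (1 / s) z) \<noteq> 0")
        case True
        then have s: "0 < s" and "norm (dilation G (1 / s) z) \<le> 1" using w(2) by (auto simp: not_less[symmetric])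
        then have "N (dilation G (1 / s) z) \<le> B" by (intro B(2))
        then have "N z / B \<le> s" using s B(1) by (simp add: N_dilation field_simps)
        moreover have "\<bar>(1 / s) ^ Q * w (dilation G (1 / s) z)\<bar> \<le> s powr - real Q * c"
          using s c(2)[of "dilation G (1 / s) z"]
          by (simp add: abs_mult powr_minus powr_realpow field_simps)
        ultimately show ?thesis using s c(1) by (simp add: ennreal_mult[symmetric] ennreal_leI mult.commute)
      qed (auto simp: indicator_def)
    qed
    also have "\<dots> = ennreal c * ennreal (- ((N z / B) powr (1 - real Q)) / (1 - real Q))"
      using nn_integral_powr_atLeast[of "1 - real Q" "N z / B"] Q Nz B(1) by (subst nn_integral_cmult) auto
    also have "\<dots> = ennreal (C * N z powr (1 - real Q))"
    proof -
      have "N z / B = N z * (1 / B)" by simp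
      then have "(N z / B) powr (1 - real Q) = N z powr (1 - real Q) * (1 / B) powr (1 - real Q)"
        using Nz B(1) by (simp only: powr_mult)
      moreover have "- ((N z / B) powr (1 - real Q)) / (1 - real Q) = (N z / B) powr (1 - real Q) / (real Q - 1)"
        using minus_divide_divide[of "(N z / B) powr (1 - real Q)" "real Q - 1"] by simp
      ultimately show ?thesis using c(1) Q by (simp add: C_def ennreal_mult'[symmetric] mult_ac)
    qed
    finally show ?thesis .
  qed
  moreover have "0 \<le> C" using c(1) Q by (simp add: C_def)
  ultimately show thesis using that by blast
qed

lemma dilation_kernel_measurable:
  assumes [measurable]: "w \<in> borel_measurable borel" shows "dilation_kernel w \<in> borel_measurable borel"
proof -
  have "(\<lambda>z. \<integral>s. indicator {0<..} s * ((1 / s) ^ Q * w (dilation G (1 / s) z)) \<partial>lborel) \<in> borel_measurable lborel"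
    by (rule lborel.borel_measurable_lebesgue_integral) measurable
  then show ?thesis by (simp add: dilation_kernel_def[abs_def])
qed

lemma dilation_kernel_le:
  assumes [measurable]: "w \<in> borel_measurable borel" and "0 \<le> C"
    and b: "(\<integral>\<^sup>+s. ennreal \<bar>indicator {0<..} s * ((1 / s) ^ Q * w (dilation G (1 / s) z))\<bar> \<partial>lborel) \<le> ennreal (C * N z powr (1 - real Q))"
  shows "\<bar>dilation_kernel w z\<bar> \<le> C * N z powr (1 - real Q)"
proof -
  have "integrable lborel (\<lambda>s. indicator {0<..} s * ((1 / s) ^ Q * w (dilation G (1 / s) z)))"
    by (rule integrableI_bounded) (use b in \<open>auto simp: less_top[symmetric] top_unique\<close>)
  then have "ennreal (norm (dilation_kernel w z)) \<le> (\<integral>\<^sup>+s. ennreal (norm (indicator {0<..} s * ((1 / s) ^ Q * w (dilation G (1 / s) z)))) \<partial>lborel)"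
    unfolding dilation_kernel_def by (rule integral_norm_bound_ennreal)
  also have "\<dots> \<le> ennreal (C * N z powr (1 - real Q))" using b by simp
  finally show ?thesis using \<open>0 \<le> C\<close> by (simp add: ennreal_le_iff)
qed

lemma csupp_N_support: assumes "csupp h" obtains r c where "0 < r" "0 < c" "\<And>z. \<bar>h z\<bar> \<le> c" "\<And>z. r \<le> N z \<Longrightarrow> h z = 0"
proof -
  obtain R where R: "\<And>y. R < norm y \<Longrightarrow> h y = 0" using assms by (auto simp: csupp_def)
  obtain c where c: "0 < c" "\<And>y. \<bar>h y\<bar> \<le> c" using csupp_bounded[OF assms] by blast
  obtain B where B: "0 < B" "\<And>y. norm y \<le> R \<Longrightarrow> N y \<le> B"
    using continuous_on_cball_bounded[OF N_cont] N_nonneg by (metis abs_of_nonneg real_norm_def)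
  have "h z = 0" if "B + 1 \<le> N z" for z
    using B(2)[of z] R[of z] that by (cases "norm z \<le> R") auto
  with B(1) c show thesis using that[of "B + 1" c] by auto
qed

text \<open>The double integral converges absolutely: the inner one is at most a multiple of
  \<open>N powr (1 - Q)\<close>, which is integrable on balls, and \<open>h\<close> is bounded and
  vanishes outside a ball.\<close>

lemma dilation_kernel_Fubini:
  assumes w: "continuous_on UNIV w" "\<And>y. 1 < norm y \<Longrightarrow> w y = 0" and Q: "1 < Q" and h: "csupp h"
  shows "integrable lborel (\<lambda>s. indicator {0<..} s * (\<integral>y. w y * h (dilation G s y) \<partial>lborel))"
    and "(\<integral>s. indicator {0<..} s * (\<integral>y. w y * h (dilation G s y) \<partial>lborel) \<partial>lborel) = (\<integral>z. dilation_kernel w z * h z \<partial>lborel)"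
proof -
  have [measurable]: "w \<in> borel_measurable borel" "h \<in> borel_measurable borel"
    using borel_measurable_continuous_onI[OF w(1)] borel_measurable_continuous_onI[OF csupp_cont[OF h]] by auto
  obtain C where C: "0 \<le> C" "\<And>z. z \<noteq> 0 \<Longrightarrow>
    (\<integral>\<^sup>+s. ennreal \<bar>indicator {0<..} s * ((1 / s) ^ Q * w (dilation G (1 / s) z))\<bar> \<partial>lborel) \<le> ennreal (C * N z powr (1 - real Q))"
    using dilation_kernel_bound[OF w Q] by blast
  obtain r c where r: "0 < r" "0 < c" "\<And>z. \<bar>h z\<bar> \<le> c" "\<And>z. r \<le> N z \<Longrightarrow> h z = 0" using csupp_N_support[OF h] by blast
  define H where "H = (\<lambda>z s. indicator {0<..} s * ((1 / s) ^ Q * w (dilation G (1 / s) z)) * h z)"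
  have [measurable]: "case_prod H \<in> borel_measurable (lborel \<Otimes>\<^sub>M lborel)"
    unfolding H_def by measurable
  have int: "integrable (lborel \<Otimes>\<^sub>M lborel) (case_prod H)"
  proof (rule integrableI_bounded)
    have "(\<integral>\<^sup>+p. ennreal (norm (case_prod H p)) \<partial>(lborel \<Otimes>\<^sub>M lborel)) = (\<integral>\<^sup>+z. \<integral>\<^sup>+s. ennreal (norm (H z s)) \<partial>lborel \<partial>lborel)"
      by (subst lborel.nn_integral_fst[symmetric]) auto
    also have "\<dots> \<le> (\<integral>\<^sup>+z. ennreal (C * c) * (ennreal (N z powr (1 - real Q)) * indicator {y. N y < r} z) \<partial>lborel)"
    proof (rule nn_integral_mono_AE, use AE_lborel_singleton[of "0 :: 'a"] in eventually_elim)
      fix z :: 'a assume z: "z \<noteq> 0"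
      show "(\<integral>\<^sup>+s. ennreal (norm (H z s)) \<partial>lborel) \<le> ennreal (C * c) * (ennreal (N z powr (1 - real Q)) * indicator {y. N y < r} z)"
      proof (cases "r \<le> N z")
        case True
        then show ?thesis using r(4) by (simp add: H_def)
      next
        case False
        have "(\<integral>\<^sup>+s. ennreal (norm (H z s)) \<partial>lborel) = (\<integral>\<^sup>+s. ennreal \<bar>indicator {0<..} s * ((1 / s) ^ Q * w (dilation G (1 / s) z))\<bar> * ennreal \<bar>h z\<bar> \<partial>lborel)"
          by (intro nn_integral_cong) (simp add: H_def abs_mult ennreal_mult[symmetric])
        also have "\<dots> = (\<integral>\<^sup>+s. ennreal \<bar>indicator {0<..} s * ((1 / s) ^ Q * w (dilation G (1 / s) z))\<bar> \<partial>lborel) * ennreal \<bar>h z\<bar>"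
          by (rule nn_integral_multc) measurable
        also have "\<dots> \<le> ennreal (C * N z powr (1 - real Q)) * ennreal c"
          by (intro mult_mono C(2)[OF z] ennreal_leI r(3)) auto
        also have "\<dots> = ennreal (C * c) * (ennreal (N z powr (1 - real Q)) * indicator {y. N y < r} z)"
          using False C(1) r(2) by (simp add: ennreal_mult[symmetric] mult_ac)
        finally show ?thesis .
      qed
    qed
    also have "\<dots> = ennreal (C * c) * (\<integral>\<^sup>+z. ennreal (N z powr (1 - real Q)) * indicator {y. N y < r} z \<partial>lborel)"
      by (rule nn_integral_cmult) measurable
    also have "\<dots> \<le> ennreal (C * c) * ennreal (kernel_mass * r)"
      by (intro mult_left_mono radial_kernel_mass Q r) auto
    also have "\<dots> < \<infinity>" by (simp add: ennreal_mult_less_top)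
    finally show "(\<integral>\<^sup>+p. ennreal (norm (case_prod H p)) \<partial>(lborel \<Otimes>\<^sub>M lborel)) < \<infinity>" .
  qed auto
  have Hs: "(\<integral>z. H z s \<partial>lborel) = indicator {0<..} s * (\<integral>y. w y * h (dilation G s y) \<partial>lborel)" for s
  proof (cases "0 < s")
    case True
    have "(\<integral>z. H z s \<partial>lborel) = (1 / s) ^ Q * (\<integral>z. w (dilation G (1 / s) z) * h z \<partial>lborel)"
      using True by (simp add: H_def mult.assoc)
    also have "(\<integral>z. w (dilation G (1 / s) z) * h z \<partial>lborel) = s ^ Q * (\<integral>z. w (dilation G (1 / s) (dilation G s z)) * h (dilation G s z) \<partial>lborel)"
      by (rule integral_dilation) (use True in auto)
    finally show ?thesis using True by (simp add: dilation_dilation power_one_over)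
  qed (simp add: H_def)
  show "integrable lborel (\<lambda>s. indicator {0<..} s * (\<integral>y. w y * h (dilation G s y) \<partial>lborel))"
    using lborel_pair.integrable_snd[OF int] by (simp add: Hs)
  have "(\<integral>s. (\<integral>z. H z s \<partial>lborel) \<partial>lborel) = (\<integral>z. (\<integral>s. H z s \<partial>lborel) \<partial>lborel)"
    by (rule lborel_pair.Fubini_integral[OF int])
  also have "\<dots> = (\<integral>z. dilation_kernel w z * h z \<partial>lborel)"
    by (simp add: H_def dilation_kernel_def)
  finally show "(\<integral>s. indicator {0<..} s * (\<integral>y. w y * h (dilation G s y) \<partial>lborel) \<partial>lborel) = (\<integral>z. dilation_kernel w z * h z \<partial>lborel)"
    by (simp add: Hs)
qed

text \<open>
  Averaging the fundamental theorem of calculus along the dilation curves from \<open>x\<close> with the weight \<open>\<omega>0\<close>.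
\<close>

lemma representation_aux:
  assumes Q: "1 < Q"
    and \<omega>: "\<And>b. continuous_on UNIV (\<omega> b)" "\<And>b y. 1 < norm y \<Longrightarrow> \<omega> b y = 0"
    and eu: "\<And>\<psi> D. (\<And>y. (\<psi> has_derivative D y) (at y)) \<Longrightarrow> lie_C1 \<psi> (\<lambda>b y. D y (left_inv_field G b y)) \<Longrightarrow>
       (\<integral>y. \<omega>0 y * D y (euler y) \<partial>lborel) = (\<Sum>b\<in>hbasis G. \<integral>y. \<omega> b y * D y (left_inv_field G b y) \<partial>lborel)"
    and C: "C1c \<phi> D"
  shows "\<phi> x * (\<integral>y. \<omega>0 y \<partial>lborel) = - (\<Sum>b\<in>hbasis G. \<integral>z. dilation_kernel (\<omega> b) z * lie_D D b (mult G x z) \<partial>lborel)"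
proof -
  \<comment> \<open>The velocity of the dilation curve, written without dividing by \<open>s\<close>
    so that it is continuous at \<open>s = 0\<close> too; \<open>s\<close> times it is the dilated
    Euler vector.\<close>
  define dd where "dd = (\<lambda>(s :: real) y. \<Sum>b\<in>Basis. (deg b * s ^ (deg b - 1) * (y \<bullet> b)) *\<^sub>R b)"
  define f' where "f' = (\<lambda>s y. \<omega>0 y * D (mult G x (dilation G s y)) (dmult x (dilation G s y) (dd s y)))"
  define T where "T = (\<lambda>s. \<integral>y. \<omega>0 y * \<phi> (mult G x (dilation G s y)) \<partial>lborel)"
  define F where "F = (\<lambda>s. \<integral>y. f' s y \<partial>lborel)"
  have dil: "((\<lambda>s. dilation G s y) has_vector_derivative dd s y) (at s)" for s y
    unfolding dilation_eq dd_def
  proof (intro has_vector_derivative_sum)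
    fix b :: 'a
    have "((\<lambda>s. s ^ deg b * (y \<bullet> b)) has_real_derivative deg b * s ^ (deg b - 1) * (y \<bullet> b)) (at s)"
      by (rule DERIV_cmult_right) (use DERIV_pow[of "deg b" s] in simp)
    then show "((\<lambda>s. (s ^ deg b * (y \<bullet> b)) *\<^sub>R b) has_vector_derivative (deg b * s ^ (deg b - 1) * (y \<bullet> b)) *\<^sub>R b) (at s)"
      using has_vector_derivative_scaleR[OF _ has_vector_derivative_const] by fastforce
  qed
  have dd: "s *\<^sub>R dd s y = dilation G s (euler y)" for s y
  proof (rule euclidean_eqI)
    fix b :: 'a assume b: "b \<in> Basis"
    have "dd s y \<bullet> b = deg b * s ^ (deg b - 1) * (y \<bullet> b)"
      unfolding dd_def using b by (simp add: inner_sum_left inner_Basis if_distrib sum.delta cong: if_cong)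
    moreover have "s * s ^ (deg b - 1) = s ^ deg b" using deg(1)[OF b] by (cases "deg b") auto
    ultimately show "(s *\<^sub>R dd s y) \<bullet> b = dilation G s (euler y) \<bullet> b"
      using b by (simp add: dilation_inner euler_inner mult_ac)
  qed
  have der: "((\<lambda>s. \<omega>0 y * \<phi> (mult G x (dilation G s y))) has_real_derivative f' s y) (at s)" for s y
  proof -
    have "((\<lambda>s. mult G x (dilation G s y)) has_derivative (\<lambda>h. dmult x (dilation G s y) (h *\<^sub>R dd s y))) (at s)"
      by (rule has_derivative_compose[OF dil[unfolded has_vector_derivative_def] has_derivative_dmult])
    from has_derivative_compose[OF this C1cD(1)[OF C]]
    have "((\<lambda>s. \<phi> (mult G x (dilation G s y))) has_derivative (\<lambda>h. D (mult G x (dilation G s y)) (dmult x (dilation G s y) (h *\<^sub>R dd s y)))) (at s)" .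
    then have "((\<lambda>s. \<phi> (mult G x (dilation G s y))) has_real_derivative D (mult G x (dilation G s y)) (dmult x (dilation G s y) (dd s y))) (at s)"
      by (simp add: has_field_derivative_def linear_scale[OF linear_dmult] linear_scale[OF C1cD(2)[OF C]] mult_commute_abs)
    then show ?thesis unfolding f'_def by (rule DERIV_cmult)
  qed
  have contd: "continuous_on A (\<lambda>z. dd (f z) (g z))" if "continuous_on A f" "continuous_on A g" for f :: "_ \<Rightarrow> real" and g :: "(real \<times> 'a) \<Rightarrow> 'a" and A
    unfolding dd_def by (intro continuous_intros that)
  have cont: "continuous_on UNIV (\<lambda>y. \<omega>0 y * \<phi> (mult G x (dilation G s y)))" for s
    by (intro continuous_on_mult \<omega>0_props continuous_on_compose2[OF csupp_cont[OF C1cD(3)[OF C], of UNIV]] continuous_intros) auto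
  have cont': "continuous_on UNIV (\<lambda>(s, y). f' s y)"
    unfolding f'_def case_prod_unfold
    by (intro continuous_on_mult continuous_on_compose2[OF \<omega>0_props(1)[of UNIV]] C1c_continuous[OF C] continuous_intros contd) auto
  note pd = integral_param_deriv[where R = 1 and f = "\<lambda>s y. \<omega>0 y * \<phi> (mult G x (dilation G s y))" and f' = f', OF der cont cont']
  have T': "(T has_real_derivative F s) (at s)" and F: "isCont F s" for s
    unfolding T_def F_def by (rule pd; simp add: \<omega>0_props f'_def)+
  \<comment> \<open>For a horizontal direction \<open>dilation G s b = s *\<^sub>R b\<close>, and
    this factor cancels the one in \<open>s * F s\<close>; a direction of higher degree would leave
    a power of \<open>s\<close>.\<close>
  have F_eq: "F s = (\<Sum>b\<in>hbasis G. \<integral>y. \<omega> b y * lie_D D b (mult G x (dilation G s y)) \<partial>lborel)" if s: "0 < s" for s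
  proof -
    note v = lie_C1_dilated[OF C s, of x]
    have "s * F s = (\<integral>y. \<omega>0 y * D (mult G x (dilation G s y)) (dmult x (dilation G s y) (dilation G s (euler y))) \<partial>lborel)"
      unfolding F_def f'_def integral_mult_right_zero[symmetric] dd[symmetric]
      by (simp add: linear_scale[OF linear_dmult] linear_scale[OF C1cD(2)[OF C]] mult_ac)
    also have "\<dots> = (\<Sum>b\<in>hbasis G. \<integral>y. \<omega> b y * lie_D D (dilation G s b) (mult G x (dilation G s y)) \<partial>lborel)"
      using eu[OF v(1,3)] unfolding v(2) .
    also have "\<dots> = (\<Sum>b\<in>hbasis G. s * (\<integral>y. \<omega> b y * lie_D D b (mult G x (dilation G s y)) \<partial>lborel))"
    proof (intro sum.cong refl)
      fix b assume "b \<in> hbasis G"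
      then have "dilation G s b = s *\<^sub>R b" using dilation_layer[of 1 b s] by (simp add: hbasis_def)
      then show "(\<integral>y. \<omega> b y * lie_D D (dilation G s b) (mult G x (dilation G s y)) \<partial>lborel) = s * (\<integral>y. \<omega> b y * lie_D D b (mult G x (dilation G s y)) \<partial>lborel)"
        by (simp add: linear_scale[OF linear_lie_D[OF C]] mult.left_commute)
    qed
    finally show ?thesis using s by (simp flip: sum_distrib_left)
  qed
  have h: "csupp (\<lambda>z. lie_D D b (mult G x z))" for b
    using csupp_left_dilation[OF csupp_lie_D[OF C] zero_less_one, of b x] by simp
  note kF = dilation_kernel_Fubini[OF \<omega> Q h]
  have iF: "indicator {0<..} s * F s = (\<Sum>b\<in>hbasis G. indicator {0<..} s * (\<integral>y. \<omega> b y * lie_D D b (mult G x (dilation G s y)) \<partial>lborel))" for s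
    by (cases "0 < s") (auto simp: F_eq)
  have ein: "einterval 0 \<infinity> = {0<..}" by (auto simp: einterval_def zero_ereal_def)
  have "(LBINT s=0..\<infinity>. F s) = 0 - T 0"
  proof (rule interval_integral_FTC_integrable)
    show "(T has_vector_derivative F s) (at s)" for s
      using T' by (simp add: has_real_derivative_iff_has_vector_derivative)
    show "set_integrable lborel (einterval 0 \<infinity>) F"
      unfolding set_integrable_def ein using kF(1) by (simp add: iF)
    have "(T \<longlongrightarrow> T 0) (at 0)" using DERIV_isCont[OF T'[of 0]] by (simp add: isCont_def)
    then have "(T \<longlongrightarrow> T 0) (at_right 0)" by (rule tendsto_mono[OF at_le, rotated]) auto
    then show "((T \<circ> real_of_ereal) \<longlongrightarrow> T 0) (at_right 0)"
      by (simp add: ereal_tendsto_simps zero_ereal_def)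
    \<comment> \<open>In the variable \<open>dilation G s y\<close> the average is
      \<open>(1 / s) ^ Q\<close> times an integral bounded independently of \<open>s\<close>, so the
      boundary term at infinity vanishes.\<close>
    have "(T \<longlongrightarrow> 0) at_top"
    proof (rule Lim_null_comparison)
      let ?I = "\<integral>z. \<bar>\<phi> (mult G x z)\<bar> \<partial>lborel"
      have [measurable]: "\<omega>0 \<in> borel_measurable borel" "\<phi> \<in> borel_measurable borel"
        using borel_measurable_continuous_onI[OF \<omega>0_props(1)] borel_measurable_continuous_onI[OF csupp_cont[OF C1cD(3)[OF C]]] by auto
      have \<phi>x: "integrable lborel (\<lambda>z. \<phi> (mult G x z))"
        using csupp_integrable[OF csupp_left_dilation[OF C1cD(3)[OF C] zero_less_one, of x]] by simp
      have "norm (T s) \<le> (1 / s) ^ Q * ?I" if s: "0 < s" for s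
      proof -
        have "(\<integral>z. \<omega>0 (dilation G (1 / s) z) * \<phi> (mult G x z) \<partial>lborel) = s ^ Q * (\<integral>z. \<omega>0 (dilation G (1 / s) (dilation G s z)) * \<phi> (mult G x (dilation G s z)) \<partial>lborel)"
          by (rule integral_dilation) (use s in auto)
        then have "T s = (1 / s) ^ Q * (\<integral>z. \<omega>0 (dilation G (1 / s) z) * \<phi> (mult G x z) \<partial>lborel)"
          using s by (simp add: T_def dilation_dilation power_one_over)
        moreover have "\<bar>\<integral>z. \<omega>0 (dilation G (1 / s) z) * \<phi> (mult G x z) \<partial>lborel\<bar> \<le> ?I"
        proof -
          have "\<bar>\<omega>0 (dilation G (1 / s) z) * \<phi> (mult G x z)\<bar> \<le> \<bar>\<phi> (mult G x z)\<bar>" for z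
            using \<omega>0_props(3,4)[of "dilation G (1 / s) z"] by (simp add: abs_mult mult_left_le_one_le)
          then have "(\<integral>z. norm (\<omega>0 (dilation G (1 / s) z) * \<phi> (mult G x z)) \<partial>lborel) \<le> ?I"
            by (intro integral_mono'[OF integrable_abs[OF \<phi>x]]) auto
          with integral_norm_bound[of lborel "\<lambda>z. \<omega>0 (dilation G (1 / s) z) * \<phi> (mult G x z)"]
          show ?thesis unfolding real_norm_def by (rule order_trans)
        qed
        ultimately show ?thesis using s by (simp add: abs_mult mult_left_mono)
      qed
      then show "\<forall>\<^sub>F s in at_top. norm (T s) \<le> (1 / s) ^ Q * ?I"
        by (intro eventually_at_top_linorderI[of 1]) auto
      have "((\<lambda>s::real. (1 / s) ^ Q) \<longlongrightarrow> 0 ^ Q) at_top"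
        by (intro tendsto_power tendsto_divide_0[OF tendsto_const] filterlim_at_top_imp_at_infinity filterlim_ident)
      then have "((\<lambda>s::real. (1 / s) ^ Q * ?I) \<longlongrightarrow> 0 ^ Q * ?I) at_top"
        by (intro tendsto_mult tendsto_const)
      moreover have "0 ^ Q * ?I = 0" using Q by (simp add: power_0_left)
      ultimately show "((\<lambda>s::real. (1 / s) ^ Q * ?I) \<longlongrightarrow> 0) at_top" by (simp only:)
    qed
    then show "((T \<circ> real_of_ereal) \<longlongrightarrow> 0) (at_left \<infinity>)"
      by (simp add: ereal_tendsto_simps)
  qed (use F in auto)
  moreover have "(LBINT s=0..\<infinity>. F s) = (\<integral>s. indicator {0<..} s * F s \<partial>lborel)"
    by (simp add: interval_lebesgue_integral_def set_lebesgue_integral_def ein)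
  moreover have "\<dots> = (\<Sum>b\<in>hbasis G. \<integral>z. dilation_kernel (\<omega> b) z * lie_D D b (mult G x z) \<partial>lborel)"
    unfolding iF using kF by (subst Bochner_Integration.integral_sum) auto
  moreover have "T 0 = \<phi> x * (\<integral>y. \<omega>0 y \<partial>lborel)" by (simp add: T_def mult.commute)
  ultimately show ?thesis by simp
qed

text \<open>Division by the integral \<open>W\<close> of the weight makes the kernel a fundamental
  solution, and a left translation brings it into convolution form. Summing the constants of all
  directions gives a common \<open>C\<close>.\<close>

lemma representation:
  assumes Q: "1 < Q"
  obtains K C where "\<And>b. K b \<in> borel_measurable borel" "0 \<le> C"
    "\<And>b z. b \<in> hbasis G \<Longrightarrow> z \<noteq> 0 \<Longrightarrow> \<bar>K b z\<bar> \<le> C * N z powr (1 - real Q)"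
    "\<And>(\<phi> :: 'a \<Rightarrow> real) D x. C1c \<phi> D \<Longrightarrow> \<phi> x = - (\<Sum>b\<in>hbasis G. \<integral>z. K b (mult G (- x) z) * lie_D D b z \<partial>lborel)"
proof -
  obtain \<omega> where \<omega>: "\<And>b. continuous_on UNIV (\<omega> b)" "\<And>b y. 1 < norm y \<Longrightarrow> \<omega> b y = 0"
    and eu: "\<And>\<psi> D. (\<And>y. (\<psi> has_derivative D y) (at y)) \<Longrightarrow> lie_C1 \<psi> (\<lambda>b y. D y (left_inv_field G b y)) \<Longrightarrow>
       (\<integral>y. \<omega>0 y * D y (euler y) \<partial>lborel) = (\<Sum>b\<in>hbasis G. \<integral>y. \<omega> b y * D y (left_inv_field G b y) \<partial>lborel)"
    using euler_horizontal_rep by blast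
  define W where "W = (\<integral>y. \<omega>0 y \<partial>lborel)"
  have W: "0 < W" unfolding W_def by (rule \<omega>0_integral_pos)
  have [measurable]: "\<omega> b \<in> borel_measurable borel" for b by (rule borel_measurable_continuous_onI[OF \<omega>(1)])
  note [measurable] = dilation_kernel_measurable
  have "\<exists>C\<ge>0. \<forall>z. z \<noteq> 0 \<longrightarrow> \<bar>dilation_kernel (\<omega> b) z\<bar> \<le> C * N z powr (1 - real Q)" for b
  proof -
    obtain C where "0 \<le> C" "\<And>z. z \<noteq> 0 \<Longrightarrow>
      (\<integral>\<^sup>+s. ennreal \<bar>indicator {0<..} s * ((1 / s) ^ Q * \<omega> b (dilation G (1 / s) z))\<bar> \<partial>lborel) \<le> ennreal (C * N z powr (1 - real Q))"
      using dilation_kernel_bound[OF \<omega>(1)[of b] \<omega>(2)[of _ b] Q] by blast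
    then show ?thesis by (intro exI[of _ C]) (auto intro!: dilation_kernel_le)
  qed
  then obtain c where c: "\<And>b. 0 \<le> c b" "\<And>b z. z \<noteq> 0 \<Longrightarrow> \<bar>dilation_kernel (\<omega> b) z\<bar> \<le> c b * N z powr (1 - real Q)"
    by metis
  define C where "C = (\<Sum>b\<in>hbasis G. c b) / W"
  show thesis
  proof (rule that[of "\<lambda>b z. dilation_kernel (\<omega> b) z / W" C])
    show "(\<lambda>z. dilation_kernel (\<omega> b) z / W) \<in> borel_measurable borel" for b by measurable
    show "0 \<le> C" using W c(1) by (simp add: C_def sum_nonneg)
    show "\<bar>dilation_kernel (\<omega> b) z / W\<bar> \<le> C * N z powr (1 - real Q)" if "b \<in> hbasis G" "z \<noteq> 0" for b z
    proof -
      have "\<bar>dilation_kernel (\<omega> b) z\<bar> \<le> c b * N z powr (1 - real Q)" by (rule c(2)[OF that(2)])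
      also have "\<dots> \<le> (\<Sum>b\<in>hbasis G. c b) * N z powr (1 - real Q)"
        using c(1) by (intro mult_right_mono member_le_sum that(1) finite_hbasis) auto
      finally show ?thesis using W by (simp add: C_def field_simps)
    qed
    fix \<phi> :: "'a \<Rightarrow> real" and D x assume C1: "C1c \<phi> D"
    have [measurable]: "lie_D D b \<in> borel_measurable borel" for b
      by (rule borel_measurable_continuous_onI[OF csupp_cont[OF csupp_lie_D[OF C1]]])
    have "(\<integral>z. dilation_kernel (\<omega> b) z * lie_D D b (mult G x z) \<partial>lborel) = W * (\<integral>z. dilation_kernel (\<omega> b) (mult G (- x) z) / W * lie_D D b z \<partial>lborel)" for b
      using integral_left_translation[of "\<lambda>z. dilation_kernel (\<omega> b) (mult G (- x) z) * lie_D D b z" x] W by simp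
    moreover have "\<phi> x * W = - (\<Sum>b\<in>hbasis G. \<integral>z. dilation_kernel (\<omega> b) z * lie_D D b (mult G x z) \<partial>lborel)"
      unfolding W_def by (rule representation_aux[OF Q \<omega> _ C1], assumption) (rule eu; blast)
    ultimately have "\<phi> x * W = - (\<Sum>b\<in>hbasis G. W * (\<integral>z. dilation_kernel (\<omega> b) (mult G (- x) z) / W * lie_D D b z \<partial>lborel))"
      by simp
    then have eq: "\<phi> x * W = (- (\<Sum>b\<in>hbasis G. \<integral>z. dilation_kernel (\<omega> b) (mult G (- x) z) / W * lie_D D b z \<partial>lborel)) * W"
      by (simp add: sum_distrib_left mult.commute)
    have "W \<noteq> 0" using W by simp
    from mult_right_cancel[THEN iffD1, OF this eq]
    show "\<phi> x = - (\<Sum>b\<in>hbasis G. \<integral>z. dilation_kernel (\<omega> b) (mult G (- x) z) / W * lie_D D b z \<partial>lborel)" .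
  qed
qed

end

section \<open>Solving the divergence equation\<close>

lemma integral_lebesgue_on_borel:
  fixes h :: "'a::euclidean_space \<Rightarrow> real"
  assumes [measurable]: "B \<in> sets borel" "h \<in> borel_measurable borel"
  shows "(\<integral>x. h x \<partial>lebesgue_on B) = (\<integral>x. indicator B x * h x \<partial>lborel)"
    and "integrable (lebesgue_on B) h \<longleftrightarrow> integrable lborel (\<lambda>x. indicator B x * h x)"
proof -
  have B: "B \<inter> space lebesgue \<in> sets lebesgue" by simp
  have m: "(\<lambda>x. indicator B x * h x) \<in> borel_measurable lborel" by measurable
  show "(\<integral>x. h x \<partial>lebesgue_on B) = (\<integral>x. indicator B x * h x \<partial>lborel)"
    using integral_restrict_space[OF B, of h] integral_completion[OF m] by simp
  show "integrable (lebesgue_on B) h \<longleftrightarrow> integrable lborel (\<lambda>x. indicator B x * h x)"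
    using integrable_restrict_space[OF B, of h] integrable_completion[OF m] by simp
qed

text \<open>Convolutions and iterated integrals are formed with Borel functions on the whole space,
  while \<open>f\<close> is Lebesgue measurable on \<open>B\<close>. The representative vanishes off
  \<open>B\<close> and keeps the norm and all pairings.\<close>

lemma in_Lp_borel_representative:
  fixes f :: "'a::euclidean_space \<Rightarrow> real"
  assumes B [measurable]: "B \<in> sets borel" and f: "in_Lp p B f"
  obtains g where "g \<in> borel_measurable borel" "\<And>x. x \<notin> B \<Longrightarrow> g x = 0"
    "(\<integral>\<^sup>+x. ennreal (\<bar>g x\<bar> powr p) \<partial>lborel) = ennreal (\<integral>x. \<bar>f x\<bar> powr p \<partial>lebesgue_on B)"
    "\<And>\<phi>. \<phi> \<in> borel_measurable borel \<Longrightarrow> (\<integral>x. f x * \<phi> x \<partial>lebesgue_on B) = (\<integral>x. g x * \<phi> x \<partial>lborel)"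
proof -
  have Bs: "B \<inter> space lebesgue \<in> sets lebesgue" by simp
  have "(\<lambda>x. indicator B x *\<^sub>R f x) \<in> borel_measurable lebesgue"
    using f borel_measurable_restrict_space_iff[OF Bs, of f] by (simp add: in_Lp_def)
  from completion_ex_borel_measurable_real[OF this] obtain g0 where
    g0 [measurable]: "g0 \<in> borel_measurable lborel" and ae: "AE x in lborel. indicator B x *\<^sub>R f x = g0 x" by blast
  define g where "g = (\<lambda>x. indicator B x * g0 x)"
  have g [measurable]: "g \<in> borel_measurable borel" unfolding g_def by measurable
  have f' [measurable]: "f \<in> borel_measurable (lebesgue_on B)" using f by (simp add: in_Lp_def)
  have "AE x in lborel. x \<in> B \<longrightarrow> f x = g x"
    using ae by eventually_elim (auto simp: g_def indicator_def split: if_splits)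
  then have "AE x in lebesgue. x \<in> B \<longrightarrow> f x = g x" by (rule AE_completion)
  then have fg: "AE x in lebesgue_on B. f x = g x"
    using AE_restrict_space_iff[OF Bs] by simp
  have bm: "h \<in> borel_measurable (lebesgue_on B)" if "h \<in> borel_measurable borel" for h :: "'a \<Rightarrow> real"
    using that by (intro measurable_restrict_space1 measurable_completion) simp
  note [measurable] = bm[OF g]
  have gB: "indicator B x * (\<bar>g x\<bar> powr p) = \<bar>g x\<bar> powr p" "indicator B x * (g x * c) = g x * c" for x c
    by (auto simp: g_def indicator_def)
  have gp: "integrable (lebesgue_on B) (\<lambda>x. \<bar>f x\<bar> powr p) \<longleftrightarrow> integrable (lebesgue_on B) (\<lambda>x. \<bar>g x\<bar> powr p)"
    by (rule integrable_cong_AE) (use fg in auto)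
  then have ig: "integrable lborel (\<lambda>x. \<bar>g x\<bar> powr p)"
    using f integral_lebesgue_on_borel(2)[OF B, of "\<lambda>x. \<bar>g x\<bar> powr p"] by (simp add: in_Lp_def gB)
  have "(\<integral>x. \<bar>f x\<bar> powr p \<partial>lebesgue_on B) = (\<integral>x. \<bar>g x\<bar> powr p \<partial>lebesgue_on B)"
    by (rule integral_cong_AE) (use fg in auto)
  also have "\<dots> = (\<integral>x. \<bar>g x\<bar> powr p \<partial>lborel)"
    using integral_lebesgue_on_borel(1)[OF B, of "\<lambda>x. \<bar>g x\<bar> powr p"] by (simp add: gB)
  finally have 1: "(\<integral>\<^sup>+x. ennreal (\<bar>g x\<bar> powr p) \<partial>lborel) = ennreal (\<integral>x. \<bar>f x\<bar> powr p \<partial>lebesgue_on B)"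
    using nn_integral_eq_integral[OF ig] by simp
  have 2: "(\<integral>x. f x * \<phi> x \<partial>lebesgue_on B) = (\<integral>x. g x * \<phi> x \<partial>lborel)" if [measurable]: "\<phi> \<in> borel_measurable borel" for \<phi>
  proof -
    have "(\<integral>x. f x * \<phi> x \<partial>lebesgue_on B) = (\<integral>x. g x * \<phi> x \<partial>lebesgue_on B)"
    proof (rule integral_cong_AE)
      show "AE x in lebesgue_on B. f x * \<phi> x = g x * \<phi> x" using fg by eventually_elim simp
    qed (intro borel_measurable_times f' bm g that)+
    then show ?thesis
      using integral_lebesgue_on_borel(1)[OF B, of "\<lambda>x. g x * \<phi> x"] by (simp add: gB)
  qed
  show thesis by (rule that[OF g _ 1 2]) (auto simp: g_def)
qed

text \<open>A point outside \<open>U\<close> has a neighbourhood that misses the closed support, so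
  the derivative vanishes there.\<close>

lemma test_function_C1c:
  assumes \<phi>: "test_function U \<phi>"
  obtains D where "C1c \<phi> D" "\<And>x v. x \<notin> U \<Longrightarrow> D x v = 0"
proof -
  have "C_k (Suc 0) \<phi>" and comp: "compact (closure {x. \<phi> x \<noteq> 0})" and sub: "closure {x. \<phi> x \<noteq> 0} \<subseteq> U"
    using \<phi> unfolding test_function_def by blast+
  then obtain D where D: "\<And>x. (\<phi> has_derivative D x) (at x)" "\<And>v. continuous_on UNIV (\<lambda>x. D x v)"
    by auto
  obtain R where "\<And>x. x \<in> closure {x. \<phi> x \<noteq> 0} \<Longrightarrow> norm x \<le> R"
    using compact_imp_bounded[OF comp] bounded_iff by blast
  then have "\<phi> x = 0" if "R < norm x" for x using closure_subset[of "{x. \<phi> x \<noteq> 0}"] that by fastforce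
  then have C: "C1c \<phi> D" using D by (auto simp: C1c_def)
  have "D x v = 0" if "x \<notin> U" for x v
  proof -
    have "((\<lambda>x. 0) has_derivative D x) (at x)"
      by (rule has_derivative_transform_within_open[OF D(1), of "- closure {x. \<phi> x \<noteq> 0}"])
        (use that sub closure_subset[of "{x. \<phi> x \<noteq> 0}"] in auto)
    from has_derivative_unique[OF this has_derivative_const] show ?thesis by simp
  qed
  with C show thesis using that by blast
qed

section \<open>Bounds of the fractional integral on a set of finite measure, and the field\<close>

context carnot_norm
begin

text \<open>\<open>C\<close> bounds the integral of the \<open>q\<close>-th power, not the norm, for
  \<open>h\<close> normalised in the \<open>p\<close>-norm. In this form the endpoint, smaller
  exponents and \<open>p = 1\<close> all feed the same construction of the field.\<close>

definition riesz_bound :: "real \<Rightarrow> real \<Rightarrow> 'a set \<Rightarrow> real \<Rightarrow> bool" where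
  "riesz_bound p q B C \<longleftrightarrow> (\<forall>h. h \<in> borel_measurable borel \<longrightarrow> (\<forall>x. 0 \<le> h x) \<longrightarrow>
     (\<integral>\<^sup>+x. ennreal (h x powr p) \<partial>lborel) \<le> 1 \<longrightarrow>
     (\<integral>\<^sup>+z. ennreal (enn2real (riesz h z) powr q) * indicator B z \<partial>lborel) \<le> ennreal C)"

lemma riesz_bound_endpoint:
  assumes "1 < p" "p < real Q"
  obtains C where "\<And>B. riesz_bound p (p * real Q / (real Q - p)) B C"
proof -
  obtain C where C: "\<And>f. f \<in> borel_measurable borel \<Longrightarrow> (\<And>x. 0 \<le> f x) \<Longrightarrow>
    (\<integral>\<^sup>+x. ennreal (f x powr p) \<partial>lborel) \<le> 1 \<Longrightarrow>
    (\<integral>\<^sup>+z. ennreal (enn2real (riesz f z) powr (p * real Q / (real Q - p))) \<partial>lborel) \<le> ennreal C"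
    using hls[OF assms] by blast
  have "riesz_bound p (p * real Q / (real Q - p)) B C" for B
    unfolding riesz_bound_def
  proof (intro allI impI)
    fix h :: "'a \<Rightarrow> real" assume h: "h \<in> borel_measurable borel" "\<forall>x. 0 \<le> h x" "(\<integral>\<^sup>+x. ennreal (h x powr p) \<partial>lborel) \<le> 1"
    have "(\<integral>\<^sup>+z. ennreal (enn2real (riesz h z) powr (p * real Q / (real Q - p))) * indicator B z \<partial>lborel) \<le>
      (\<integral>\<^sup>+z. ennreal (enn2real (riesz h z) powr (p * real Q / (real Q - p))) \<partial>lborel)"
      by (intro nn_integral_mono) (auto simp: indicator_def)
    also have "\<dots> \<le> ennreal C" using h by (intro C) auto
    finally show "(\<integral>\<^sup>+z. ennreal (enn2real (riesz h z) powr (p * real Q / (real Q - p))) * indicator B z \<partial>lborel) \<le> ennreal C" .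
  qed
  then show thesis by (rule that)
qed

text \<open>On a set of finite measure \<open>t powr q \<le> 1 + t powr q'\<close> is enough.
  \<open>ennreal\<close> hides the sign of \<open>C\<close>, hence \<open>max 0 C\<close> in the
  sum.\<close>

lemma riesz_bound_subcritical:
  assumes B [measurable]: "B \<in> sets borel" and fin: "emeasure lborel B < \<infinity>"
    and C: "riesz_bound p q' B C" and q: "0 < q" "q \<le> q'"
  shows "riesz_bound p q B (measure lborel B + max 0 C)"
  unfolding riesz_bound_def
proof (intro allI impI)
  fix h :: "'a \<Rightarrow> real" assume h [measurable]: "h \<in> borel_measurable borel" and h': "\<forall>x. 0 \<le> h x" "(\<integral>\<^sup>+x. ennreal (h x powr p) \<partial>lborel) \<le> 1"
  have "(\<integral>\<^sup>+z. ennreal (enn2real (riesz h z) powr q) * indicator B z \<partial>lborel) \<le>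
    (\<integral>\<^sup>+z. indicator B z + ennreal (enn2real (riesz h z) powr q') * indicator B z \<partial>lborel)"
  proof (rule nn_integral_mono)
    fix z
    have "t powr q \<le> 1 + t powr q'" if "0 \<le> t" for t :: real
    proof (cases "t \<le> 1")
      case True
      then show ?thesis using powr_mono2[of q t 1] q that by (simp add: add_increasing2)
    next
      case False
      then have "t powr q \<le> t powr q'" by (intro powr_mono q(2)) simp
      then show ?thesis by simp
    qed
    then have "ennreal (enn2real (riesz h z) powr q) \<le> ennreal (1 + enn2real (riesz h z) powr q')"
      by (intro ennreal_leI) simp
    then show "ennreal (enn2real (riesz h z) powr q) * indicator B z \<le> indicator B z + ennreal (enn2real (riesz h z) powr q') * indicator B z"
      by (cases "z \<in> B") (simp_all add: ennreal_plus)
  qed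
  also have "\<dots> = emeasure lborel B + (\<integral>\<^sup>+z. ennreal (enn2real (riesz h z) powr q') * indicator B z \<partial>lborel)"
    by (subst nn_integral_add) auto
  also have "\<dots> \<le> ennreal (measure lborel B) + ennreal (max 0 C)"
  proof (rule add_mono)
    show "emeasure lborel B \<le> ennreal (measure lborel B)"
      using fin by (simp add: emeasure_eq_ennreal_measure)
    have "(\<integral>\<^sup>+z. ennreal (enn2real (riesz h z) powr q') * indicator B z \<partial>lborel) \<le> ennreal C"
      using C h h' unfolding riesz_bound_def by blast
    also have "\<dots> \<le> ennreal (max 0 C)" by (intro ennreal_leI) simp
    finally show "(\<integral>\<^sup>+z. ennreal (enn2real (riesz h z) powr q') * indicator B z \<partial>lborel) \<le> ennreal (max 0 C)" .
  qed
  finally show "(\<integral>\<^sup>+z. ennreal (enn2real (riesz h z) powr q) * indicator B z \<partial>lborel) \<le> ennreal (measure lborel B + max 0 C)"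
    by simp
qed

text \<open>Jensen's inequality for the measure with density \<open>h\<close>, of mass at most 1.
  Young's inequality with the weight \<open>m powr (q - 1)\<close>, where \<open>m\<close> is the
  value of the integral, leaves a multiple of \<open>m powr q\<close> that is absorbed on the left.
  An infinite integral makes the left side 0, by the convention of \<open>enn2real\<close>.\<close>

lemma riesz_jensen:
  assumes [measurable]: "h \<in> borel_measurable borel" and h: "\<And>x. 0 \<le> h x" "(\<integral>\<^sup>+x. ennreal (h x) \<partial>lborel) \<le> 1"
    and q: "1 \<le> q"
  shows "ennreal (enn2real (riesz h z) powr q) \<le> (\<integral>\<^sup>+x. ennreal (h x * riesz_kernel x z powr q) \<partial>lborel)"
proof (cases "q = 1 \<or> riesz h z = \<infinity> \<or> riesz h z = 0")
  case True
  moreover have "ennreal (enn2real (riesz h z)) \<le> riesz h z" by (cases "riesz h z") auto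
  ultimately show ?thesis using q by (auto simp: riesz_def)
next
  case False
  then obtain m where m: "riesz h z = ennreal m" "0 < m"
    by (cases "riesz h z") (auto simp: order_less_le)
  have q1: "1 < q" using False q by simp
  let ?X = "\<integral>\<^sup>+x. ennreal (h x * riesz_kernel x z powr q) \<partial>lborel"
  show ?thesis
  proof (cases "?X = \<infinity>")
    case fin: False
    then obtain X where X: "?X = ennreal X" "0 \<le> X" by (cases ?X) auto
    define q' where "q' = q / (q - 1)"
    have q': "1 < q'" "1 / q + 1 / q' = 1" "(q - 1) * q' = q" using q1 by (auto simp: q'_def field_simps)
    have "ennreal (m powr (q - 1)) * ennreal (h x * riesz_kernel x z) \<le> ennreal (1 / q) * ennreal (h x * riesz_kernel x z powr q) + ennreal (m powr q / q') * ennreal (h x)" for x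
    proof -
      have "riesz_kernel x z * m powr (q - 1) \<le> riesz_kernel x z powr q / q + (m powr (q - 1)) powr q' / q'"
        by (rule Youngs_inequality[OF q1 q'(1,2)]) auto
      also have "(m powr (q - 1)) powr q' = m powr q" by (simp add: powr_powr q'(3))
      finally have "h x * (riesz_kernel x z * m powr (q - 1)) \<le> h x * (riesz_kernel x z powr q / q + m powr q / q')"
        by (rule mult_left_mono[OF _ h(1)])
      then have "m powr (q - 1) * (h x * riesz_kernel x z) \<le> 1 / q * (h x * riesz_kernel x z powr q) + m powr q / q' * h x"
        by (simp add: algebra_simps)
      then have "ennreal (m powr (q - 1) * (h x * riesz_kernel x z)) \<le> ennreal (1 / q * (h x * riesz_kernel x z powr q) + m powr q / q' * h x)"
        by (rule ennreal_leI)
      also have "\<dots> = ennreal (1 / q * (h x * riesz_kernel x z powr q)) + ennreal (m powr q / q' * h x)"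
        using h(1)[of x] q1 q'(1) by (intro ennreal_plus) auto
      finally show ?thesis
        using h(1)[of x] q1 q'(1) by (simp only: ennreal_mult'[symmetric] powr_ge_zero divide_nonneg_pos zero_le_one less_trans[OF zero_less_one] mult_nonneg_nonneg)
    qed
    then have "(\<integral>\<^sup>+x. ennreal (m powr (q - 1)) * ennreal (h x * riesz_kernel x z) \<partial>lborel) \<le>
       (\<integral>\<^sup>+x. ennreal (1 / q) * ennreal (h x * riesz_kernel x z powr q) + ennreal (m powr q / q') * ennreal (h x) \<partial>lborel)"
      by (rule nn_integral_mono)
    also have "\<dots> = ennreal (1 / q) * ?X + ennreal (m powr q / q') * (\<integral>\<^sup>+x. ennreal (h x) \<partial>lborel)"
      by (subst nn_integral_add) (auto simp: nn_integral_cmult)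
    also have "\<dots> \<le> ennreal (1 / q) * ennreal X + ennreal (m powr q / q') * 1"
      unfolding X(1) by (intro add_mono mult_left_mono h(2)) auto
    also have "\<dots> = ennreal (X / q + m powr q / q')"
      using X(2) q1 q'(1) by (simp add: ennreal_mult'[symmetric] ennreal_plus[symmetric] del: ennreal_plus)
    also have "(\<integral>\<^sup>+x. ennreal (m powr (q - 1)) * ennreal (h x * riesz_kernel x z) \<partial>lborel) = ennreal (m powr (q - 1)) * riesz h z"
      unfolding riesz_def by (rule nn_integral_cmult) measurable
    also have "\<dots> = ennreal (m powr q)"
      using m(2) by (simp add: m(1) ennreal_mult'[symmetric] powr_diff)
    finally have "m powr q \<le> X / q + m powr q / q'"
      using X(2) q1 q'(1) by (subst (asm) ennreal_le_iff) auto
    moreover have "m powr q / q' = m powr q * (1 - 1 / q)"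
    proof -
      have "1 / q' = 1 - 1 / q" using q'(2) by simp
      then show ?thesis by (metis times_divide_eq_right mult.right_neutral)
    qed
    ultimately have "m powr q / q \<le> X / q" by (simp add: algebra_simps)
    then have "m powr q \<le> X" using q1 by (simp add: divide_le_cancel)
    then show ?thesis using m X by (simp add: ennreal_leI)
  qed simp
qed

text \<open>Jensen's inequality leaves the integral over \<open>B\<close> of the \<open>q\<close>-th
  power of the kernel. It is bounded uniformly in \<open>x\<close>: near \<open>x\<close> because
  \<open>q * (Q - 1) < Q\<close>, elsewhere because the kernel is at most 1.\<close>

lemma riesz_bound_1:
  assumes B [measurable]: "B \<in> sets borel" and fin: "emeasure lborel B < \<infinity>"
    and q: "1 \<le> q" "q * (real Q - 1) < real Q" and Q: "1 < Q"
  obtains C where "riesz_bound 1 q B C"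
proof -
  let ?\<beta> = "(1 - real Q) * q"
  let ?X = "\<integral>\<^sup>+y. ennreal (N y powr ?\<beta>) * indicator {y. N y < 1} y \<partial>lborel"
  have "?\<beta> < 0" using q Q by (simp add: mult_neg_pos)
  have "?X < \<infinity>" by (rule radial_inner_finite[OF \<open>?\<beta> < 0\<close>]) (use q in \<open>simp add: algebra_simps\<close>)
  then have "?X + emeasure lborel B < \<infinity>" using fin by simp
  then obtain C where C: "?X + emeasure lborel B = ennreal C" by (cases "?X + emeasure lborel B") auto
  have k: "(\<integral>\<^sup>+z. ennreal (riesz_kernel x z powr q) * indicator B z \<partial>lborel) \<le> ennreal C" for x
  proof -
    let ?h = "\<lambda>n. ennreal (n powr ?\<beta>) * indicator {..<1} n"
    have "(\<integral>\<^sup>+z. ennreal (riesz_kernel x z powr q) * indicator B z \<partial>lborel) \<le> (\<integral>\<^sup>+z. ?h (N (mult G (- x) z)) + indicator B z \<partial>lborel)"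
    proof (rule nn_integral_mono)
      fix z
      have e: "riesz_kernel x z powr q = N (mult G (- x) z) powr ?\<beta>" by (simp add: riesz_kernel_def powr_powr)
      show "ennreal (riesz_kernel x z powr q) * indicator B z \<le> ?h (N (mult G (- x) z)) + indicator B z"
      proof (cases "N (mult G (- x) z) < 1")
        case True
        then show ?thesis by (cases "z \<in> B") (auto simp: e add_increasing2)
      next
        case False
        then have "N (mult G (- x) z) powr ?\<beta> \<le> 1" using powr_mono2'[of ?\<beta> 1 "N (mult G (- x) z)"] \<open>?\<beta> < 0\<close> by simp
        then show ?thesis using False by (cases "z \<in> B") (auto simp: e)
      qed
    qed
    also have "\<dots> = (\<integral>\<^sup>+z. ?h (N (mult G (- x) z)) \<partial>lborel) + emeasure lborel B"
      by (subst nn_integral_add) auto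
    also have "(\<integral>\<^sup>+z. ?h (N (mult G (- x) z)) \<partial>lborel) = (\<integral>\<^sup>+y. ?h (N y) \<partial>lborel)"
      by (rule nn_integral_N_right) measurable
    also have "\<dots> = ?X" by (intro nn_integral_cong) (auto simp: indicator_def)
    finally show ?thesis by (simp only: C)
  qed
  have "riesz_bound 1 q B C"
    unfolding riesz_bound_def
  proof (intro allI impI)
    fix h :: "'a \<Rightarrow> real" assume h [measurable]: "h \<in> borel_measurable borel" and h': "\<forall>x. 0 \<le> h x" "(\<integral>\<^sup>+x. ennreal (h x powr 1) \<partial>lborel) \<le> 1"
    then have h1: "(\<integral>\<^sup>+x. ennreal (h x) \<partial>lborel) \<le> 1" by simp
    have "(\<integral>\<^sup>+z. ennreal (enn2real (riesz h z) powr q) * indicator B z \<partial>lborel) \<le>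
      (\<integral>\<^sup>+z. (\<integral>\<^sup>+x. ennreal (h x * riesz_kernel x z powr q) \<partial>lborel) * indicator B z \<partial>lborel)"
      using h' by (intro nn_integral_mono mult_right_mono riesz_jensen h h1 q) auto
    also have "\<dots> = (\<integral>\<^sup>+z. \<integral>\<^sup>+x. ennreal (h x) * (ennreal (riesz_kernel x z powr q) * indicator B z) \<partial>lborel \<partial>lborel)"
      using h' by (intro nn_integral_cong) (simp add: nn_integral_multc[symmetric] ennreal_mult mult.assoc)
    also have "\<dots> = (\<integral>\<^sup>+x. \<integral>\<^sup>+z. ennreal (h x) * (ennreal (riesz_kernel x z powr q) * indicator B z) \<partial>lborel \<partial>lborel)"
      by (rule lborel_pair.Fubini') measurable
    also have "\<dots> = (\<integral>\<^sup>+x. ennreal (h x) * (\<integral>\<^sup>+z. ennreal (riesz_kernel x z powr q) * indicator B z \<partial>lborel) \<partial>lborel)"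
      by (intro nn_integral_cong nn_integral_cmult) measurable
    also have "\<dots> \<le> (\<integral>\<^sup>+x. ennreal (h x) * ennreal C \<partial>lborel)"
      by (intro nn_integral_mono mult_left_mono k) auto
    also have "\<dots> = (\<integral>\<^sup>+x. ennreal (h x) \<partial>lborel) * ennreal C"
      by (rule nn_integral_multc) measurable
    also have "\<dots> \<le> 1 * ennreal C" by (intro mult_right_mono h1) auto
    finally show "(\<integral>\<^sup>+z. ennreal (enn2real (riesz h z) powr q) * indicator B z \<partial>lborel) \<le> ennreal C" by simp
  qed
  then show thesis by (rule that)
qed

text \<open>Homogeneity extends the bound beyond normalised functions. For \<open>I = 0\<close> one
  cannot normalise, but then \<open>g\<close> vanishes almost everywhere.\<close>

lemma riesz_bound_scaled:
  assumes b: "riesz_bound p q B C" and B [measurable]: "B \<in> sets borel" and g [measurable]: "g \<in> borel_measurable borel"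
    and I: "(\<integral>\<^sup>+x. ennreal (\<bar>g x\<bar> powr p) \<partial>lborel) = ennreal I" "0 \<le> I" and p: "0 < p" and q: "0 < q"
  shows "(\<integral>\<^sup>+z. ennreal (enn2real (riesz (\<lambda>x. \<bar>g x\<bar>) z) powr q) * indicator B z \<partial>lborel) \<le> ennreal (C * (I powr (1 / p)) powr q)"
proof (cases "I = 0")
  case True
  then have "(\<integral>\<^sup>+x. ennreal (\<bar>g x\<bar> powr p) \<partial>lborel) = 0" using I(1) by simp
  then have "AE x in lborel. ennreal (\<bar>g x\<bar> powr p) = 0"
    by (subst (asm) nn_integral_0_iff_AE) auto
  then have "AE x in lborel. g x = 0" by eventually_elim auto
  then have "riesz (\<lambda>x. \<bar>g x\<bar>) z = 0" for z
    unfolding riesz_def by (subst nn_integral_0_iff_AE) (auto elim: eventually_mono)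
  then show ?thesis using q by simp
next
  case False
  define A where "A = I powr (1 / p)"
  have A: "0 < A" using False I(2) by (simp add: A_def)
  have Ap: "A powr p = I" using I(2) p False by (simp add: A_def powr_powr)
  let ?h = "\<lambda>x. \<bar>g x\<bar> / A"
  have "(\<integral>\<^sup>+x. ennreal (?h x powr p) \<partial>lborel) = (\<integral>\<^sup>+x. ennreal (1 / I) * ennreal (\<bar>g x\<bar> powr p) \<partial>lborel)"
    using A I(2) Ap by (intro nn_integral_cong) (simp add: powr_divide ennreal_mult'[symmetric])
  also have "\<dots> = ennreal (1 / I) * ennreal I"
    using I(1) by (subst nn_integral_cmult) auto
  also have "\<dots> = 1" using False I(2) by (simp add: ennreal_mult'[symmetric])
  finally have h1: "(\<integral>\<^sup>+x. ennreal (?h x powr p) \<partial>lborel) \<le> 1" by simp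
  have rh: "riesz ?h z = ennreal (1 / A) * riesz (\<lambda>x. \<bar>g x\<bar>) z" for z
  proof -
    have "riesz ?h z = (\<integral>\<^sup>+x. ennreal (1 / A) * ennreal (\<bar>g x\<bar> * riesz_kernel x z) \<partial>lborel)"
      unfolding riesz_def using A by (intro nn_integral_cong) (simp add: ennreal_mult'[symmetric])
    also have "\<dots> = ennreal (1 / A) * riesz (\<lambda>x. \<bar>g x\<bar>) z"
      unfolding riesz_def by (rule nn_integral_cmult) measurable
    finally show ?thesis .
  qed
  have e: "enn2real (riesz (\<lambda>x. \<bar>g x\<bar>) z) powr q = A powr q * enn2real (riesz ?h z) powr q" for z
    using A by (simp add: rh enn2real_mult powr_mult powr_divide)
  have "(\<integral>\<^sup>+z. ennreal (enn2real (riesz (\<lambda>x. \<bar>g x\<bar>) z) powr q) * indicator B z \<partial>lborel) =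
     (\<integral>\<^sup>+z. ennreal (A powr q) * (ennreal (enn2real (riesz ?h z) powr q) * indicator B z) \<partial>lborel)"
    unfolding e by (simp add: ennreal_mult mult.assoc)
  also have "\<dots> = ennreal (A powr q) * (\<integral>\<^sup>+z. ennreal (enn2real (riesz ?h z) powr q) * indicator B z \<partial>lborel)"
    by (rule nn_integral_cmult) measurable
  also have "\<dots> \<le> ennreal (A powr q) * ennreal C"
    using b h1 A unfolding riesz_bound_def by (intro mult_left_mono) auto
  also have "\<dots> = ennreal (C * A powr q)"
    by (simp add: ennreal_mult'' mult.commute)
  finally show ?thesis by (simp add: A_def)
qed

lemma hom_ball_borel [measurable]: "hom_ball G N x r \<in> sets borel"
  unfolding hom_ball_def hom_dist_def by measurable

lemma compact_hom_cball: "compact {y. N (mult G (- x) y) \<le> r}"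
proof -
  have "{y. N (mult G (- x) y) \<le> r} = mult G x ` {y. N y \<le> r}"
  proof (intro equalityI subsetI)
    fix y assume "y \<in> {y. N (mult G (- x) y) \<le> r}"
    then show "y \<in> mult G x ` {y. N y \<le> r}" by (intro image_eqI[of _ _ "mult G (- x) y"]) auto
  qed auto
  then show ?thesis by (simp add: compact_continuous_image compact_N_le continuous_intros)
qed

lemma emeasure_hom_ball_finite: "emeasure lborel (hom_ball G N x r) < \<infinity>"
proof (rule le_less_trans[OF emeasure_mono])
  show "hom_ball G N x r \<subseteq> {y. N (mult G (- x) y) \<le> r}" by (auto simp: hom_ball_def hom_dist_def)
  show "emeasure lborel {y. N (mult G (- x) y) \<le> r} < \<infinity>" by (rule emeasure_compact_finite[OF compact_hom_cball])
qed measurable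

text \<open>The kernel is integrable over \<open>B\<close> uniformly in \<open>x\<close>, and
  \<open>g\<close> is integrable because it vanishes off \<open>B\<close>. The integral defining the
  field then converges almost everywhere on \<open>B\<close>, and Fubini is available against test
  functions.\<close>

lemma riesz_integrable_on:
  assumes B [measurable]: "B \<in> sets borel" and fin: "emeasure lborel B < \<infinity>" and Q: "1 < Q" and p: "1 \<le> p"
    and g [measurable]: "g \<in> borel_measurable borel" and gB: "\<And>x. x \<notin> B \<Longrightarrow> g x = 0"
    and I: "(\<integral>\<^sup>+x. ennreal (\<bar>g x\<bar> powr p) \<partial>lborel) < \<infinity>"
  shows "(\<integral>\<^sup>+z. riesz (\<lambda>x. \<bar>g x\<bar>) z * indicator B z \<partial>lborel) < \<infinity>"
proof -
  have k: "(\<integral>\<^sup>+z. ennreal (riesz_kernel x z) * indicator B z \<partial>lborel) \<le> ennreal kernel_mass + emeasure lborel B" for x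
  proof -
    have "(\<integral>\<^sup>+z. ennreal (riesz_kernel x z) * indicator B z \<partial>lborel) \<le> (\<integral>\<^sup>+z. ennreal (riesz_kernel x z) * indicator {z. N (mult G (- x) z) < 1} z + indicator B z \<partial>lborel)"
    proof (rule nn_integral_mono)
      fix z
      show "ennreal (riesz_kernel x z) * indicator B z \<le> ennreal (riesz_kernel x z) * indicator {z. N (mult G (- x) z) < 1} z + indicator B z"
      proof (cases "N (mult G (- x) z) < 1")
        case True
        then show ?thesis by (cases "z \<in> B") (auto simp: add_increasing2)
      next
        case False
        then have "riesz_kernel x z \<le> 1" using powr_mono2'[of "1 - real Q" 1 "N (mult G (- x) z)"] Q by (simp add: riesz_kernel_def)
        then show ?thesis using False by (cases "z \<in> B") auto
      qed
    qed
    also have "\<dots> = (\<integral>\<^sup>+z. ennreal (riesz_kernel x z) * indicator {z. N (mult G (- x) z) < 1} z \<partial>lborel) + emeasure lborel B"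
      by (subst nn_integral_add) auto
    also have "\<dots> \<le> ennreal kernel_mass + emeasure lborel B"
      using riesz_kernel_inner(2)[OF Q zero_less_one, of x] by (intro add_right_mono) simp
    finally show ?thesis .
  qed
  have "(\<integral>\<^sup>+x. ennreal \<bar>g x\<bar> \<partial>lborel) \<le> (\<integral>\<^sup>+x. indicator B x + ennreal (\<bar>g x\<bar> powr p) \<partial>lborel)"
  proof (rule nn_integral_mono)
    fix x
    have "\<bar>g x\<bar> \<le> 1 + \<bar>g x\<bar> powr p"
    proof (cases "\<bar>g x\<bar> \<le> 1")
      case False
      then show ?thesis using powr_mono[OF p, of "\<bar>g x\<bar>"] by simp
    qed (simp add: add_increasing2)
    then have "ennreal \<bar>g x\<bar> \<le> ennreal (1 + \<bar>g x\<bar> powr p)" by (rule ennreal_leI)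
    then show "ennreal \<bar>g x\<bar> \<le> indicator B x + ennreal (\<bar>g x\<bar> powr p)"
      using gB[of x] by (cases "x \<in> B") (auto simp: ennreal_plus)
  qed
  also have "\<dots> < \<infinity>" using I fin by (subst nn_integral_add) auto
  finally have g1: "(\<integral>\<^sup>+x. ennreal \<bar>g x\<bar> \<partial>lborel) < \<infinity>" .
  have "(\<integral>\<^sup>+z. riesz (\<lambda>x. \<bar>g x\<bar>) z * indicator B z \<partial>lborel) = (\<integral>\<^sup>+z. \<integral>\<^sup>+x. ennreal \<bar>g x\<bar> * (ennreal (riesz_kernel x z) * indicator B z) \<partial>lborel \<partial>lborel)"
    unfolding riesz_def by (intro nn_integral_cong) (simp add: nn_integral_multc[symmetric] ennreal_mult mult.assoc)
  also have "\<dots> = (\<integral>\<^sup>+x. \<integral>\<^sup>+z. ennreal \<bar>g x\<bar> * (ennreal (riesz_kernel x z) * indicator B z) \<partial>lborel \<partial>lborel)"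
    by (rule lborel_pair.Fubini') measurable
  also have "\<dots> = (\<integral>\<^sup>+x. ennreal \<bar>g x\<bar> * (\<integral>\<^sup>+z. ennreal (riesz_kernel x z) * indicator B z \<partial>lborel) \<partial>lborel)"
    by (intro nn_integral_cong nn_integral_cmult) measurable
  also have "\<dots> \<le> (\<integral>\<^sup>+x. ennreal \<bar>g x\<bar> * (ennreal kernel_mass + emeasure lborel B) \<partial>lborel)"
    by (intro nn_integral_mono mult_left_mono k) auto
  also have "\<dots> = (\<integral>\<^sup>+x. ennreal \<bar>g x\<bar> \<partial>lborel) * (ennreal kernel_mass + emeasure lborel B)"
    by (rule nn_integral_multc) measurable
  also have "\<dots> < \<infinity>" using g1 fin by (simp add: ennreal_mult_less_top)
  finally show ?thesis .
qed

text \<open>The representation formula of a test function, integrated against \<open>f\<close> with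
  the order of integration exchanged, is the weak divergence equation. \<open>C\<close> is fixed
  before \<open>x\<close>, \<open>r\<close>, \<open>l\<close> and \<open>f\<close>, so the ball
  enters the constant through \<open>C0\<close> alone.\<close>

lemma horizontal_solution:
  assumes Q: "1 < Q" and p: "1 \<le> p" and q: "1 \<le> q" and C0: "0 \<le> C0"
  obtains C where "\<And>x r l f. 0 < r \<Longrightarrow> 1 < l \<Longrightarrow> riesz_bound p q (hom_ball G N x r) C0 \<Longrightarrow>
    in_Lp p (hom_ball G N x r) f \<Longrightarrow>
    \<exists>F. in_Lp_hor G q (hom_ball G N x (l * r)) F \<and> compactly_supported_in (hom_ball G N x (l * r)) F \<and>
      is_hdiv_in G (hom_ball G N x r) f F \<and>
      Lp_norm_hor G q (hom_ball G N x (l * r)) F \<le> C * Lp_norm p (hom_ball G N x r) f"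
proof -
  obtain K CK where K [measurable]: "\<And>b. K b \<in> borel_measurable borel" and CK: "0 \<le> CK"
    and Kb: "\<And>b z. b \<in> hbasis G \<Longrightarrow> z \<noteq> 0 \<Longrightarrow> \<bar>K b z\<bar> \<le> CK * N z powr (1 - real Q)"
    and rep: "\<And>(\<phi> :: 'a \<Rightarrow> real) D x. C1c \<phi> D \<Longrightarrow> \<phi> x = - (\<Sum>b\<in>hbasis G. \<integral>z. K b (mult G (- x) z) * lie_D D b z \<partial>lborel)"
    using representation[OF Q] by blast
  define n where "n = real (card (hbasis G))"
  \<comment> \<open>\<open>n\<close> comes from bounding a Euclidean norm by the sum of the
    components, \<open>CK\<close> from the kernel and \<open>C0\<close> from
    \<open>riesz_bound\<close>.\<close>
  define C where "C = n * CK * C0 powr (1 / q)"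
  have Krk: "AE x in lborel. \<bar>K b (mult G (- x) z)\<bar> \<le> CK * riesz_kernel x z" if "b \<in> hbasis G" for b z
    using AE_lborel_singleton[of z]
  proof eventually_elim
    fix x assume "x \<noteq> z"
    then have "mult G (- x) z \<noteq> 0" by (metis mult_0_right mult_minus_cancel(2))
    then show "\<bar>K b (mult G (- x) z)\<bar> \<le> CK * riesz_kernel x z" using Kb[OF that] by (simp add: riesz_kernel_def)
  qed
  have main: "\<exists>F. in_Lp_hor G q (hom_ball G N x0 (l * r)) F \<and> compactly_supported_in (hom_ball G N x0 (l * r)) F \<and>
      is_hdiv_in G (hom_ball G N x0 r) f F \<and>
      Lp_norm_hor G q (hom_ball G N x0 (l * r)) F \<le> C * Lp_norm p (hom_ball G N x0 r) f"
    if r: "0 < r" "1 < l" and rb: "riesz_bound p q (hom_ball G N x0 r) C0" and f: "in_Lp p (hom_ball G N x0 r) f"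
    for x0 r l f
  proof -
    define B where "B = hom_ball G N x0 r"
    define B' where "B' = hom_ball G N x0 (l * r)"
    have [measurable]: "B \<in> sets borel" "B' \<in> sets borel" by (simp_all add: B_def B'_def hom_ball_borel)
    have finB: "emeasure lborel B < \<infinity>" unfolding B_def by (rule emeasure_hom_ball_finite)
    define I where "I = (\<integral>x. \<bar>f x\<bar> powr p \<partial>lebesgue_on B)"
    have I0: "0 \<le> I" unfolding I_def by simp
    obtain g where g [measurable]: "g \<in> borel_measurable borel" and gB: "\<And>x. x \<notin> B \<Longrightarrow> g x = 0"
      and gI: "(\<integral>\<^sup>+x. ennreal (\<bar>g x\<bar> powr p) \<partial>lborel) = ennreal I"
      and gf: "\<And>\<phi>. \<phi> \<in> borel_measurable borel \<Longrightarrow> (\<integral>x. f x * \<phi> x \<partial>lebesgue_on B) = (\<integral>x. g x * \<phi> x \<partial>lborel)"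
      using in_Lp_borel_representative[OF \<open>B \<in> sets borel\<close> f[folded B_def]] unfolding I_def by blast
    let ?J = "riesz (\<lambda>x. \<bar>g x\<bar>)"
    define u where "u = (\<lambda>z. enn2real (?J z))"
    have [measurable]: "?J \<in> borel_measurable borel" by (rule riesz_measurable) measurable
    then have [measurable]: "u \<in> borel_measurable borel" unfolding u_def by measurable
    have u0: "0 \<le> u z" for z by (simp add: u_def)
    have Jfin: "(\<integral>\<^sup>+z. ?J z * indicator B z \<partial>lborel) < \<infinity>"
      by (rule riesz_integrable_on[OF _ finB Q p g gB]) (simp_all add: gI)
    \<comment> \<open>Where the majorant is infinite the convolution need not exist, and the field
      is set to 0; in \<open>B\<close> this concerns a null set only.\<close>
    define S where "S = {z\<in>B. ?J z < \<infinity>}"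
    have [measurable]: "S \<in> sets borel" unfolding S_def by measurable
    define Fb where "Fb = (\<lambda>b z. indicator S z * (\<integral>x. g x * K b (mult G (- x) z) \<partial>lborel))"
    define F where "F = (\<lambda>z. \<Sum>b\<in>hbasis G. Fb b z *\<^sub>R b)"
    have [measurable]: "Fb b \<in> borel_measurable borel" for b
    proof -
      have "(\<lambda>z. \<integral>x. g x * K b (mult G (- x) z) \<partial>lborel) \<in> borel_measurable lborel"
        by (rule lborel.borel_measurable_lebesgue_integral) measurable
      then show ?thesis unfolding Fb_def by measurable
    qed
    have Fin: "F z \<bullet> b = Fb b z" if "b \<in> hbasis G" for b z
      using that finite_hbasis unfolding F_def
      by (simp add: hbasis_def inner_sum_left inner_Basis if_distrib sum.delta cong: if_cong)
    have F0: "F z = 0" "Fb b z = 0" if "z \<notin> B" for z b using that by (auto simp: F_def Fb_def S_def)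
    have Fbound: "\<bar>Fb b z\<bar> \<le> CK * u z" if b: "b \<in> hbasis G" for b z
    proof (cases "z \<in> S")
      case True
      have "(\<integral>\<^sup>+x. ennreal (norm (g x * K b (mult G (- x) z))) \<partial>lborel) \<le> (\<integral>\<^sup>+x. ennreal CK * ennreal (\<bar>g x\<bar> * riesz_kernel x z) \<partial>lborel)"
      proof (rule nn_integral_mono_AE, use Krk[OF b, of z] in eventually_elim)
        fix x assume "\<bar>K b (mult G (- x) z)\<bar> \<le> CK * riesz_kernel x z"
        then have "norm (g x * K b (mult G (- x) z)) \<le> CK * (\<bar>g x\<bar> * riesz_kernel x z)"
          using mult_left_mono[of "\<bar>K b (mult G (- x) z)\<bar>" "CK * riesz_kernel x z" "\<bar>g x\<bar>"] by (simp add: abs_mult mult_ac)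
        then show "ennreal (norm (g x * K b (mult G (- x) z))) \<le> ennreal CK * ennreal (\<bar>g x\<bar> * riesz_kernel x z)"
          using CK by (simp add: ennreal_mult'[symmetric] ennreal_leI)
      qed
      also have "\<dots> = ennreal CK * ?J z" unfolding riesz_def by (rule nn_integral_cmult) measurable
      also have "\<dots> = ennreal (CK * u z)"
        using True CK by (simp add: u_def S_def ennreal_mult')
      finally have le: "(\<integral>\<^sup>+x. ennreal (norm (g x * K b (mult G (- x) z))) \<partial>lborel) \<le> ennreal (CK * u z)" .
      have "integrable lborel (\<lambda>x. g x * K b (mult G (- x) z))"
        by (rule integrableI_bounded) (use le in \<open>auto intro: le_less_trans\<close>)
      then have "ennreal (norm (\<integral>x. g x * K b (mult G (- x) z) \<partial>lborel)) \<le> ennreal (CK * u z)"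
        by (rule order_trans[OF integral_norm_bound_ennreal le])
      then show ?thesis using True CK u0[of z] by (simp add: Fb_def ennreal_le_iff)
    qed (simp add: Fb_def CK u0)
    have uq: "(\<integral>\<^sup>+z. ennreal (u z powr q) * indicator B z \<partial>lborel) \<le> ennreal (C0 * (I powr (1 / p)) powr q)"
      unfolding u_def using riesz_bound_scaled[OF rb[folded B_def] _ g gI I0] p q by simp
    have hn: "hnorm G (F z) \<le> n * CK * u z" for z
    proof -
      have "hnorm G (F z) = sqrt (\<Sum>b\<in>hbasis G. (Fb b z)\<^sup>2)" unfolding hnorm_def by (simp add: Fin)
      also have "\<dots> \<le> (\<Sum>b\<in>hbasis G. \<bar>Fb b z\<bar>)"
        using L2_set_le_sum_abs[of "\<lambda>b. Fb b z" "hbasis G"] by (simp add: L2_set_def)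
      also have "\<dots> \<le> (\<Sum>b\<in>hbasis G. CK * u z)" by (intro sum_mono Fbound)
      finally show ?thesis by (simp add: n_def)
    qed
    have hn0: "0 \<le> hnorm G v" for v by (simp add: hnorm_def sum_nonneg)
    have hnB: "hnorm G (F z) = 0" if "z \<notin> B" for z using F0[OF that] by (simp add: hnorm_def)
    have [measurable]: "(\<lambda>z. hnorm G (F z)) \<in> borel_measurable borel"
    proof -
      have "(\<lambda>z. hnorm G (F z)) = (\<lambda>z. sqrt (\<Sum>b\<in>hbasis G. (Fb b z)\<^sup>2))"
        unfolding hnorm_def by (simp add: Fin)
      then show ?thesis by simp
    qed
    have bound: "(\<integral>\<^sup>+z. ennreal (v z powr q) \<partial>lborel) \<le> ennreal ((c powr q * C0) * (I powr (1 / p)) powr q)"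
      if c: "0 \<le> c" and v: "\<And>z. 0 \<le> v z" "\<And>z. v z \<le> c * u z" "\<And>z. z \<notin> B \<Longrightarrow> v z = 0" for v c
    proof -
      have "(\<integral>\<^sup>+z. ennreal (v z powr q) \<partial>lborel) \<le> (\<integral>\<^sup>+z. ennreal (c powr q) * (ennreal (u z powr q) * indicator B z) \<partial>lborel)"
      proof (rule nn_integral_mono)
        fix z
        have "v z powr q \<le> (c * u z) powr q" using q by (intro powr_mono2 v) auto
        then show "ennreal (v z powr q) \<le> ennreal (c powr q) * (ennreal (u z powr q) * indicator B z)"
          using v(3)[of z] c u0[of z] q by (cases "z \<in> B") (auto simp: powr_mult ennreal_mult'[symmetric] intro!: ennreal_leI)
      qed
      also have "\<dots> = ennreal (c powr q) * (\<integral>\<^sup>+z. ennreal (u z powr q) * indicator B z \<partial>lborel)"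
        by (rule nn_integral_cmult) measurable
      also have "\<dots> \<le> ennreal (c powr q) * ennreal (C0 * (I powr (1 / p)) powr q)"
        by (intro mult_left_mono uq) simp
      finally show ?thesis by (simp add: ennreal_mult'[symmetric] mult_ac)
    qed
    \<comment> \<open>The closed ball of radius \<open>r\<close> is compact and, as
      \<open>1 < l\<close>, lies in \<open>B'\<close>; it is the compact set that carries
      \<open>F\<close>.\<close>
    have BB': "B \<subseteq> {y. N (mult G (- x0) y) \<le> r}" "{y. N (mult G (- x0) y) \<le> r} \<subseteq> B'"
    proof -
      have "r < l * r" using r by simp
      then show "{y. N (mult G (- x0) y) \<le> r} \<subseteq> B'" by (auto simp: B'_def hom_ball_def hom_dist_def)
      show "B \<subseteq> {y. N (mult G (- x0) y) \<le> r}" by (auto simp: B_def hom_ball_def hom_dist_def)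
    qed
    have indB': "indicator B' z * v z = v z" if "\<And>z. z \<notin> B \<Longrightarrow> v z = 0" for v :: "'a \<Rightarrow> real" and z
      using that[of z] BB' by (cases "z \<in> B'") auto
    have "in_Lp_hor G q B' F"
      unfolding in_Lp_hor_def
    proof (intro conjI ballI)
      show "horizontal_on G B' F"
        unfolding horizontal_on_def F_def
        by (intro ballI subspace_sum subspace_scale subspace_layer) (auto simp: hbasis_def)
      fix b assume b: "b \<in> hbasis G"
      have "integrable lborel (\<lambda>z. \<bar>Fb b z\<bar> powr q)"
      proof (rule integrableI_bounded)
        have "(\<integral>\<^sup>+z. ennreal (\<bar>Fb b z\<bar> powr q) \<partial>lborel) \<le> ennreal ((CK powr q * C0) * (I powr (1 / p)) powr q)"
          by (rule bound[OF CK]) (auto simp: Fbound[OF b] F0)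
        then show "(\<integral>\<^sup>+z. ennreal (norm (\<bar>Fb b z\<bar> powr q)) \<partial>lborel) < \<infinity>"
          by (auto intro: le_less_trans)
      qed measurable
      then have "integrable (lebesgue_on B') (\<lambda>z. \<bar>Fb b z\<bar> powr q)"
        using integral_lebesgue_on_borel(2)[of B' "\<lambda>z. \<bar>Fb b z\<bar> powr q"] indB'[of "\<lambda>z. \<bar>Fb b z\<bar> powr q"] F0 by simp
      moreover have "Fb b \<in> borel_measurable (lebesgue_on B')"
        by (intro measurable_restrict_space1 measurable_completion) measurable
      ultimately show "in_Lp q B' (\<lambda>z. F z \<bullet> b)" by (simp add: in_Lp_def Fin[OF b])
    qed
    moreover have "compactly_supported_in B' F"
      unfolding compactly_supported_in_def
      using compact_hom_cball[of x0 r] BB' F0(1) by (intro exI[of _ "{y. N (mult G (- x0) y) \<le> r}"]) (auto intro!: AE_I2)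
    moreover have "is_hdiv_in G B f F"
      unfolding is_hdiv_in_def
    proof (intro allI impI)
      fix \<phi> assume "test_function B \<phi>"
      then obtain D where D: "C1c \<phi> D" and DB: "\<And>x v. x \<notin> B \<Longrightarrow> D x v = 0"
        by (rule test_function_C1c) blast
      have [measurable]: "\<phi> \<in> borel_measurable borel" "lie_D D b \<in> borel_measurable borel" for b
        by (intro borel_measurable_continuous_onI csupp_cont C1cD[OF D] csupp_lie_D[OF D])+
      have lie: "lie_deriv G b \<phi> z = lie_D D b z" for b z
        using frechet_derivative_at[OF C1cD(1)[OF D]] by (simp add: lie_deriv_def lie_D_def)
      have XB: "lie_D D b z = 0" if "z \<notin> B" for b z using DB[OF that] by (simp add: lie_D_def)
      have fub: "integrable (lborel \<Otimes>\<^sub>M lborel) (\<lambda>(z, x). g x * K b (mult G (- x) z) * lie_D D b z)" if b: "b \<in> hbasis G" for b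
      proof (rule integrableI_bounded)
        obtain c where c: "0 < c" "\<And>z. \<bar>lie_D D b z\<bar> \<le> c" using csupp_bounded[OF csupp_lie_D[OF D]] by blast
        have "(\<integral>\<^sup>+w. ennreal (norm (case w of (z, x) \<Rightarrow> g x * K b (mult G (- x) z) * lie_D D b z)) \<partial>(lborel \<Otimes>\<^sub>M lborel)) =
          (\<integral>\<^sup>+z. \<integral>\<^sup>+x. ennreal (norm (g x * K b (mult G (- x) z) * lie_D D b z)) \<partial>lborel \<partial>lborel)"
          by (subst lborel.nn_integral_fst[symmetric]) auto
        also have "\<dots> \<le> (\<integral>\<^sup>+z. ennreal (CK * c) * (?J z * indicator B z) \<partial>lborel)"
        proof (rule nn_integral_mono)
          fix z
          show "(\<integral>\<^sup>+x. ennreal (norm (g x * K b (mult G (- x) z) * lie_D D b z)) \<partial>lborel) \<le> ennreal (CK * c) * (?J z * indicator B z)"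
          proof (cases "z \<in> B")
            case True
            have "(\<integral>\<^sup>+x. ennreal (norm (g x * K b (mult G (- x) z) * lie_D D b z)) \<partial>lborel) \<le> (\<integral>\<^sup>+x. ennreal (CK * c) * ennreal (\<bar>g x\<bar> * riesz_kernel x z) \<partial>lborel)"
            proof (rule nn_integral_mono_AE, use Krk[OF b, of z] in eventually_elim)
              fix x assume k: "\<bar>K b (mult G (- x) z)\<bar> \<le> CK * riesz_kernel x z"
              have "norm (g x * K b (mult G (- x) z) * lie_D D b z) \<le> \<bar>g x\<bar> * (CK * riesz_kernel x z) * c"
                unfolding real_norm_def abs_mult using CK by (intro mult_mono k c) auto
              then show "ennreal (norm (g x * K b (mult G (- x) z) * lie_D D b z)) \<le> ennreal (CK * c) * ennreal (\<bar>g x\<bar> * riesz_kernel x z)"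
                using CK c(1) by (simp add: ennreal_mult'[symmetric] ennreal_leI mult_ac)
            qed
            also have "\<dots> = ennreal (CK * c) * ?J z" unfolding riesz_def by (rule nn_integral_cmult) measurable
            finally show ?thesis using True by simp
          qed (simp add: XB)
        qed
        also have "\<dots> = ennreal (CK * c) * (\<integral>\<^sup>+z. ?J z * indicator B z \<partial>lborel)"
          by (rule nn_integral_cmult) measurable
        also have "\<dots> < \<infinity>" using Jfin by (simp add: ennreal_mult_less_top)
        finally show "(\<integral>\<^sup>+w. ennreal (norm (case w of (z, x) \<Rightarrow> g x * K b (mult G (- x) z) * lie_D D b z)) \<partial>(lborel \<Otimes>\<^sub>M lborel)) < \<infinity>" .
      qed measurable
      have JS: "AE z in lborel. z \<in> B \<longrightarrow> z \<in> S"
      proof -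
        have "AE z in lborel. ?J z * indicator B z \<noteq> \<infinity>"
          using Jfin by (intro nn_integral_noteq_infinite) auto
        then show ?thesis by eventually_elim (auto simp: S_def indicator_def less_top)
      qed
      have pairing: "(\<integral>x. g x * (\<integral>z. K b (mult G (- x) z) * lie_D D b z \<partial>lborel) \<partial>lborel) = (\<integral>z. (F z \<bullet> b) * lie_deriv G b \<phi> z \<partial>lebesgue_on B)"
        and int: "integrable lborel (\<lambda>x. g x * (\<integral>z. K b (mult G (- x) z) * lie_D D b z \<partial>lborel))" if b: "b \<in> hbasis G" for b
      proof -
        have e: "(\<integral>z. g x * K b (mult G (- x) z) * lie_D D b z \<partial>lborel) = g x * (\<integral>z. K b (mult G (- x) z) * lie_D D b z \<partial>lborel)" for x
          by (simp add: mult.assoc)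
        show "integrable lborel (\<lambda>x. g x * (\<integral>z. K b (mult G (- x) z) * lie_D D b z \<partial>lborel))"
          using lborel_pair.integrable_snd[OF fub[OF b]] by (simp add: e)
        have "(\<integral>x. g x * (\<integral>z. K b (mult G (- x) z) * lie_D D b z \<partial>lborel) \<partial>lborel) = (\<integral>x. \<integral>z. g x * K b (mult G (- x) z) * lie_D D b z \<partial>lborel \<partial>lborel)"
          by (simp only: e)
        also have "\<dots> = (\<integral>z. \<integral>x. g x * K b (mult G (- x) z) * lie_D D b z \<partial>lborel \<partial>lborel)"
          by (rule lborel_pair.Fubini_integral[OF fub[OF b]])
        also have "\<dots> = (\<integral>z. indicator B z * (Fb b z * lie_D D b z) \<partial>lborel)"
        proof (rule integral_cong_AE)
          show "AE z in lborel. (\<integral>x. g x * K b (mult G (- x) z) * lie_D D b z \<partial>lborel) = indicator B z * (Fb b z * lie_D D b z)"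
            using JS by eventually_elim (auto simp: Fb_def XB indicator_def)
          show "(\<lambda>z. \<integral>x. g x * K b (mult G (- x) z) * lie_D D b z \<partial>lborel) \<in> borel_measurable lborel"
            by (rule lborel.borel_measurable_lebesgue_integral) measurable
        qed measurable
        also have "\<dots> = (\<integral>z. Fb b z * lie_D D b z \<partial>lebesgue_on B)"
          by (rule integral_lebesgue_on_borel(1)[symmetric]) measurable
        finally show "(\<integral>x. g x * (\<integral>z. K b (mult G (- x) z) * lie_D D b z \<partial>lborel) \<partial>lborel) = (\<integral>z. (F z \<bullet> b) * lie_deriv G b \<phi> z \<partial>lebesgue_on B)"
          by (simp add: Fin[OF b] lie)
      qed
      have "(\<integral>x. f x * \<phi> x \<partial>lebesgue_on B) = (\<integral>x. g x * \<phi> x \<partial>lborel)"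
        by (rule gf) measurable
      \<comment> \<open>The representation formula at every \<open>x\<close>; its minus sign is the
        one in the distributional derivative.\<close>
      also have "\<dots> = (\<integral>x. - (\<Sum>b\<in>hbasis G. g x * (\<integral>z. K b (mult G (- x) z) * lie_D D b z \<partial>lborel)) \<partial>lborel)"
        by (intro Bochner_Integration.integral_cong refl) (subst rep[OF D], simp add: sum_distrib_left)
      also have "\<dots> = - (\<Sum>b\<in>hbasis G. \<integral>x. g x * (\<integral>z. K b (mult G (- x) z) * lie_D D b z \<partial>lborel) \<partial>lborel)"
        using int by (simp add: Bochner_Integration.integral_sum)
      also have "\<dots> = distr_hdiv G B F \<phi>"
        unfolding distr_hdiv_def distr_lie_deriv_def by (simp add: sum_negf pairing)
      finally show "(\<integral>x. f x * \<phi> x \<partial>lebesgue_on B) = distr_hdiv G B F \<phi>" .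
    qed
    moreover have "Lp_norm_hor G q B' F \<le> C * Lp_norm p B f"
    proof -
      have nCK: "0 \<le> n * CK" using CK by (simp add: n_def)
      have 1: "(\<integral>\<^sup>+z. ennreal (hnorm G (F z) powr q) \<partial>lborel) \<le> ennreal (((n * CK) powr q * C0) * (I powr (1 / p)) powr q)"
        by (rule bound[OF nCK hn0 hn hnB])
      have "(\<integral>z. \<bar>hnorm G (F z)\<bar> powr q \<partial>lebesgue_on B') = (\<integral>z. hnorm G (F z) powr q \<partial>lborel)"
        using integral_lebesgue_on_borel(1)[of B' "\<lambda>z. \<bar>hnorm G (F z)\<bar> powr q"] indB'[of "\<lambda>z. hnorm G (F z) powr q"] hnB hn0 by simp
      also have "\<dots> = enn2real (\<integral>\<^sup>+z. ennreal (hnorm G (F z) powr q) \<partial>lborel)"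
        by (rule integral_eq_nn_integral) auto
      also have "\<dots> \<le> ((n * CK) powr q * C0) * (I powr (1 / p)) powr q"
        using enn2real_mono[OF 1] C0 by simp
      finally have "Lp_norm_hor G q B' F \<le> (((n * CK) powr q * C0) * (I powr (1 / p)) powr q) powr (1 / q)"
        unfolding Lp_norm_hor_def Lp_norm_def using q by (intro powr_mono2) (auto intro: integral_nonneg)
      also have "\<dots> = C * I powr (1 / p)"
        using nCK C0 q I0 CK by (simp add: powr_mult powr_powr C_def n_def)
      finally show ?thesis by (simp add: Lp_norm_def I_def)
    qed
    ultimately show ?thesis unfolding B_def B'_def by blast
  qed
  then show thesis by (rule that)
qed

end

theorem theorem3p1:
  fixes G :: "('a::euclidean_space) stratified"
    and N :: "'a \<Rightarrow> real"
    and p q l :: real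
  assumes "carnot G"
    and "hom_norm G N"
    and "1 \<le> p" and "p < real (hom_dim G)"
    and "1 < l"
    and "(1 < p \<and> 1 \<le> q \<and> q \<le> p * real (hom_dim G) / (real (hom_dim G) - p)) \<or>
         (p = 1 \<and> 1 \<le> q \<and> q < real (hom_dim G) / (real (hom_dim G) - 1))"
  shows "(\<exists>C::real. \<forall>f.
            in_Lp p (hom_ball G N 0 1) f \<and>
            compactly_supported_in (hom_ball G N 0 1) f \<and>
            (\<integral>y. f y \<partial>lebesgue_on (hom_ball G N 0 1)) = 0 \<longrightarrow>
            (\<exists>F. in_Lp_hor G q (hom_ball G N 0 l) F \<and>
                 compactly_supported_in (hom_ball G N 0 l) F \<and>
                 is_hdiv_in G (hom_ball G N 0 1) f F \<and>
                 Lp_norm_hor G q (hom_ball G N 0 l) F \<le> C * Lp_norm p (hom_ball G N 0 1) f)) \<and>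
         (1 < p \<and> q = p * real (hom_dim G) / (real (hom_dim G) - p) \<longrightarrow>
          (\<exists>C::real. \<forall>x. \<forall>r>0. \<forall>f.
            in_Lp p (hom_ball G N x r) f \<and>
            compactly_supported_in (hom_ball G N x r) f \<and>
            (\<integral>y. f y \<partial>lebesgue_on (hom_ball G N x r)) = 0 \<longrightarrow>
            (\<exists>F. in_Lp_hor G q (hom_ball G N x (l * r)) F \<and>
                 compactly_supported_in (hom_ball G N x (l * r)) F \<and>
                 is_hdiv_in G (hom_ball G N x r) f F \<and>
                 Lp_norm_hor G q (hom_ball G N x (l * r)) F \<le> C * Lp_norm p (hom_ball G N x r) f)))"
proof -
  interpret carnot_norm G N by unfold_locales (use assms in auto)
  have Q: "1 < hom_dim G" using assms(3,4) by linarith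
  have q: "1 \<le> q" using assms(6) by auto
  \<comment> \<open>For the fixed unit ball the constant may contain its measure.\<close>
  have "\<exists>C\<ge>0. riesz_bound p q (hom_ball G N 0 1) C"
  proof (cases "1 < p")
    case True
    obtain C where C: "\<And>B. riesz_bound p (p * real Q / (real Q - p)) B C"
      using riesz_bound_endpoint[OF True assms(4)] by blast
    have "riesz_bound p q (hom_ball G N 0 1) (measure lborel (hom_ball G N 0 1) + max 0 C)"
      by (rule riesz_bound_subcritical[OF hom_ball_borel emeasure_hom_ball_finite C]) (use q True assms(6) in auto)
    then show ?thesis by (intro exI[of _ "measure lborel (hom_ball G N 0 1) + max 0 C"]) simp
  next
    case False
    then have p1: "p = 1" and "q < real Q / (real Q - 1)" using assms(6) by auto
    then have "q * (real Q - 1) < real Q" using Q by (simp add: field_simps)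
    then obtain C where C: "riesz_bound 1 q (hom_ball G N 0 1) C"
      using riesz_bound_1[OF hom_ball_borel emeasure_hom_ball_finite q _ Q] by blast
    have "ennreal C \<le> ennreal (max 0 C)" by (intro ennreal_leI) simp
    then have "riesz_bound 1 q (hom_ball G N 0 1) (max 0 C)"
      using C unfolding riesz_bound_def by (meson order_trans)
    then show ?thesis using p1 by (intro exI[of _ "max 0 C"]) simp
  qed
  then obtain C0 where C0: "0 \<le> C0" "riesz_bound p q (hom_ball G N 0 1) C0" by blast
  obtain C where C: "\<And>x r l f. 0 < r \<Longrightarrow> 1 < l \<Longrightarrow> riesz_bound p q (hom_ball G N x r) C0 \<Longrightarrow>
    in_Lp p (hom_ball G N x r) f \<Longrightarrow>
    \<exists>F. in_Lp_hor G q (hom_ball G N x (l * r)) F \<and> compactly_supported_in (hom_ball G N x (l * r)) F \<and>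
      is_hdiv_in G (hom_ball G N x r) f F \<and>
      Lp_norm_hor G q (hom_ball G N x (l * r)) F \<le> C * Lp_norm p (hom_ball G N x r) f"
    using horizontal_solution[OF Q assms(3) q C0(1)] by blast
  show ?thesis
  proof (intro conjI impI)
    show "\<exists>C::real. \<forall>f. in_Lp p (hom_ball G N 0 1) f \<and> compactly_supported_in (hom_ball G N 0 1) f \<and>
            (\<integral>y. f y \<partial>lebesgue_on (hom_ball G N 0 1)) = 0 \<longrightarrow>
            (\<exists>F. in_Lp_hor G q (hom_ball G N 0 l) F \<and>
                 compactly_supported_in (hom_ball G N 0 l) F \<and>
                 is_hdiv_in G (hom_ball G N 0 1) f F \<and>
                 Lp_norm_hor G q (hom_ball G N 0 l) F \<le> C * Lp_norm p (hom_ball G N 0 1) f)"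
      using C[OF zero_less_one assms(5) C0(2)] by (intro exI[of _ C]) simp
    \<comment> \<open>At the endpoint one constant in \<open>riesz_bound\<close> serves every set,
      hence every ball, and \<open>horizontal_solution\<close> preserves this uniformity.\<close>
    assume e: "1 < p \<and> q = p * real Q / (real Q - p)"
    then obtain C1 where C1: "\<And>B. riesz_bound p q B C1"
      using riesz_bound_endpoint[of p] assms(4) by metis
    have "ennreal C1 \<le> ennreal (max 0 C1)" by (intro ennreal_leI) simp
    then have C2: "riesz_bound p q B (max 0 C1)" for B
      using C1[of B] unfolding riesz_bound_def by (meson order_trans)
    obtain C' where C': "\<And>x r l f. 0 < r \<Longrightarrow> 1 < l \<Longrightarrow> riesz_bound p q (hom_ball G N x r) (max 0 C1) \<Longrightarrow>
      in_Lp p (hom_ball G N x r) f \<Longrightarrow>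
      \<exists>F. in_Lp_hor G q (hom_ball G N x (l * r)) F \<and> compactly_supported_in (hom_ball G N x (l * r)) F \<and>
        is_hdiv_in G (hom_ball G N x r) f F \<and>
        Lp_norm_hor G q (hom_ball G N x (l * r)) F \<le> C' * Lp_norm p (hom_ball G N x r) f"
      using horizontal_solution[OF Q assms(3) q, of "max 0 C1"] by (metis max.cobounded1)
    show "\<exists>C::real. \<forall>x. \<forall>r>0. \<forall>f.
            in_Lp p (hom_ball G N x r) f \<and>
            compactly_supported_in (hom_ball G N x r) f \<and>
            (\<integral>y. f y \<partial>lebesgue_on (hom_ball G N x r)) = 0 \<longrightarrow>
            (\<exists>F. in_Lp_hor G q (hom_ball G N x (l * r)) F \<and>
                 compactly_supported_in (hom_ball G N x (l * r)) F \<and>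
                 is_hdiv_in G (hom_ball G N x r) f F \<and>
                 Lp_norm_hor G q (hom_ball G N x (l * r)) F \<le> C * Lp_norm p (hom_ball G N x r) f)"
      using C'[OF _ assms(5) C2] by (intro exI[of _ C']) blast
  qed
qed

end
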